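(* Let $\mathcal{C}$ be a triangulated category with a twin cotorsion pair $((\mathcal{S},\mathcal{T}),(\mathcal{U},\mathcal{V}))$. If $\mathcal{H}=\mathcal{C}^{-}$ or $\mathcal{H}=\mathcal{C}^{+}$, then the additive quotient category $\overline{\mathcal{H}}=\mathcal{H}/[\mathcal{W}]$ is quasi-abelian.
   Context: $\Sigma$ denotes the suspension functor of $\mathcal{C}$, "triangle" means distinguished triangle, and $\operatorname{Ext}^{1}_{\mathcal{C}}(X,Y)=\operatorname{Hom}_{\mathcal{C}}(X,\Sigma Y)$. For full subcategories $\mathcal{X},\mathcal{Y}$ of $\mathcal{C}$, $\mathcal{X}*\mathcal{Y}$ is the full subcategory of objects $C$ for which there is a triangle $X\to C\to Y\to\Sigma X$ with $X\in\mathcal{X}$, $Y\in\mathcal{Y}$. A cotorsion pair on $\mathcal{C}$ is a pair $(\mathcal{U},\mathcal{V})$ of full, additive subcategories closed under isomorphisms and direct summands such that $\operatorname{Ext}^{1}_{\mathcal{C}}(U,V)=0$ for all $U\in\mathcal{U}$, $V\in\mathcal{V}$, and $\mathcal{C}=\mathcal{U}*\Sigma\mathcal{V}$. A twin cotorsion pair $((\mathcal{S},\mathcal{T}),(\mathcal{U},\mathcal{V}))$ is a pair of cotorsion pairs on $\mathcal{C}$ with $\operatorname{Ext}^{1}_{\mathcal{C}}(\mathcal{S},\mathcal{V})=0$ (equivalently $\mathcal{S}\subseteq\mathcal{U}$, equivalently $\mathcal{V}\subseteq\mathcal{T}$). Given a twin cotorsion pair, define full subcategories $\mathcal{W}=\mathcal{T}\cap\mathcal{U}$,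 $\mathcal{C}^{-}=\Sigma^{-1}\mathcal{S}*\mathcal{W}$, $\mathcal{C}^{+}=\mathcal{W}*\Sigma\mathcal{V}$, $\mathcal{H}=\mathcal{C}^{-}\cap\mathcal{C}^{+}$. $[\mathcal{W}]$ is the ideal of morphisms factoring through an object of $\mathcal{W}$, and $\overline{\mathcal{H}}=\mathcal{H}/[\mathcal{W}]$ is called the heart of the twin cotorsion pair. A preabelian category is an additive category in which every morphism has a kernel and a cokernel. A preabelian category is quasi-abelian if cokernels (morphisms that are a cokernel of some morphism) are stable under pullback and kernels (morphisms that are a kernel of some morphism) are stable under pushout. *)

theory Defs
  imports "HOL-Algebra.Group"
begin

section \<open>Categories enriched in abelian groups\<close>

text \<open>
  A category is given by a set of objects and a set of morphisms for each pair of objects. The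
  fields carry meaning only for objects in \<open>Obj\<close> and for morphisms between such objects. The
  hom-sets are pairwise disjoint, so that composition and addition need no object arguments.
\<close>

record ('o, 'm) cat =
  Obj :: "'o set"
  Hom :: "'o \<Rightarrow> 'o \<Rightarrow> 'm set"
  Ide :: "'o \<Rightarrow> 'm"
  Comp :: "'m \<Rightarrow> 'm \<Rightarrow> 'm" (infixr "\<cdot>\<index>" 75)
  Add :: "'m \<Rightarrow> 'm \<Rightarrow> 'm" (infixl "\<boxplus>\<index>" 65)
  Zero :: "'o \<Rightarrow> 'o \<Rightarrow> 'm"

locale category =
  fixes C :: "('o, 'm, 'z) cat_scheme" (structure)
  assumes hom_disjoint:
      "\<lbrakk>X \<in> Obj C; Y \<in> Obj C; X' \<in> Obj C; Y' \<in> Obj C; f \<in> Hom C X Y; f \<in> Hom C X' Y'\<rbrakk>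
        \<Longrightarrow> X = X' \<and> Y = Y'"
    and ide_in_hom: "X \<in> Obj C \<Longrightarrow> Ide C X \<in> Hom C X X"
    and comp_in_hom:
      "\<lbrakk>X \<in> Obj C; Y \<in> Obj C; Z \<in> Obj C; f \<in> Hom C X Y; g \<in> Hom C Y Z\<rbrakk>
        \<Longrightarrow> g \<cdot> f \<in> Hom C X Z"
    and comp_ide_right: "\<lbrakk>X \<in> Obj C; Y \<in> Obj C; f \<in> Hom C X Y\<rbrakk> \<Longrightarrow> f \<cdot> Ide C X = f"
    and comp_ide_left: "\<lbrakk>X \<in> Obj C; Y \<in> Obj C; f \<in> Hom C X Y\<rbrakk> \<Longrightarrow> Ide C Y \<cdot> f = f"
    and comp_assoc:
      "\<lbrakk>W \<in> Obj C; X \<in> Obj C; Y \<in> Obj C; Z \<in> Obj C;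
        f \<in> Hom C W X; g \<in> Hom C X Y; h \<in> Hom C Y Z\<rbrakk>
        \<Longrightarrow> (h \<cdot> g) \<cdot> f = h \<cdot> (g \<cdot> f)"

definition hom_group :: "('o, 'm, 'z) cat_scheme \<Rightarrow> 'o \<Rightarrow> 'o \<Rightarrow> 'm monoid" where
  "hom_group C X Y = \<lparr>carrier = Hom C X Y, monoid.mult = Add C, one = Zero C X Y\<rparr>"

definition neg :: "('o, 'm, 'z) cat_scheme \<Rightarrow> 'o \<Rightarrow> 'o \<Rightarrow> 'm \<Rightarrow> 'm" where
  "neg C X Y f = inv\<^bsub>hom_group C X Y\<^esub> f"

locale preadditive_category = category +
  assumes hom_comm_group: "\<lbrakk>X \<in> Obj C; Y \<in> Obj C\<rbrakk> \<Longrightarrow> comm_group (hom_group C X Y)"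
    and comp_add_right:
      "\<lbrakk>X \<in> Obj C; Y \<in> Obj C; Z \<in> Obj C; f \<in> Hom C X Y; f' \<in> Hom C X Y; g \<in> Hom C Y Z\<rbrakk>
        \<Longrightarrow> g \<cdot> (f \<boxplus> f') = g \<cdot> f \<boxplus> g \<cdot> f'"
    and comp_add_left:
      "\<lbrakk>X \<in> Obj C; Y \<in> Obj C; Z \<in> Obj C; f \<in> Hom C X Y; g \<in> Hom C Y Z; g' \<in> Hom C Y Z\<rbrakk>
        \<Longrightarrow> (g \<boxplus> g') \<cdot> f = g \<cdot> f \<boxplus> g' \<cdot> f"

definition is_zero_object :: "('o, 'm, 'z) cat_scheme \<Rightarrow> 'o \<Rightarrow> bool" where
  "is_zero_object C Z \<longleftrightarrow> Z \<in> Obj C \<and>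
     (\<forall>X \<in> Obj C. (\<exists>!f. f \<in> Hom C X Z) \<and> (\<exists>!f. f \<in> Hom C Z X))"

definition is_biproduct ::
    "('o, 'm, 'z) cat_scheme \<Rightarrow> 'o \<Rightarrow> 'o \<Rightarrow> 'o \<Rightarrow> 'm \<Rightarrow> 'm \<Rightarrow> 'm \<Rightarrow> 'm \<Rightarrow> bool" where
  "is_biproduct C X Y P i j p q \<longleftrightarrow>
     X \<in> Obj C \<and> Y \<in> Obj C \<and> P \<in> Obj C \<and>
     i \<in> Hom C X P \<and> j \<in> Hom C Y P \<and> p \<in> Hom C P X \<and> q \<in> Hom C P Y \<and>
     p \<cdot>\<^bsub>C\<^esub> i = Ide C X \<and> q \<cdot>\<^bsub>C\<^esub> j = Ide C Y \<and>
     p \<cdot>\<^bsub>C\<^esub> j = Zero C Y X \<and> q \<cdot>\<^bsub>C\<^esub> i = Zero C X Y \<and>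
     i \<cdot>\<^bsub>C\<^esub> p \<boxplus>\<^bsub>C\<^esub> j \<cdot>\<^bsub>C\<^esub> q = Ide C P"

locale additive_category = preadditive_category +
  assumes ex_zero_object: "\<exists>Z. is_zero_object C Z"
    and ex_biproduct:
      "\<lbrakk>X \<in> Obj C; Y \<in> Obj C\<rbrakk> \<Longrightarrow> \<exists>P i j p q. is_biproduct C X Y P i j p q"

definition is_iso :: "('o, 'm, 'z) cat_scheme \<Rightarrow> 'o \<Rightarrow> 'o \<Rightarrow> 'm \<Rightarrow> bool" where
  "is_iso C X Y f \<longleftrightarrow> X \<in> Obj C \<and> Y \<in> Obj C \<and> f \<in> Hom C X Y \<and>
     (\<exists>g \<in> Hom C Y X. g \<cdot>\<^bsub>C\<^esub> f = Ide C X \<and> f \<cdot>\<^bsub>C\<^esub> g = Ide C Y)"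

definition isomorphic :: "('o, 'm, 'z) cat_scheme \<Rightarrow> 'o \<Rightarrow> 'o \<Rightarrow> bool" where
  "isomorphic C X Y \<longleftrightarrow> (\<exists>f. is_iso C X Y f)"


section \<open>Quasi-abelian categories\<close>

definition is_kernel :: "('o, 'm, 'z) cat_scheme \<Rightarrow> 'o \<Rightarrow> 'o \<Rightarrow> 'o \<Rightarrow> 'm \<Rightarrow> 'm \<Rightarrow> bool" where
  "is_kernel C K X Y k f \<longleftrightarrow>
     K \<in> Obj C \<and> X \<in> Obj C \<and> Y \<in> Obj C \<and> k \<in> Hom C K X \<and> f \<in> Hom C X Y \<and>
     f \<cdot>\<^bsub>C\<^esub> k = Zero C K Y \<and>
     (\<forall>Z \<in> Obj C. \<forall>z \<in> Hom C Z X. f \<cdot>\<^bsub>C\<^esub> z = Zero C Z Y \<longrightarrow>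
        (\<exists>!u. u \<in> Hom C Z K \<and> k \<cdot>\<^bsub>C\<^esub> u = z))"

definition is_cokernel :: "('o, 'm, 'z) cat_scheme \<Rightarrow> 'o \<Rightarrow> 'o \<Rightarrow> 'o \<Rightarrow> 'm \<Rightarrow> 'm \<Rightarrow> bool" where
  "is_cokernel C X Y K f c \<longleftrightarrow>
     X \<in> Obj C \<and> Y \<in> Obj C \<and> K \<in> Obj C \<and> f \<in> Hom C X Y \<and> c \<in> Hom C Y K \<and>
     c \<cdot>\<^bsub>C\<^esub> f = Zero C X K \<and>
     (\<forall>Z \<in> Obj C. \<forall>z \<in> Hom C Y Z. z \<cdot>\<^bsub>C\<^esub> f = Zero C X Z \<longrightarrow>
        (\<exists>!u. u \<in> Hom C K Z \<and> u \<cdot>\<^bsub>C\<^esub> c = z))"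

definition kernel_morphism :: "('o, 'm, 'z) cat_scheme \<Rightarrow> 'o \<Rightarrow> 'o \<Rightarrow> 'm \<Rightarrow> bool" where
  "kernel_morphism C K X k \<longleftrightarrow> (\<exists>Y f. is_kernel C K X Y k f)"

definition cokernel_morphism :: "('o, 'm, 'z) cat_scheme \<Rightarrow> 'o \<Rightarrow> 'o \<Rightarrow> 'm \<Rightarrow> bool" where
  "cokernel_morphism C Y K c \<longleftrightarrow> (\<exists>X f. is_cokernel C X Y K f c)"

text \<open>
  The square with \<open>p : P \<rightarrow> X\<close>, \<open>q : P \<rightarrow> Y\<close>, \<open>f : X \<rightarrow> Z\<close>, \<open>g : Y \<rightarrow> Z\<close> is a pullback; below,
  the square with \<open>f : Z \<rightarrow> X\<close>, \<open>g : Z \<rightarrow> Y\<close>, \<open>i : X \<rightarrow> P\<close>, \<open>j : Y \<rightarrow> P\<close> is a pushout.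
\<close>

definition is_pullback ::
    "('o, 'm, 'z) cat_scheme \<Rightarrow> 'o \<Rightarrow> 'o \<Rightarrow> 'o \<Rightarrow> 'o \<Rightarrow> 'm \<Rightarrow> 'm \<Rightarrow> 'm \<Rightarrow> 'm \<Rightarrow> bool" where
  "is_pullback C P X Y Z p q f g \<longleftrightarrow>
     P \<in> Obj C \<and> X \<in> Obj C \<and> Y \<in> Obj C \<and> Z \<in> Obj C \<and>
     p \<in> Hom C P X \<and> q \<in> Hom C P Y \<and> f \<in> Hom C X Z \<and> g \<in> Hom C Y Z \<and>
     f \<cdot>\<^bsub>C\<^esub> p = g \<cdot>\<^bsub>C\<^esub> q \<and>
     (\<forall>A \<in> Obj C. \<forall>a \<in> Hom C A X. \<forall>b \<in> Hom C A Y. f \<cdot>\<^bsub>C\<^esub> a = g \<cdot>\<^bsub>C\<^esub> b \<longrightarrow>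
        (\<exists>!u. u \<in> Hom C A P \<and> p \<cdot>\<^bsub>C\<^esub> u = a \<and> q \<cdot>\<^bsub>C\<^esub> u = b))"

definition is_pushout ::
    "('o, 'm, 'z) cat_scheme \<Rightarrow> 'o \<Rightarrow> 'o \<Rightarrow> 'o \<Rightarrow> 'o \<Rightarrow> 'm \<Rightarrow> 'm \<Rightarrow> 'm \<Rightarrow> 'm \<Rightarrow> bool" where
  "is_pushout C Z X Y P f g i j \<longleftrightarrow>
     Z \<in> Obj C \<and> X \<in> Obj C \<and> Y \<in> Obj C \<and> P \<in> Obj C \<and>
     f \<in> Hom C Z X \<and> g \<in> Hom C Z Y \<and> i \<in> Hom C X P \<and> j \<in> Hom C Y P \<and>
     i \<cdot>\<^bsub>C\<^esub> f = j \<cdot>\<^bsub>C\<^esub> g \<and>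
     (\<forall>A \<in> Obj C. \<forall>a \<in> Hom C X A. \<forall>b \<in> Hom C Y A. a \<cdot>\<^bsub>C\<^esub> f = b \<cdot>\<^bsub>C\<^esub> g \<longrightarrow>
        (\<exists>!u. u \<in> Hom C P A \<and> u \<cdot>\<^bsub>C\<^esub> i = a \<and> u \<cdot>\<^bsub>C\<^esub> j = b))"

locale preabelian_category = additive_category +
  assumes ex_kernel:
      "\<lbrakk>X \<in> Obj C; Y \<in> Obj C; f \<in> Hom C X Y\<rbrakk> \<Longrightarrow> \<exists>K k. is_kernel C K X Y k f"
    and ex_cokernel:
      "\<lbrakk>X \<in> Obj C; Y \<in> Obj C; f \<in> Hom C X Y\<rbrakk> \<Longrightarrow> \<exists>K c. is_cokernel C X Y K f c"

locale quasi_abelian_category = preabelian_category +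
  assumes cokernel_pullback_stable:
      "\<lbrakk>is_pullback C P X Y Z p q f g; cokernel_morphism C X Z f\<rbrakk> \<Longrightarrow> cokernel_morphism C P Y q"
    and kernel_pushout_stable:
      "\<lbrakk>is_pushout C Z X Y P f g i j; kernel_morphism C Z X f\<rbrakk> \<Longrightarrow> kernel_morphism C Y P j"


section \<open>Triangulated categories\<close>

text \<open>
  \<open>Susp\<close> and \<open>SuspM\<close> are the object and morphism parts of the suspension functor. Only the
  members \<open>(f, g, h)\<close> of \<open>Dist\<close> that form a sextuple \<open>X \<rightarrow> Y \<rightarrow> Z \<rightarrow> Susp X\<close> matter.
\<close>

record ('o, 'm) tcat = "('o, 'm) cat" +
  Susp :: "'o \<Rightarrow> 'o"
  SuspM :: "'m \<Rightarrow> 'm"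
  Dist :: "('m \<times> 'm \<times> 'm) set"

definition candidate_triangle ::
    "('o, 'm, 'z) tcat_scheme \<Rightarrow> 'o \<Rightarrow> 'o \<Rightarrow> 'o \<Rightarrow> 'm \<Rightarrow> 'm \<Rightarrow> 'm \<Rightarrow> bool" where
  "candidate_triangle C X Y Z f g h \<longleftrightarrow> X \<in> Obj C \<and> Y \<in> Obj C \<and> Z \<in> Obj C \<and>
     f \<in> Hom C X Y \<and> g \<in> Hom C Y Z \<and> h \<in> Hom C Z (Susp C X)"

definition triangle ::
    "('o, 'm, 'z) tcat_scheme \<Rightarrow> 'o \<Rightarrow> 'o \<Rightarrow> 'o \<Rightarrow> 'm \<Rightarrow> 'm \<Rightarrow> 'm \<Rightarrow> bool" where
  "triangle C X Y Z f g h \<longleftrightarrow> candidate_triangle C X Y Z f g h \<and> (f, g, h) \<in> Dist C"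

text \<open>
  Verdier's axioms. The suspension is only required to be an additive autoequivalence, which
  covers the convention that it is an automorphism.
\<close>

locale triangulated_category = additive_category C for C :: "('o, 'm, 'z) tcat_scheme" (structure) +
  assumes susp_obj: "X \<in> Obj C \<Longrightarrow> Susp C X \<in> Obj C"
    and susp_ide: "X \<in> Obj C \<Longrightarrow> SuspM C (Ide C X) = Ide C (Susp C X)"
    and susp_comp:
      "\<lbrakk>X \<in> Obj C; Y \<in> Obj C; Z \<in> Obj C; f \<in> Hom C X Y; g \<in> Hom C Y Z\<rbrakk>
        \<Longrightarrow> SuspM C (g \<cdot> f) = SuspM C g \<cdot> SuspM C f"
    and susp_add:
      "\<lbrakk>X \<in> Obj C; Y \<in> Obj C; f \<in> Hom C X Y; g \<in> Hom C X Y\<rbrakk>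
        \<Longrightarrow> SuspM C (f \<boxplus> g) = SuspM C f \<boxplus> SuspM C g"
    and susp_fully_faithful:
      "\<lbrakk>X \<in> Obj C; Y \<in> Obj C\<rbrakk>
        \<Longrightarrow> bij_betw (SuspM C) (Hom C X Y) (Hom C (Susp C X) (Susp C Y))"
    and susp_ess_surj: "Y \<in> Obj C \<Longrightarrow> \<exists>X \<in> Obj C. isomorphic C (Susp C X) Y"
    and TR1_ide:
      "\<lbrakk>X \<in> Obj C; is_zero_object C Z\<rbrakk>
        \<Longrightarrow> triangle C X X Z (Ide C X) (Zero C X Z) (Zero C Z (Susp C X))"
    and TR1_cone:
      "\<lbrakk>X \<in> Obj C; Y \<in> Obj C; f \<in> Hom C X Y\<rbrakk> \<Longrightarrow> \<exists>Z g h. triangle C X Y Z f g h"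
    and TR1_iso:
      "\<lbrakk>triangle C X Y Z f g h; candidate_triangle C X' Y' Z' f' g' h';
        is_iso C X X' a; is_iso C Y Y' b; is_iso C Z Z' c;
        b \<cdot> f = f' \<cdot> a; c \<cdot> g = g' \<cdot> b; SuspM C a \<cdot> h = h' \<cdot> c\<rbrakk>
        \<Longrightarrow> triangle C X' Y' Z' f' g' h'"
    and TR2:
      "candidate_triangle C X Y Z f g h
        \<Longrightarrow> triangle C X Y Z f g h \<longleftrightarrow>
            triangle C Y Z (Susp C X) g h (neg C (Susp C X) (Susp C Y) (SuspM C f))"
    and TR3:
      "\<lbrakk>triangle C X Y Z f g h; triangle C X' Y' Z' f' g' h';
        a \<in> Hom C X X'; b \<in> Hom C Y Y'; b \<cdot> f = f' \<cdot> a\<rbrakk>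
        \<Longrightarrow> \<exists>c \<in> Hom C Z Z'. c \<cdot> g = g' \<cdot> b \<and> SuspM C a \<cdot> h = h' \<cdot> c"
    and TR4:
      "\<lbrakk>triangle C X Y Z' f u u'; triangle C Y Z X' g v v'; triangle C X Z Y' (g \<cdot> f) w w'\<rbrakk>
        \<Longrightarrow> \<exists>m n. triangle C Z' Y' X' m n (SuspM C u \<cdot> v') \<and>
              m \<cdot> u = w \<cdot> g \<and> w' \<cdot> m = u' \<and> n \<cdot> w = v \<and> v' \<cdot> n = SuspM C f \<cdot> w'"


section \<open>Twin cotorsion pairs\<close>

text \<open>Full subcategories are identified with their sets of objects.\<close>

definition full_subcategory :: "('o, 'm, 'z) cat_scheme \<Rightarrow> 'o set \<Rightarrow> ('o, 'm) cat" where
  "full_subcategory C U =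
     \<lparr>Obj = U, Hom = Hom C, Ide = Ide C, Comp = Comp C, Add = Add C, Zero = Zero C\<rparr>"

definition additive_subcategory :: "('o, 'm, 'z) cat_scheme \<Rightarrow> 'o set \<Rightarrow> bool" where
  "additive_subcategory C U \<longleftrightarrow> U \<subseteq> Obj C \<and> additive_category (full_subcategory C U)"

definition closed_under_isos :: "('o, 'm, 'z) cat_scheme \<Rightarrow> 'o set \<Rightarrow> bool" where
  "closed_under_isos C U \<longleftrightarrow> (\<forall>X Y. X \<in> U \<and> isomorphic C X Y \<longrightarrow> Y \<in> U)"

definition closed_under_summands :: "('o, 'm, 'z) cat_scheme \<Rightarrow> 'o set \<Rightarrow> bool" where
  "closed_under_summands C U \<longleftrightarrow>
     (\<forall>X Y P i j p q. is_biproduct C X Y P i j p q \<and> P \<in> U \<longrightarrow> X \<in> U \<and> Y \<in> U)"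

definition Ext1 :: "('o, 'm, 'z) tcat_scheme \<Rightarrow> 'o \<Rightarrow> 'o \<Rightarrow> 'm set" where
  "Ext1 C X Y = Hom C X (Susp C Y)"

definition Ext1_vanishes :: "('o, 'm, 'z) tcat_scheme \<Rightarrow> 'o set \<Rightarrow> 'o set \<Rightarrow> bool" where
  "Ext1_vanishes C U V \<longleftrightarrow> (\<forall>X \<in> U. \<forall>Y \<in> V. Ext1 C X Y = {Zero C X (Susp C Y)})"

definition star :: "('o, 'm, 'z) tcat_scheme \<Rightarrow> 'o set \<Rightarrow> 'o set \<Rightarrow> 'o set" where
  "star C XX YY = {E \<in> Obj C. \<exists>X \<in> XX. \<exists>Y \<in> YY. \<exists>f g h. triangle C X E Y f g h}"

text \<open>
  Since the suspension is an autoequivalence, images and preimages of full subcategories under it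
  are closed up under isomorphism.
\<close>

definition susp_set :: "('o, 'm, 'z) tcat_scheme \<Rightarrow> 'o set \<Rightarrow> 'o set" where
  "susp_set C U = {Y \<in> Obj C. \<exists>X \<in> U. isomorphic C (Susp C X) Y}"

definition desusp_set :: "('o, 'm, 'z) tcat_scheme \<Rightarrow> 'o set \<Rightarrow> 'o set" where
  "desusp_set C U = {X \<in> Obj C. \<exists>Y \<in> U. isomorphic C (Susp C X) Y}"

definition cotorsion_pair :: "('o, 'm, 'z) tcat_scheme \<Rightarrow> 'o set \<Rightarrow> 'o set \<Rightarrow> bool" where
  "cotorsion_pair C U V \<longleftrightarrow>
     additive_subcategory C U \<and> closed_under_isos C U \<and> closed_under_summands C U \<and>
     additive_subcategory C V \<and> closed_under_isos C V \<and> closed_under_summands C V \<and>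
     Ext1_vanishes C U V \<and> Obj C = star C U (susp_set C V)"

definition twin_cotorsion_pair ::
    "('o, 'm, 'z) tcat_scheme \<Rightarrow> 'o set \<Rightarrow> 'o set \<Rightarrow> 'o set \<Rightarrow> 'o set \<Rightarrow> bool" where
  "twin_cotorsion_pair C S T U V \<longleftrightarrow>
     cotorsion_pair C S T \<and> cotorsion_pair C U V \<and> Ext1_vanishes C S V"

definition twin_W :: "'o set \<Rightarrow> 'o set \<Rightarrow> 'o set" where
  "twin_W T U = T \<inter> U"

definition twin_C_minus :: "('o, 'm, 'z) tcat_scheme \<Rightarrow> 'o set \<Rightarrow> 'o set \<Rightarrow> 'o set \<Rightarrow> 'o set" where
  "twin_C_minus C S T U = star C (desusp_set C S) (twin_W T U)"

definition twin_C_plus :: "('o, 'm, 'z) tcat_scheme \<Rightarrow> 'o set \<Rightarrow> 'o set \<Rightarrow> 'o set \<Rightarrow> 'o set" where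
  "twin_C_plus C T U V = star C (twin_W T U) (susp_set C V)"

definition twin_H ::
    "('o, 'm, 'z) tcat_scheme \<Rightarrow> 'o set \<Rightarrow> 'o set \<Rightarrow> 'o set \<Rightarrow> 'o set \<Rightarrow> 'o set" where
  "twin_H C S T U V = twin_C_minus C S T U \<inter> twin_C_plus C T U V"


section \<open>Quotient by an ideal and the heart\<close>

definition factor_ideal :: "('o, 'm, 'z) cat_scheme \<Rightarrow> 'o set \<Rightarrow> 'm set" where
  "factor_ideal C WW = {b \<cdot>\<^bsub>C\<^esub> a | a b X W Y.
     X \<in> Obj C \<and> Y \<in> Obj C \<and> W \<in> WW \<and> a \<in> Hom C X W \<and> b \<in> Hom C W Y}"

text \<open>
  For \<open>f : X \<rightarrow> Y\<close> in \<open>C\<close>, this is the coset of \<open>f\<close> modulo the part of the ideal \<open>J\<close> in \<open>Hom C X Y\<close>.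
\<close>

definition ideal_coset :: "('o, 'm, 'z) cat_scheme \<Rightarrow> 'm set \<Rightarrow> 'm \<Rightarrow> 'm set" where
  "ideal_coset C J f = {f \<boxplus>\<^bsub>C\<^esub> j | j X Y.
     X \<in> Obj C \<and> Y \<in> Obj C \<and> f \<in> Hom C X Y \<and> j \<in> Hom C X Y \<and> j \<in> J}"

text \<open>
  Composition and addition of cosets are those of representatives: for a two-sided ideal \<open>J\<close> all
  members of the unions below coincide.
\<close>

definition quotient_category ::
    "('o, 'm, 'z) cat_scheme \<Rightarrow> 'm set \<Rightarrow> ('o, 'm set) cat" where
  "quotient_category C J =
     \<lparr>Obj = Obj C,
      Hom = (\<lambda>X Y. ideal_coset C J ` Hom C X Y),
      Ide = (\<lambda>X. ideal_coset C J (Ide C X)),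
      Comp = (\<lambda>G F. \<Union>g \<in> G. \<Union>f \<in> F. ideal_coset C J (g \<cdot>\<^bsub>C\<^esub> f)),
      Add = (\<lambda>F G. \<Union>f \<in> F. \<Union>g \<in> G. ideal_coset C J (f \<boxplus>\<^bsub>C\<^esub> g)),
      Zero = (\<lambda>X Y. ideal_coset C J (Zero C X Y))\<rparr>"

definition heart ::
    "('o, 'm, 'z) tcat_scheme \<Rightarrow> 'o set \<Rightarrow> 'o set \<Rightarrow> 'o set \<Rightarrow> 'o set \<Rightarrow> ('o, 'm set) cat" where
  "heart C S T U V =
     quotient_category (full_subcategory C (twin_H C S T U V)) (factor_ideal C (twin_W T U))"

end

theory Submission
  imports Defs
begin

text \<open>
  By duality it suffices to treat \<open>\<H> = \<C>\<^sup>-\<close>, that is \<open>\<C>\<^sup>- \<subseteq> \<C>\<^sup>+\<close>. The proof rests on a description of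
  \<open>\<C>\<^sup>-\<close> by vanishing: an object \<open>X\<close> lies in \<open>\<C>\<^sup>- = \<Sigma>\<inverse>\<S> * \<W>\<close> if and only if every composite
  \<open>X \<rightarrow> T \<rightarrow> \<Sigma>V\<close> with \<open>T \<in> \<T>\<close> and \<open>V \<in> \<V>\<close> is zero. With it, membership in \<open>\<C>\<^sup>-\<close> becomes a short
  diagram chase, and almost no octahedra are needed.

  Cokernels in \<open>\<H>/[\<W>]\<close>: for \<open>f : A \<rightarrow> B\<close> choose \<open>\<Sigma>\<inverse>S \<rightarrow> A \<rightarrow> W \<rightarrow> S\<close> and take the cone \<open>B \<rightarrow> M\<close> of
  the composite \<open>\<Sigma>\<inverse>S \<rightarrow> A \<rightarrow> B\<close>. So, up to isomorphism, a cokernel is the middle map of a triangle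
  \<open>\<Sigma>\<inverse>S \<rightarrow> B \<rightarrow> M \<rightarrow> S\<close> with \<open>B \<in> \<C>\<^sup>-\<close>, and conversely any such map is a cokernel
  (\<open>quotient_cokernel_of_cone\<close>, \<open>quotient_cokernelE\<close>). Kernels: choose \<open>V \<rightarrow> W \<rightarrow> B \<rightarrow> \<Sigma>V\<close>, take the
  fibre \<open>L\<close> of \<open>A \<rightarrow> B \<rightarrow> \<Sigma>V\<close>, and replace \<open>L\<close> by its coreflection \<open>K\<close> into \<open>\<C>\<^sup>-\<close>
  (\<open>coreflection\<close>, \<open>quotient_kernelE\<close>); both \<open>K \<rightarrow> L\<close> and \<open>L \<rightarrow> A\<close> have their fibre in \<open>\<V>\<close>.
  Maps with fibre in \<open>\<V>\<close> reflect the ideal \<open>[\<W>]\<close> on maps out of \<open>\<C>\<^sup>-\<close> (\<open>null_reflected\<close>), which is what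
  makes them monic.

  Both stability conditions then hold in a weak form, with some commutative square in place of the
  universal one. A triangle \<open>\<Sigma>\<inverse>S \<rightarrow> B \<rightarrow> M \<rightarrow> S\<close> restricts along \<open>Y \<rightarrow> M\<close> to \<open>\<Sigma>\<inverse>S \<rightarrow> P \<rightarrow> Y \<rightarrow> S\<close>, and
  \<open>P\<close> is still in \<open>\<C>\<^sup>-\<close> (\<open>quotient_cokernel_square\<close>). A kernel can be pushed out to a map whose
  fibre is in \<open>\<V>\<close>, and after coreflecting the target this map is monic
  (\<open>quotient_kernel_square\<close>). For preabelian categories these weak forms imply the
  quasi-abelian axioms; this is the purely categorical content of the locale
  \<open>preabelian_with_squares\<close>, in the spirit of Rump's theorem that for semi-abelian categories
  left and right quasi-abelianness agree.

  For the duality, the argument is carried out in a locale \<open>twin_sequences\<close> whose assumptions mention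
  only four-term sequences \<open>X \<rightarrow> Y \<rightarrow> Z \<rightarrow> \<Sigma>X\<close> and are invariant under reversing all arrows. Thus no
  triangulated structure on the opposite category, and no inverse of \<open>\<Sigma>\<close>, has to be constructed.
\<close>

section \<open>Arithmetic of arrows\<close>

text \<open>
  As the hom-sets are disjoint, an arrow determines its domain and codomain. With these as functions,
  the typing conditions of composites and sums become equations between objects, which the
  simplifier discharges.
\<close>

definition is_arrow :: "('o, 'm, 'z) cat_scheme \<Rightarrow> 'm \<Rightarrow> bool" where
  "is_arrow C f \<longleftrightarrow> (\<exists>X \<in> Obj C. \<exists>Y \<in> Obj C. f \<in> Hom C X Y)"

definition Dom :: "('o, 'm, 'z) cat_scheme \<Rightarrow> 'm \<Rightarrow> 'o" where
  "Dom C f = (THE X. X \<in> Obj C \<and> (\<exists>Y \<in> Obj C. f \<in> Hom C X Y))"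

definition Cod :: "('o, 'm, 'z) cat_scheme \<Rightarrow> 'm \<Rightarrow> 'o" where
  "Cod C f = (THE Y. Y \<in> Obj C \<and> (\<exists>X \<in> Obj C. f \<in> Hom C X Y))"

definition arr :: "('o, 'm, 'z) cat_scheme \<Rightarrow> 'o \<Rightarrow> 'o \<Rightarrow> 'm \<Rightarrow> bool" where
  "arr C X Y f \<longleftrightarrow> X \<in> Obj C \<and> Y \<in> Obj C \<and> f \<in> Hom C X Y"

text \<open>
  The inverse \<open>neg\<close> in a hom-group needs the two objects; here they are read off from the arrow.
\<close>

definition negate :: "('o, 'm, 'z) cat_scheme \<Rightarrow> 'm \<Rightarrow> 'm" ("\<ominus>\<index> _" [81] 80) where
  "negate C f = neg C (Dom C f) (Cod C f) f"

lemma arrI: "X \<in> Obj C \<Longrightarrow> Y \<in> Obj C \<Longrightarrow> f \<in> Hom C X Y \<Longrightarrow> arr C X Y f"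
  and arr_hom: "arr C X Y f \<Longrightarrow> f \<in> Hom C X Y"
  and arr_objs: "arr C X Y f \<Longrightarrow> X \<in> Obj C \<and> Y \<in> Obj C"
  by (auto simp: arr_def)

context category begin

lemma arr_unique: "arr C X Y f \<Longrightarrow> arr C X' Y' f \<Longrightarrow> X = X' \<and> Y = Y'"
  unfolding arr_def using hom_disjoint by blast

lemma Dom_eq: "arr C X Y f \<Longrightarrow> Dom C f = X"
  unfolding Dom_def by (rule the_equality) (use arr_unique in \<open>auto simp: arr_def\<close>)

lemma Cod_eq: "arr C X Y f \<Longrightarrow> Cod C f = Y"
  unfolding Cod_def by (rule the_equality) (use arr_unique in \<open>auto simp: arr_def\<close>)

lemma arr_iff [simp]:
  "arr C X Y f \<longleftrightarrow> is_arrow C f \<and> Dom C f = X \<and> Cod C f = Y \<and> X \<in> Obj C \<and> Y \<in> Obj C"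
  using Dom_eq Cod_eq unfolding is_arrow_def arr_def by metis

lemma Dom_Cod_Obj [simp]: "is_arrow C f \<Longrightarrow> Dom C f \<in> Obj C" "is_arrow C f \<Longrightarrow> Cod C f \<in> Obj C"
  using Dom_eq Cod_eq unfolding is_arrow_def arr_def by metis+

lemma hom_iff: "X \<in> Obj C \<Longrightarrow> Y \<in> Obj C \<Longrightarrow> f \<in> Hom C X Y \<longleftrightarrow> is_arrow C f \<and> Dom C f = X \<and> Cod C f = Y"
  using arr_iff[of X Y f] by (simp add: arr_def del: arr_iff)

lemma ide_arrow [simp]:
  assumes "X \<in> Obj C"
  shows "is_arrow C (Ide C X)" "Dom C (Ide C X) = X" "Cod C (Ide C X) = X"
  using ide_in_hom[OF assms] assms by (simp_all add: hom_iff)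

lemma comp_arrow [simp]:
  assumes "is_arrow C f" "is_arrow C g" "Dom C g = Cod C f"
  shows "is_arrow C (g \<cdot> f)" "Dom C (g \<cdot> f) = Dom C f" "Cod C (g \<cdot> f) = Cod C g"
  using comp_in_hom[of "Dom C f" "Cod C f" "Cod C g" f g] assms
  by (metis hom_iff Dom_Cod_Obj)+

lemma assoc [simp]:
  assumes "is_arrow C f" "is_arrow C g" "is_arrow C h" "Dom C g = Cod C f" "Dom C h = Cod C g"
  shows "(h \<cdot> g) \<cdot> f = h \<cdot> (g \<cdot> f)"
  using comp_assoc[of "Dom C f" "Cod C f" "Cod C g" "Cod C h" f g h] assms
  by (simp add: hom_iff)

lemma ide_right [simp]: "is_arrow C f \<Longrightarrow> Dom C f = X \<Longrightarrow> f \<cdot> Ide C X = f"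
  using comp_ide_right[of "Dom C f" "Cod C f" f] by (auto simp add: hom_iff)

lemma ide_left [simp]: "is_arrow C f \<Longrightarrow> Cod C f = X \<Longrightarrow> Ide C X \<cdot> f = f"
  using comp_ide_left[of "Dom C f" "Cod C f" f] by (auto simp add: hom_iff)

end

context preadditive_category begin

lemma hom_group_simps:
  "carrier (hom_group C X Y) = Hom C X Y" "monoid.mult (hom_group C X Y) = Add C"
  "one (hom_group C X Y) = Zero C X Y" "inv\<^bsub>hom_group C X Y\<^esub> f = neg C X Y f"
  by (simp_all add: hom_group_def neg_def)

lemma zero_arrow [simp]:
  assumes "X \<in> Obj C" "Y \<in> Obj C"
  shows "is_arrow C (Zero C X Y)" "Dom C (Zero C X Y) = X" "Cod C (Zero C X Y) = Y"
proof -
  interpret comm_group "hom_group C X Y" by (rule hom_comm_group) fact+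
  show "is_arrow C (Zero C X Y)" "Dom C (Zero C X Y) = X" "Cod C (Zero C X Y) = Y"
    using one_closed assms by (simp_all add: hom_group_simps hom_iff)
qed

lemma add_arrow [simp]:
  assumes "is_arrow C f" "is_arrow C g" "Dom C g = Dom C f" "Cod C g = Cod C f"
  shows "is_arrow C (f \<boxplus> g)" "Dom C (f \<boxplus> g) = Dom C f" "Cod C (f \<boxplus> g) = Cod C f"
proof -
  interpret comm_group "hom_group C (Dom C f) (Cod C f)" by (rule hom_comm_group) (use assms in auto)
  show "is_arrow C (f \<boxplus> g)" "Dom C (f \<boxplus> g) = Dom C f" "Cod C (f \<boxplus> g) = Cod C f"
    using m_closed[of f g] assms by (simp_all add: hom_group_simps hom_iff)
qed

lemma negate_arrow [simp]:
  assumes "is_arrow C f"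
  shows "is_arrow C (\<ominus> f)" "Dom C (\<ominus> f) = Dom C f" "Cod C (\<ominus> f) = Cod C f"
proof -
  interpret comm_group "hom_group C (Dom C f) (Cod C f)" by (rule hom_comm_group) (use assms in auto)
  show "is_arrow C (\<ominus> f)" "Dom C (\<ominus> f) = Dom C f" "Cod C (\<ominus> f) = Cod C f"
    using inv_closed[of f] assms by (simp_all add: hom_group_simps hom_iff negate_def)
qed

lemma neg_eq: "arr C X Y f \<Longrightarrow> neg C X Y f = \<ominus> f"
  by (simp add: negate_def)

lemma add_assoc [simp]:
  assumes "is_arrow C f" "is_arrow C g" "is_arrow C h" "Dom C g = Dom C f" "Cod C g = Cod C f"
    "Dom C h = Dom C f" "Cod C h = Cod C f"
  shows "(f \<boxplus> g) \<boxplus> h = f \<boxplus> (g \<boxplus> h)"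
proof -
  interpret comm_group "hom_group C (Dom C f) (Cod C f)" by (rule hom_comm_group) (use assms in auto)
  show ?thesis using m_assoc[of f g h] assms by (simp add: hom_group_simps hom_iff)
qed

lemma add_commute:
  assumes "is_arrow C f" "is_arrow C g" "Dom C g = Dom C f" "Cod C g = Cod C f"
  shows "f \<boxplus> g = g \<boxplus> f"
proof -
  interpret comm_group "hom_group C (Dom C f) (Cod C f)" by (rule hom_comm_group) (use assms in auto)
  show ?thesis using m_comm[of f g] assms by (simp add: hom_group_simps hom_iff)
qed

lemma add_zero [simp]:
  assumes "is_arrow C f" "Dom C f = X" "Cod C f = Y"
  shows "f \<boxplus> Zero C X Y = f" "Zero C X Y \<boxplus> f = f"
proof -
  interpret comm_group "hom_group C (Dom C f) (Cod C f)" by (rule hom_comm_group) (use assms in auto)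
  show "f \<boxplus> Zero C X Y = f" "Zero C X Y \<boxplus> f = f"
    using r_one[of f] l_one[of f] assms by (auto simp: hom_group_simps hom_iff)
qed

lemma add_negate [simp]:
  assumes "is_arrow C f"
  shows "f \<boxplus> \<ominus> f = Zero C (Dom C f) (Cod C f)" "\<ominus> f \<boxplus> f = Zero C (Dom C f) (Cod C f)"
proof -
  interpret comm_group "hom_group C (Dom C f) (Cod C f)" by (rule hom_comm_group) (use assms in auto)
  show "f \<boxplus> \<ominus> f = Zero C (Dom C f) (Cod C f)" "\<ominus> f \<boxplus> f = Zero C (Dom C f) (Cod C f)"
    using r_inv[of f] l_inv[of f] assms by (auto simp: hom_group_simps hom_iff negate_def)
qed

lemma add_right_cancel:
  assumes "f \<boxplus> h = g \<boxplus> h" "is_arrow C f" "is_arrow C g" "is_arrow C h"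
    "Dom C g = Dom C f" "Cod C g = Cod C f" "Dom C h = Dom C f" "Cod C h = Cod C f"
  shows "f = g"
proof -
  interpret comm_group "hom_group C (Dom C f) (Cod C f)" by (rule hom_comm_group) (use assms in auto)
  show ?thesis using right_cancel[of h f g] assms by (simp add: hom_group_simps hom_iff)
qed

lemma distrib_right [simp]:
  assumes "is_arrow C f" "is_arrow C g" "is_arrow C h" "Dom C h = Dom C g" "Cod C h = Cod C g"
    "Dom C g = Cod C f"
  shows "(g \<boxplus> h) \<cdot> f = g \<cdot> f \<boxplus> h \<cdot> f"
  using comp_add_left[of "Dom C f" "Cod C f" "Cod C g" f g h] assms by (simp add: hom_iff)

lemma distrib_left [simp]:
  assumes "is_arrow C f" "is_arrow C g" "is_arrow C h" "Dom C h = Dom C g" "Cod C h = Cod C g"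
    "Dom C f = Cod C g"
  shows "f \<cdot> (g \<boxplus> h) = f \<cdot> g \<boxplus> f \<cdot> h"
  using comp_add_right[of "Dom C g" "Dom C f" "Cod C f" g h f] assms by (simp add: hom_iff)

lemma comp_zero [simp]:
  assumes "is_arrow C f" "Z \<in> Obj C"
  shows "Dom C f = Y \<Longrightarrow> f \<cdot> Zero C Z Y = Zero C Z (Cod C f)"
    and "Cod C f = Y \<Longrightarrow> Zero C Y Z \<cdot> f = Zero C (Dom C f) Z"
proof -
  assume Y: "Dom C f = Y"
  have "f \<cdot> Zero C Z Y \<boxplus> f \<cdot> Zero C Z Y = Zero C Z (Cod C f) \<boxplus> f \<cdot> Zero C Z Y"
    using assms Y distrib_left[of f "Zero C Z Y" "Zero C Z Y"] by (auto simp del: distrib_left)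
  then show "f \<cdot> Zero C Z Y = Zero C Z (Cod C f)"
    by (rule add_right_cancel) (use assms Y in auto)
next
  assume Y: "Cod C f = Y"
  have "Zero C Y Z \<cdot> f \<boxplus> Zero C Y Z \<cdot> f = Zero C (Dom C f) Z \<boxplus> Zero C Y Z \<cdot> f"
    using assms Y distrib_right[of f "Zero C Y Z" "Zero C Y Z"] by (auto simp del: distrib_right)
  then show "Zero C Y Z \<cdot> f = Zero C (Dom C f) Z"
    by (rule add_right_cancel) (use assms Y in auto)
qed

lemma eq_negateI:
  assumes "f \<boxplus> g = Zero C (Dom C f) (Cod C f)" "is_arrow C f" "is_arrow C g"
    "Dom C g = Dom C f" "Cod C g = Cod C f"
  shows "f = \<ominus> g"
  by (rule add_right_cancel[of _ g]) (use assms in auto)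

lemma comp_negate [simp]:
  assumes "is_arrow C f" "is_arrow C g" "Dom C g = Cod C f"
  shows "g \<cdot> (\<ominus> f) = \<ominus> (g \<cdot> f)" "(\<ominus> g) \<cdot> f = \<ominus> (g \<cdot> f)"
proof -
  have "g \<cdot> (\<ominus> f) \<boxplus> g \<cdot> f = Zero C (Dom C f) (Cod C g)"
    using assms distrib_left[of g "\<ominus> f" f] by simp
  then show "g \<cdot> (\<ominus> f) = \<ominus> (g \<cdot> f)"
    by (intro eq_negateI) (use assms in auto)
  have "(\<ominus> g) \<cdot> f \<boxplus> g \<cdot> f = Zero C (Dom C f) (Cod C g)"
    using assms distrib_right[of f "\<ominus> g" g] by simp
  then show "(\<ominus> g) \<cdot> f = \<ominus> (g \<cdot> f)"
    by (intro eq_negateI) (use assms in auto)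
qed

lemma negate_negate [simp]: "is_arrow C f \<Longrightarrow> \<ominus> (\<ominus> f) = f"
  by (rule eq_negateI[symmetric]) auto

lemma negate_zero [simp]: "X \<in> Obj C \<Longrightarrow> Y \<in> Obj C \<Longrightarrow> \<ominus> (Zero C X Y) = Zero C X Y"
  by (rule eq_negateI[symmetric]) auto

lemma add_diff_cancel:
  assumes "is_arrow C f" "is_arrow C g" "Dom C g = Dom C f" "Cod C g = Cod C f"
  shows "g \<boxplus> (f \<boxplus> \<ominus> g) = f" "(f \<boxplus> \<ominus> g) \<boxplus> g = f"
proof -
  show "(f \<boxplus> \<ominus> g) \<boxplus> g = f" using assms by simp
  then show "g \<boxplus> (f \<boxplus> \<ominus> g) = f" using assms by (subst add_commute) auto
qed

lemma diff_eq_zero_iff: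
  assumes "is_arrow C f" "is_arrow C g" "Dom C g = Dom C f" "Cod C g = Cod C f"
  shows "f \<boxplus> \<ominus> g = Zero C (Dom C f) (Cod C f) \<longleftrightarrow> f = g"
  using assms add_diff_cancel(2)[of f g] by fastforce

lemma zero_object_arr: "is_zero_object C Z \<Longrightarrow> arr C X Z f \<Longrightarrow> f = Zero C X Z"
  and zero_object_arr': "is_zero_object C Z \<Longrightarrow> arr C Z X f \<Longrightarrow> f = Zero C Z X"
proof -
  assume Z: "is_zero_object C Z"
  have ZO: "Z \<in> Obj C" using Z by (simp add: is_zero_object_def)
  show "f = Zero C X Z" if f: "arr C X Z f"
  proof -
    have "X \<in> Obj C" using f by simp
    then have "\<exists>!f. f \<in> Hom C X Z" using Z by (simp only: is_zero_object_def)
    moreover have "f \<in> Hom C X Z" "Zero C X Z \<in> Hom C X Z"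
      using f ZO by (simp_all add: hom_iff)
    ultimately show ?thesis by blast
  qed
  show "f = Zero C Z X" if f: "arr C Z X f"
  proof -
    have "X \<in> Obj C" using f by simp
    then have "\<exists>!f. f \<in> Hom C Z X" using Z by (simp only: is_zero_object_def)
    moreover have "f \<in> Hom C Z X" "Zero C Z X \<in> Hom C Z X"
      using f ZO by (simp_all add: hom_iff)
    ultimately show ?thesis by blast
  qed
qed

end

section \<open>A criterion for being quasi-abelian\<close>

text \<open>
  In a preadditive category it suffices to test on arrows with composite zero; see \<open>monicD\<close>.
\<close>

definition monic :: "('o, 'm, 'z) cat_scheme \<Rightarrow> 'o \<Rightarrow> 'o \<Rightarrow> 'm \<Rightarrow> bool" where
  "monic C X Y f \<longleftrightarrow> arr C X Y f \<and>
     (\<forall>Z u. arr C Z X u \<longrightarrow> f \<cdot>\<^bsub>C\<^esub> u = Zero C Z Y \<longrightarrow> u = Zero C Z X)"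

context preadditive_category begin

lemma monic_zero: "monic C X Y f \<Longrightarrow> arr C Z X u \<Longrightarrow> f \<cdot> u = Zero C Z Y \<Longrightarrow> u = Zero C Z X"
  unfolding monic_def by blast

lemma monicD:
  assumes "monic C X Y f" "arr C Z X u" "arr C Z X v" "f \<cdot> u = f \<cdot> v"
  shows "u = v"
proof -
  have f: "arr C X Y f" using assms unfolding monic_def by simp
  have "f \<cdot> (u \<boxplus> \<ominus> v) = Zero C Z Y" using assms f by simp
  then have "u \<boxplus> \<ominus> v = Zero C Z X"
    by (rule monic_zero[OF assms(1), rotated]) (use assms in simp)
  then show ?thesis using assms diff_eq_zero_iff[of u v] by simp
qed

lemma kernelE:
  assumes "is_kernel C K X Y k f" "arr C Z X z" "f \<cdot> z = Zero C Z Y"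
  obtains u where "arr C Z K u" "k \<cdot> u = z"
  using assms unfolding is_kernel_def arr_def by metis

lemma cokernelE:
  assumes "is_cokernel C X Y K f c" "arr C Y Z z" "z \<cdot> f = Zero C X Z"
  obtains u where "arr C K Z u" "u \<cdot> c = z"
  using assms unfolding is_cokernel_def arr_def by metis

lemma kernel_arr: "is_kernel C K X Y k f \<Longrightarrow> arr C K X k \<and> arr C X Y f \<and> f \<cdot> k = Zero C K Y"
  unfolding is_kernel_def by (auto simp: arr_def simp del: arr_iff)

lemma cokernel_arr: "is_cokernel C X Y K f c \<Longrightarrow> arr C X Y f \<and> arr C Y K c \<and> c \<cdot> f = Zero C X K"
  unfolding is_cokernel_def by (auto simp: arr_def simp del: arr_iff)

lemma kernel_cancel:
  assumes "is_kernel C K X Y k f" "arr C Z K u" "arr C Z K v" "k \<cdot> u = k \<cdot> v"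
  shows "u = v"
proof -
  have a: "arr C K X k" "arr C X Y f" "f \<cdot> k = Zero C K Y" using kernel_arr[OF assms(1)] by auto
  have "f \<cdot> (k \<cdot> v) = (f \<cdot> k) \<cdot> v" using a assms by (simp del: assoc add: assoc[symmetric])
  then have "f \<cdot> (k \<cdot> v) = Zero C Z Y" using a assms by simp
  moreover have "arr C Z X (k \<cdot> v)" using a assms by simp
  ultimately show ?thesis using assms unfolding is_kernel_def arr_def by metis
qed

lemma cokernel_cancel:
  assumes "is_cokernel C X Y K f c" "arr C K Z u" "arr C K Z v" "u \<cdot> c = v \<cdot> c"
  shows "u = v"
proof -
  have a: "arr C X Y f" "arr C Y K c" "c \<cdot> f = Zero C X K" using cokernel_arr[OF assms(1)] by auto
  have "(v \<cdot> c) \<cdot> f = Zero C X Z" using a assms by simp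
  moreover have "arr C Y Z (v \<cdot> c)" using a assms by simp
  ultimately show ?thesis using assms unfolding is_cokernel_def arr_def by metis
qed

lemma kernelI:
  assumes "arr C K X k" "arr C X Y f" "f \<cdot> k = Zero C K Y"
    and "\<And>Z z. arr C Z X z \<Longrightarrow> f \<cdot> z = Zero C Z Y \<Longrightarrow> \<exists>u. arr C Z K u \<and> k \<cdot> u = z"
    and "monic C K X k"
  shows "is_kernel C K X Y k f"
proof -
  have *: "\<exists>!u. u \<in> Hom C Z K \<and> k \<cdot> u = z"
    if z: "Z \<in> Obj C" "z \<in> Hom C Z X" "f \<cdot> z = Zero C Z Y" for Z z
  proof -
    have "arr C Z X z" using z assms(1) by (auto simp add: hom_iff)
    then obtain u where u: "arr C Z K u" "k \<cdot> u = z" using assms(4) z by blast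
    show ?thesis
    proof (rule ex1I[of _ u])
      show "u \<in> Hom C Z K \<and> k \<cdot> u = z" using u by (simp add: hom_iff)
      show "v = u" if "v \<in> Hom C Z K \<and> k \<cdot> v = z" for v
        using monicD[OF assms(5), of Z v u] that u by (simp add: hom_iff)
    qed
  qed
  then show ?thesis unfolding is_kernel_def using assms(1-3) * by (auto simp: arr_def simp del: arr_iff)
qed

lemma cokernelI:
  assumes "arr C X Y f" "arr C Y K c" "c \<cdot> f = Zero C X K"
    and "\<And>Z z. arr C Y Z z \<Longrightarrow> z \<cdot> f = Zero C X Z \<Longrightarrow> \<exists>u. arr C K Z u \<and> u \<cdot> c = z"
    and "\<And>Z u. arr C K Z u \<Longrightarrow> u \<cdot> c = Zero C Y Z \<Longrightarrow> u = Zero C K Z"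
  shows "is_cokernel C X Y K f c"
proof -
  have *: "\<exists>!u. u \<in> Hom C K Z \<and> u \<cdot> c = z"
    if z: "Z \<in> Obj C" "z \<in> Hom C Y Z" "z \<cdot> f = Zero C X Z" for Z z
  proof -
    have "arr C Y Z z" using z assms(1) by (auto simp add: hom_iff)
    then obtain u where u: "arr C K Z u" "u \<cdot> c = z" using assms(4) z by blast
    show ?thesis
    proof (rule ex1I[of _ u])
      show "u \<in> Hom C K Z \<and> u \<cdot> c = z" using u by (simp add: hom_iff)
      show "v = u" if v: "v \<in> Hom C K Z \<and> v \<cdot> c = z" for v
      proof -
        have v': "arr C K Z v" "v \<cdot> c = z" using v u by (auto simp add: hom_iff)
        have "v \<boxplus> \<ominus> u = Zero C K Z" using u v' assms(1,2) by (intro assms(5)) auto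
        then show ?thesis using diff_eq_zero_iff[of v u] u v' by simp
      qed
    qed
  qed
  then show ?thesis unfolding is_cokernel_def using assms(1-3) * by (auto simp: arr_def simp del: arr_iff)
qed

text \<open>
  If \<open>e \<cdot> w\<close> is a cokernel of \<open>h\<close>, then \<open>w \<cdot> h = 0\<close> because \<open>e\<close> is monic, so \<open>w\<close> factors through
  \<open>e \<cdot> w\<close>. The factor is a section of \<open>e\<close>, and a monic with a section is invertible.
\<close>

lemma monic_factor_of_cokernel_iso:
  assumes "monic C X Y e" "arr C Z X w" "cokernel_morphism C Z Y (e \<cdot> w)"
  shows "\<exists>d. arr C Y X d \<and> d \<cdot> e = Ide C X \<and> e \<cdot> d = Ide C Y"
proof -
  obtain A h where h: "is_cokernel C A Z Y h (e \<cdot> w)"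
    using assms(3) unfolding cokernel_morphism_def by blast
  have e: "arr C X Y e" using assms(1) unfolding monic_def by simp
  have hA: "arr C A Z h" "(e \<cdot> w) \<cdot> h = Zero C A Y" using cokernel_arr[OF h] by auto
  have "w \<cdot> h = Zero C A X"
    by (rule monic_zero[OF assms(1)]) (use hA e assms(2) in simp_all)
  then obtain d where d: "arr C Y X d" "d \<cdot> (e \<cdot> w) = w"
    using cokernelE[OF h assms(2)] by blast
  have ed: "e \<cdot> d = Ide C Y"
  proof (rule cokernel_cancel[OF h])
    show "(e \<cdot> d) \<cdot> (e \<cdot> w) = Ide C Y \<cdot> (e \<cdot> w)" using d e assms(2) by simp
  qed (use d e in auto)
  have "e \<cdot> (d \<cdot> e) = (e \<cdot> d) \<cdot> e" using d e by simp
  then have "d \<cdot> e = Ide C X"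
    using monicD[OF assms(1), of X "d \<cdot> e" "Ide C X"] d e ed by simp
  then show ?thesis using d ed by blast
qed

text \<open>
  Composites are normalized by associating to the right, where a known composite \<open>g \<cdot> f\<close> is no
  longer a subterm. This rule makes the equation applicable again.
\<close>

lemma comp_reduce:
  assumes "g \<cdot> f = h" "is_arrow C f" "is_arrow C g" "is_arrow C u" "Dom C g = Cod C f" "Cod C u = Dom C f"
  shows "g \<cdot> (f \<cdot> u) = h \<cdot> u"
  using assms by force

lemma kernel_comp_iso:
  assumes "is_kernel C K X Y k f" "arr C K' K e" "arr C K K' d" "d \<cdot> e = Ide C K'" "e \<cdot> d = Ide C K"
  shows "is_kernel C K' X Y (k \<cdot> e) f"
proof (rule kernelI)
  note k = kernel_arr[OF assms(1)]
  show "f \<cdot> (k \<cdot> e) = Zero C K' Y"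
    using k assms(2) comp_reduce[of f k _ e] by simp
  show "monic C K' X (k \<cdot> e)" unfolding monic_def
  proof (intro conjI allI impI)
    fix Z u assume u: "arr C Z K' u" "(k \<cdot> e) \<cdot> u = Zero C Z X"
    have "e \<cdot> u = e \<cdot> Zero C Z K'"
      by (rule kernel_cancel[OF assms(1), of Z]) (use u k assms in auto)
    then have "d \<cdot> (e \<cdot> u) = d \<cdot> (e \<cdot> Zero C Z K')" by simp
    then show "u = Zero C Z K'"
      using assms(2-4) u comp_reduce[OF assms(4), of u] by simp
  qed (use k assms in auto)
  show "\<exists>u. arr C Z K' u \<and> (k \<cdot> e) \<cdot> u = z" if z: "arr C Z X z" "f \<cdot> z = Zero C Z Y" for Z z
  proof -
    obtain u where u: "arr C Z K u" "k \<cdot> u = z" using kernelE[OF assms(1) z] .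
    have "(k \<cdot> e) \<cdot> (d \<cdot> u) = k \<cdot> u"
      using u k assms(2-5) comp_reduce[OF assms(5), of u] by simp
    then show ?thesis using u assms(3) by (intro exI[of _ "d \<cdot> u"]) auto
  qed
qed (use kernel_arr[OF assms(1)] assms in auto)

lemma cokernel_comp_iso:
  assumes "is_cokernel C X Y K f c" "arr C K K' e" "arr C K' K d" "d \<cdot> e = Ide C K" "e \<cdot> d = Ide C K'"
  shows "is_cokernel C X Y K' f (e \<cdot> c)"
proof (rule cokernelI)
  note c = cokernel_arr[OF assms(1)]
  show "(e \<cdot> c) \<cdot> f = Zero C X K'"
    using c assms(2) by simp
  show "u = Zero C K' Z" if u: "arr C K' Z u" "u \<cdot> (e \<cdot> c) = Zero C Y Z" for Z u
  proof -
    have "u \<cdot> e = Zero C K Z"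
      by (rule cokernel_cancel[OF assms(1), of Z]) (use u c assms in auto)
    then have "(u \<cdot> e) \<cdot> d = Zero C K' Z" using u assms(3) by simp
    then show "u = Zero C K' Z"
      using assms u by simp
  qed
  show "\<exists>u. arr C K' Z u \<and> u \<cdot> (e \<cdot> c) = z" if z: "arr C Y Z z" "z \<cdot> f = Zero C X Z" for Z z
  proof -
    obtain u where u: "arr C K Z u" "u \<cdot> c = z" using cokernelE[OF assms(1) z] .
    have "(u \<cdot> d) \<cdot> (e \<cdot> c) = u \<cdot> c"
      using u c assms(2-5) comp_reduce[OF assms(4), of c] by simp
    then show ?thesis using u assms(3) by (intro exI[of _ "u \<cdot> d"]) auto
  qed
qed (use cokernel_arr[OF assms(1)] assms in auto)

lemma cokernel_unique:
  assumes "is_cokernel C X Y K f c" "is_cokernel C X Y K' f c'"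
  obtains e d where "arr C K K' e" "arr C K' K d" "d \<cdot> e = Ide C K" "e \<cdot> c = c'" "d \<cdot> c' = c"
proof -
  note a = cokernel_arr[OF assms(1)] cokernel_arr[OF assms(2)]
  obtain e where e: "arr C K K' e" "e \<cdot> c = c'" using cokernelE[OF assms(1), of K' c'] a by blast
  obtain d where d: "arr C K' K d" "d \<cdot> c' = c" using cokernelE[OF assms(2), of K c] a by blast
  have "d \<cdot> e = Ide C K"
    by (rule cokernel_cancel[OF assms(1)]) (use a d e in auto)
  then show thesis using that d e by blast
qed

lemma kernel_unique:
  assumes "is_kernel C K X Y k f" "is_kernel C K' X Y k' f"
  obtains e d where "arr C K K' e" "arr C K' K d" "d \<cdot> e = Ide C K" "k' \<cdot> e = k" "k \<cdot> d = k'"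
proof -
  note a = kernel_arr[OF assms(1)] kernel_arr[OF assms(2)]
  obtain e where e: "arr C K K' e" "k' \<cdot> e = k" using kernelE[OF assms(2), of K k] a by blast
  obtain d where d: "arr C K' K d" "k \<cdot> d = k'" using kernelE[OF assms(1), of K' k'] a by blast
  have "d \<cdot> e = Ide C K"
    by (rule kernel_cancel[OF assms(1)]) (use a d e comp_reduce[OF d(2), of e] in auto)
  then show thesis using that d e by blast
qed

end

text \<open>
  The squares are not required to be universal. This is all that has to be verified in the heart:
  the comparison with the actual pullback or pushout is done once and for all in this locale.
\<close>

locale preabelian_with_squares = preabelian_category +
  assumes cokernel_square:
      "\<lbrakk>cokernel_morphism C X Z f; arr C Y Z g\<rbrakk>
        \<Longrightarrow> \<exists>P p q. cokernel_morphism C P Y q \<and> arr C P X p \<and> f \<cdot> p = g \<cdot> q"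
    and kernel_square:
      "\<lbrakk>kernel_morphism C Z X f; arr C Z Y g\<rbrakk>
        \<Longrightarrow> \<exists>P i j. monic C Y P j \<and> arr C X P i \<and> i \<cdot> f = j \<cdot> g"
begin

text \<open>
  Let \<open>p\<close> be a cokernel of a kernel of \<open>f\<close>. If the induced \<open>i\<close> satisfies \<open>i \<cdot> x = 0\<close>, a square for \<open>p\<close>
  and \<open>x\<close> gives \<open>p \<cdot> r = x \<cdot> q\<close> with \<open>q\<close> a cokernel. Then \<open>f \<cdot> r = 0\<close>, so \<open>r\<close> factors through the
  kernel of \<open>f\<close> and \<open>p \<cdot> r = 0\<close>; hence \<open>x \<cdot> q = 0\<close> and \<open>x = 0\<close>.
\<close>

lemma ex_coimage_factorization:
  assumes f: "arr C X Y f"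
  shows "\<exists>I p i. cokernel_morphism C X I p \<and> monic C I Y i \<and> f = i \<cdot> p"
proof -
  obtain K k where k: "is_kernel C K X Y k f" using ex_kernel f arr_hom arr_objs by metis
  note ka = kernel_arr[OF k]
  obtain I p where p: "is_cokernel C K X I k p"
    using ex_cokernel ka arr_hom arr_objs by metis
  note pa = cokernel_arr[OF p]
  obtain i where i: "arr C I Y i" "i \<cdot> p = f" using cokernelE[OF p f] ka by blast
  have "monic C I Y i" unfolding monic_def
  proof (intro conjI allI impI)
    fix Z x assume x: "arr C Z I x" "i \<cdot> x = Zero C Z Y"
    obtain G r q where q: "cokernel_morphism C G Z q" "arr C G X r" "p \<cdot> r = x \<cdot> q"
      using cokernel_square x(1) p unfolding cokernel_morphism_def by blast
    obtain A h where h: "is_cokernel C A G Z h q" using q(1) unfolding cokernel_morphism_def by blast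
    note ha = cokernel_arr[OF h]
    have "f \<cdot> r = i \<cdot> (p \<cdot> r)" using i pa q(2) by auto
    also have "\<dots> = (i \<cdot> x) \<cdot> q" using q(3) i x(1) ha by simp
    also have "\<dots> = Zero C G Y" using x i(1) ha by simp
    finally obtain s where s: "arr C G K s" "k \<cdot> s = r" using kernelE[OF k q(2)] by blast
    have "p \<cdot> (k \<cdot> s) = Zero C K I \<cdot> s" by (rule comp_reduce) (use s pa ka in auto)
    then have "p \<cdot> r = Zero C G I" using s pa by auto
    then have "x \<cdot> q = Zero C Z I \<cdot> q" using q x ha by simp
    then show "x = Zero C Z I"
      by (rule cokernel_cancel[OF h, rotated 2]) (use x in auto)
  qed (use i in auto)
  then show ?thesis using p i unfolding cokernel_morphism_def by blast
qed

text \<open>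
  The apex of a weak square maps to the pullback, so some composite \<open>q \<cdot> u\<close> is a cokernel. Write
  \<open>q = i \<cdot> e\<close> with \<open>i\<close> monic and \<open>e\<close> a cokernel. Then \<open>i\<close> is invertible, being a monic through which
  a cokernel factors, and \<open>q\<close> is a cokernel like \<open>e\<close>.
\<close>

lemma cokernel_pullback:
  assumes "is_pullback C P X Y Z p q f g" "cokernel_morphism C X Z f"
  shows "cokernel_morphism C P Y q"
proof -
  have a: "arr C P X p" "arr C P Y q" "arr C X Z f" "arr C Y Z g" "f \<cdot> p = g \<cdot> q"
    and univ: "\<And>A a b. arr C A X a \<Longrightarrow> arr C A Y b \<Longrightarrow> f \<cdot> a = g \<cdot> b
        \<Longrightarrow> \<exists>u. arr C A P u \<and> p \<cdot> u = a \<and> q \<cdot> u = b"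
    using assms(1) unfolding is_pullback_def arr_def by (auto, metis)
  obtain G r t where G: "cokernel_morphism C G Y t" "arr C G X r" "f \<cdot> r = g \<cdot> t"
    using cokernel_square[OF assms(2) a(4)] by blast
  have t: "arr C G Y t" using G(1) cokernel_arr unfolding cokernel_morphism_def by blast
  obtain u where u: "arr C G P u" "q \<cdot> u = t" using univ[OF G(2) t G(3)] by blast
  obtain I e i where I: "cokernel_morphism C P I e" "monic C I Y i" "q = i \<cdot> e"
    using ex_coimage_factorization[OF a(2)] by blast
  obtain A h where h: "is_cokernel C A P I h e" using I(1) unfolding cokernel_morphism_def by blast
  note ha = cokernel_arr[OF h]
  have i: "arr C I Y i" using I(2) unfolding monic_def by simp
  have "i \<cdot> (e \<cdot> u) = t" using u I(3) i ha by simp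
  then obtain d where "arr C Y I d" "d \<cdot> i = Ide C I" "i \<cdot> d = Ide C Y"
    using monic_factor_of_cokernel_iso[OF I(2), of G "e \<cdot> u"] G(1) ha u(1) by auto
  then show ?thesis
    using cokernel_comp_iso[OF h i] I(3) unfolding cokernel_morphism_def by blast
qed

text \<open>
  The pushout maps to the end of a weak square, so \<open>j\<close> is monic. The cokernel \<open>c\<close> of \<open>f\<close> induces
  \<open>d : P \<rightarrow> D\<close> with \<open>d \<cdot> j = 0\<close>, and \<open>j\<close> factors as \<open>k \<cdot> e\<close> through the kernel \<open>k\<close> of \<open>d\<close>. It remains to
  see that the monic \<open>e\<close> is invertible, for which a cokernel must be factored through it. The arrow
  \<open>m = (i, j)\<close> from the biproduct is a cokernel of \<open>n = (f, -g)\<close>; a square over it and \<open>k\<close> yields a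
  cokernel \<open>q\<close> with \<open>m \<cdot> r = k \<cdot> q\<close>. The first component of \<open>r\<close> is killed by \<open>c\<close>, hence equals
  \<open>f \<cdot> s\<close>, and can be moved to the second component by \<open>i \<cdot> f = j \<cdot> g\<close>. So \<open>m \<cdot> r\<close> factors through
  \<open>j\<close>, and \<open>q\<close> factors through \<open>e\<close>.
\<close>

lemma kernel_pushout:
  assumes "is_pushout C Z X Y P f g i j" "kernel_morphism C Z X f"
  shows "kernel_morphism C Y P j"
proof -
  have a: "arr C Z X f" "arr C Z Y g" "arr C X P i" "arr C Y P j" "i \<cdot> f = j \<cdot> g"
    and univ: "\<And>A a b. arr C X A a \<Longrightarrow> arr C Y A b \<Longrightarrow> a \<cdot> f = b \<cdot> g
        \<Longrightarrow> \<exists>!u. arr C P A u \<and> u \<cdot> i = a \<and> u \<cdot> j = b"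
    using assms(1) unfolding is_pushout_def arr_def by simp_all
  have j_monic: "monic C Y P j" unfolding monic_def
  proof (intro conjI allI impI)
    obtain P' i' j' where P': "monic C Y P' j'" "arr C X P' i'" "i' \<cdot> f = j' \<cdot> g"
      using kernel_square[OF assms(2) a(2)] by blast
    have j': "arr C Y P' j'" using P'(1) unfolding monic_def by simp
    obtain u where u: "arr C P P' u" "u \<cdot> j = j'" using univ[OF P'(2) j' P'(3)] by blast
    fix A x assume x: "arr C A Y x" "j \<cdot> x = Zero C A P"
    have "j' \<cdot> x = u \<cdot> (j \<cdot> x)" using u x(1) a by auto
    then have "j' \<cdot> x = Zero C A P'" using x u by simp
    then show "x = Zero C A Y" using P'(1) x(1) unfolding monic_def by blast
  qed (use a in auto)
  obtain Y0 f0 where f0: "is_kernel C Z X Y0 f f0" using assms(2) unfolding kernel_morphism_def by blast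
  note f0a = kernel_arr[OF f0]
  obtain D c where c: "is_cokernel C Z X D f c" using ex_cokernel a(1) arr_hom arr_objs by metis
  note ca = cokernel_arr[OF c]
  obtain f1 where f1: "arr C D Y0 f1" "f1 \<cdot> c = f0" using cokernelE[OF c, of Y0 f0] f0a by blast
  have f_ker: "\<exists>u. arr C A Z u \<and> f \<cdot> u = x" if x: "arr C A X x" "c \<cdot> x = Zero C A D" for A x
  proof -
    have "f0 \<cdot> x = f1 \<cdot> (c \<cdot> x)" using f1 ca x(1) by auto
    then have "f0 \<cdot> x = Zero C A Y0" using x f1(1) by simp
    then show ?thesis using kernelE[OF f0 x(1)] by metis
  qed
  obtain d where d: "arr C P D d" "d \<cdot> i = c" "d \<cdot> j = Zero C Y D"
    using univ[of D c "Zero C Y D"] ca a by auto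
  obtain E k where k: "is_kernel C E P D k d" using ex_kernel d(1) arr_hom arr_objs by metis
  note ka = kernel_arr[OF k]
  obtain e where e: "arr C Y E e" "k \<cdot> e = j" using kernelE[OF k a(4) d(3)] .
  have e_monic: "monic C Y E e" unfolding monic_def
  proof (intro conjI allI impI)
    fix A x assume x: "arr C A Y x" "e \<cdot> x = Zero C A E"
    have "j \<cdot> x = k \<cdot> (e \<cdot> x)" using e x(1) ka by auto
    then have "j \<cdot> x = Zero C A P" using x ka by simp
    then show "x = Zero C A Y" using j_monic x(1) unfolding monic_def by blast
  qed (use e in auto)
  obtain B b1 b2 p1 p2 where "is_biproduct C X Y B b1 b2 p1 p2"
    using ex_biproduct[of X Y] a by auto
  then have B: "arr C X B b1" "arr C Y B b2" "arr C B X p1" "arr C B Y p2"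
      "p1 \<cdot> b1 = Ide C X" "p2 \<cdot> b2 = Ide C Y" "p1 \<cdot> b2 = Zero C Y X" "p2 \<cdot> b1 = Zero C X Y"
      "b1 \<cdot> p1 \<boxplus> b2 \<cdot> p2 = Ide C B"
    unfolding is_biproduct_def arr_def by auto
  define m where "m = i \<cdot> p1 \<boxplus> j \<cdot> p2"
  define n where "n = b1 \<cdot> f \<boxplus> \<ominus> (b2 \<cdot> g)"
  have m: "arr C B P m" and n: "arr C Z B n" using a B(1-4) by (simp_all add: m_def n_def)
  have mb: "m \<cdot> b1 = i" "m \<cdot> b2 = j" using a B by (simp_all add: m_def)
  have "is_cokernel C Z B P n m"
  proof (rule cokernelI[OF n m])
    have "m \<cdot> n = (m \<cdot> b1) \<cdot> f \<boxplus> \<ominus> ((m \<cdot> b2) \<cdot> g)"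
      using m a B(1,2) by (simp add: n_def)
    then show "m \<cdot> n = Zero C Z P" using mb a by simp
    fix A x assume x: "arr C B A x"
    have x_eq: "x = (x \<cdot> b1) \<cdot> p1 \<boxplus> (x \<cdot> b2) \<cdot> p2"
    proof -
      have "x = x \<cdot> (b1 \<cdot> p1 \<boxplus> b2 \<cdot> p2)" using B(9) x by simp
      then show ?thesis using x B(1-4) by simp
    qed
    show "\<exists>u. arr C P A u \<and> u \<cdot> m = x" if "x \<cdot> n = Zero C Z A"
    proof -
      have "(x \<cdot> b1) \<cdot> f \<boxplus> \<ominus> ((x \<cdot> b2) \<cdot> g) = Zero C Z A"
        using that x a B(1,2) by (simp add: n_def)
      then have "(x \<cdot> b1) \<cdot> f = (x \<cdot> b2) \<cdot> g"
        using diff_eq_zero_iff[of "(x \<cdot> b1) \<cdot> f" "(x \<cdot> b2) \<cdot> g"] x a B(1,2) by simp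
      then obtain u where u: "arr C P A u" "u \<cdot> i = x \<cdot> b1" "u \<cdot> j = x \<cdot> b2"
        using univ[of A "x \<cdot> b1" "x \<cdot> b2"] x B(1,2) by auto
      have "u \<cdot> m = (u \<cdot> i) \<cdot> p1 \<boxplus> (u \<cdot> j) \<cdot> p2" using u(1) a B(3,4) by (simp add: m_def)
      then have "u \<cdot> m = x" using x_eq u(2,3) by simp
      then show ?thesis using u(1) by blast
    qed
  next
    fix A u assume u: "arr C P A u" "u \<cdot> m = Zero C B A"
    have "u \<cdot> i = (u \<cdot> m) \<cdot> b1" "u \<cdot> j = (u \<cdot> m) \<cdot> b2" using mb m u(1) B(1,2) by auto
    then have "u \<cdot> i = Zero C X A" "u \<cdot> j = Zero C Y A" using u B(1,2) by simp_all
    moreover have "\<exists>!u. arr C P A u \<and> u \<cdot> i = Zero C X A \<and> u \<cdot> j = Zero C Y A"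
      using univ[of A "Zero C X A" "Zero C Y A"] u(1) a by simp
    moreover have "arr C P A (Zero C P A)" "Zero C P A \<cdot> i = Zero C X A" "Zero C P A \<cdot> j = Zero C Y A"
      using u(1) a by auto
    ultimately show "u = Zero C P A" using u(1) by blast
  qed
  then have "cokernel_morphism C B P m" unfolding cokernel_morphism_def by blast
  then obtain G r q where q: "cokernel_morphism C G E q" "arr C G B r" "m \<cdot> r = k \<cdot> q"
    using cokernel_square ka by blast
  have qa: "arr C G E q" using q(1) cokernel_arr unfolding cokernel_morphism_def by blast
  have dm: "d \<cdot> m = c \<cdot> p1"
    using d a B(3,4) comp_reduce[OF d(2), of p1] comp_reduce[OF d(3), of p2] ca by (simp add: m_def)
  have "c \<cdot> (p1 \<cdot> r) = (d \<cdot> m) \<cdot> r" using dm ca B(3) q(2) by simp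
  also have "\<dots> = d \<cdot> (k \<cdot> q)" using q(3) d(1) m q(2) by simp
  also have "\<dots> = Zero C G D" using ka qa d(1) comp_reduce[of d k _ q] by simp
  finally have "c \<cdot> (p1 \<cdot> r) = Zero C G D" .
  then obtain s where s: "arr C G Z s" "f \<cdot> s = p1 \<cdot> r"
    using f_ker[of G "p1 \<cdot> r"] B(3) q(2) by auto
  define w where "w = g \<cdot> s \<boxplus> p2 \<cdot> r"
  have w: "arr C G Y w" using a s B(4) q(2) by (simp add: w_def)
  have "j \<cdot> w = (j \<cdot> g) \<cdot> s \<boxplus> j \<cdot> (p2 \<cdot> r)" using a s(1) B(4) q(2) by (simp add: w_def)
  also have "\<dots> = i \<cdot> (f \<cdot> s) \<boxplus> j \<cdot> (p2 \<cdot> r)" using a s(1) by (simp add: a(5)[symmetric])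
  also have "\<dots> = m \<cdot> r" using s a B(3,4) q(2) by (simp add: m_def)
  finally have "k \<cdot> (e \<cdot> w) = k \<cdot> q" using q(3) e w ka by force
  then have "e \<cdot> w = q"
    by (rule kernel_cancel[OF k, rotated 2]) (use e w qa in auto)
  then obtain e' where "arr C E Y e'" "e' \<cdot> e = Ide C Y" "e \<cdot> e' = Ide C E"
    using monic_factor_of_cokernel_iso[OF e_monic w] q(1) by auto
  then have "is_kernel C Y P D (k \<cdot> e) d"
    by (intro kernel_comp_iso[OF k e(1)]) auto
  then show ?thesis using e(2) unfolding kernel_morphism_def by blast
qed

lemma quasi_abelian: "quasi_abelian_category C"
  by unfold_locales (fact cokernel_pullback, fact kernel_pushout)

end

section \<open>Opposite categories\<close>

definition opposite :: "('o, 'm, 'z) cat_scheme \<Rightarrow> ('o, 'm) cat" where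
  "opposite C = \<lparr>Obj = Obj C, Hom = (\<lambda>X Y. Hom C Y X), Ide = Ide C,
     Comp = (\<lambda>g f. Comp C f g), Add = Add C, Zero = (\<lambda>X Y. Zero C Y X)\<rparr>"

lemma opposite_simps [simp]:
  "Obj (opposite C) = Obj C" "Hom (opposite C) X Y = Hom C Y X" "Ide (opposite C) = Ide C"
  "g \<cdot>\<^bsub>opposite C\<^esub> f = f \<cdot>\<^bsub>C\<^esub> g" "Add (opposite C) = Add C" "Zero (opposite C) X Y = Zero C Y X"
  by (simp_all add: opposite_def)

lemma arr_opposite [simp]: "arr (opposite C) X Y f \<longleftrightarrow> arr C Y X f"
  by (auto simp: arr_def)

lemma is_arrow_opposite [simp]: "is_arrow (opposite C) f \<longleftrightarrow> is_arrow C f"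
  by (auto simp: is_arrow_def)

lemma Dom_opposite [simp]: "Dom (opposite C) f = Cod C f"
  and Cod_opposite [simp]: "Cod (opposite C) f = Dom C f"
  by (simp_all add: Dom_def Cod_def)

lemma opposite_opposite: "opposite (opposite Q) = Q" for Q :: "('o, 'm) cat"
  by (simp add: opposite_def)

lemma hom_group_opposite: "hom_group (opposite C) X Y = hom_group C Y X"
  by (simp add: hom_group_def)

lemma is_kernel_opposite: "is_kernel (opposite C) K X Y k f \<longleftrightarrow> is_cokernel C Y X K f k"
  by (auto simp: is_kernel_def is_cokernel_def)

lemma is_cokernel_opposite: "is_cokernel (opposite C) X Y K f c \<longleftrightarrow> is_kernel C K Y X c f"
  by (auto simp: is_kernel_def is_cokernel_def)

lemma is_biproduct_opposite: "is_biproduct (opposite C) X Y P i j p q \<longleftrightarrow> is_biproduct C X Y P p q i j"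
  by (auto simp: is_biproduct_def)

lemma is_zero_object_opposite: "is_zero_object (opposite C) = is_zero_object C"
  by (auto simp: is_zero_object_def)

lemma is_pullback_opposite: "is_pullback (opposite C) P X Y Z p q f g \<longleftrightarrow> is_pushout C Z X Y P f g p q"
  by (auto simp: is_pullback_def is_pushout_def)

lemma is_pushout_opposite: "is_pushout (opposite C) Z X Y P f g i j \<longleftrightarrow> is_pullback C P X Y Z i j f g"
  by (auto simp: is_pullback_def is_pushout_def)

lemma additive_opposite:
  assumes "additive_category C"
  shows "additive_category (opposite C)"
proof -
  interpret C: additive_category C by fact
  show ?thesis
  proof (intro additive_category.intro preadditive_category.intro category.intro
      preadditive_category_axioms.intro additive_category_axioms.intro)
    fix X Y X' Y' f
    assume "X \<in> Obj (opposite C)" "Y \<in> Obj (opposite C)" "X' \<in> Obj (opposite C)" "Y' \<in> Obj (opposite C)"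
      "f \<in> Hom (opposite C) X Y" "f \<in> Hom (opposite C) X' Y'"
    then show "X = X' \<and> Y = Y'" using C.hom_disjoint[of Y X Y' X' f] by simp
  next
    show "\<exists>Z. is_zero_object (opposite C) Z"
      using C.ex_zero_object by (simp add: is_zero_object_opposite)
    show "\<exists>P i j p q. is_biproduct (opposite C) X Y P i j p q"
      if "X \<in> Obj (opposite C)" "Y \<in> Obj (opposite C)" for X Y
      using C.ex_biproduct[of X Y] that by (simp add: is_biproduct_opposite) blast
  qed (simp_all add: C.hom_iff hom_group_opposite C.hom_comm_group)
qed

lemma quasi_abelian_opposite:
  assumes "quasi_abelian_category C"
  shows "quasi_abelian_category (opposite C)"
proof -
  interpret C: quasi_abelian_category C by fact
  interpret D: additive_category "opposite C"
    by (rule additive_opposite) (rule C.additive_category_axioms)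
  show ?thesis
  proof
    show "\<exists>K k. is_kernel (opposite C) K X Y k f" "\<exists>K c. is_cokernel (opposite C) X Y K f c"
      if "X \<in> Obj (opposite C)" "Y \<in> Obj (opposite C)" "f \<in> Hom (opposite C) X Y" for X Y f
      using C.ex_kernel[of Y X f] C.ex_cokernel[of Y X f] that
      by (auto simp: is_kernel_opposite is_cokernel_opposite)
  next
    fix P X Y Z p q f g
    assume "is_pullback (opposite C) P X Y Z p q f g" "cokernel_morphism (opposite C) X Z f"
    then show "cokernel_morphism (opposite C) P Y q"
      using C.kernel_pushout_stable[of Z X Y P f g p q]
      by (auto simp: is_pullback_opposite cokernel_morphism_def kernel_morphism_def is_cokernel_opposite)
  next
    fix P X Y Z i j f g
    assume "is_pushout (opposite C) Z X Y P f g i j" "kernel_morphism (opposite C) Z X f"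
    then show "kernel_morphism (opposite C) Y P j"
      using C.cokernel_pullback_stable[of P X Y Z i j f g]
      by (auto simp: is_pushout_opposite cokernel_morphism_def kernel_morphism_def is_kernel_opposite)
  qed
qed

lemma factor_ideal_opposite: "factor_ideal (opposite C) WW = factor_ideal C WW"
  unfolding factor_ideal_def by (simp, blast)

lemma ideal_coset_opposite:
  "ideal_coset (full_subcategory (opposite C) H) J = ideal_coset (full_subcategory C H) J"
  by (rule ext) (auto simp: ideal_coset_def full_subcategory_def)

text \<open>
  A factorization through an object of \<open>WW\<close>, read backwards, is again one, so the ideal and its
  cosets do not change under passage to the opposite category.
\<close>

lemma quotient_category_opposite:
  "quotient_category (full_subcategory (opposite C) H) (factor_ideal (opposite C) WW) =
   opposite (quotient_category (full_subcategory C H) (factor_ideal C WW))"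
  unfolding quotient_category_def factor_ideal_opposite ideal_coset_opposite
  by (simp add: opposite_def full_subcategory_def fun_eq_iff) blast

section \<open>Quotients by ideals of factoring morphisms\<close>

text \<open>
  Objects are restricted to \<open>H\<close>, while the factorizations through objects of \<open>WW\<close> take place in the
  whole category.
\<close>

locale ideal_quotient = additive_category C for C :: "('o, 'm, 'z) cat_scheme" (structure) +
  fixes WW H :: "'o set"
  assumes WW_objects: "WW \<subseteq> Obj C" and H_objects: "H \<subseteq> Obj C"
    and WW_zero: "is_zero_object C Z \<Longrightarrow> Z \<in> WW" and H_zero: "is_zero_object C Z \<Longrightarrow> Z \<in> H"
    and WW_biproduct: "\<lbrakk>is_biproduct C X Y P i j p q; X \<in> WW; Y \<in> WW\<rbrakk> \<Longrightarrow> P \<in> WW"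
    and H_biproduct: "\<lbrakk>is_biproduct C X Y P i j p q; X \<in> H; Y \<in> H\<rbrakk> \<Longrightarrow> P \<in> H"
begin

definition null :: "'m \<Rightarrow> bool" where
  "null f \<longleftrightarrow> is_arrow C f \<and>
     (\<exists>W a b. W \<in> WW \<and> arr C (Dom C f) W a \<and> arr C W (Cod C f) b \<and> f = b \<cdot> a)"

abbreviation quotient where
  "quotient \<equiv> quotient_category (full_subcategory C H) (factor_ideal C WW)"

abbreviation coset where
  "coset \<equiv> ideal_coset (full_subcategory C H) (factor_ideal C WW)"

lemma null_arrow [simp]: "null f \<Longrightarrow> is_arrow C f"
  by (simp add: null_def)

lemma nullI: "W \<in> WW \<Longrightarrow> arr C X W a \<Longrightarrow> arr C W Y b \<Longrightarrow> null (b \<cdot> a)"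
  unfolding null_def by auto

lemma nullE:
  assumes "null f"
  obtains W a b where "W \<in> WW" "arr C (Dom C f) W a" "arr C W (Cod C f) b" "f = b \<cdot> a"
  using assms unfolding null_def by blast

lemma null_zero [simp]: "X \<in> Obj C \<Longrightarrow> Y \<in> Obj C \<Longrightarrow> null (Zero C X Y)"
proof -
  assume *: "X \<in> Obj C" "Y \<in> Obj C"
  obtain Z where "Z \<in> WW" using ex_zero_object WW_zero by blast
  then have "null (Zero C Z Y \<cdot> Zero C X Z)" "Z \<in> Obj C"
    using * WW_objects by (auto intro!: nullI)
  then show ?thesis using * by simp
qed

lemma null_comp_left:
  assumes "null f" "is_arrow C g" "Dom C g = Cod C f"
  shows "null (g \<cdot> f)"
proof -
  obtain W a b where f: "W \<in> WW" "arr C (Dom C f) W a" "arr C W (Cod C f) b" "f = b \<cdot> a"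
    using assms(1) by (rule nullE)
  have "null ((g \<cdot> b) \<cdot> a)"
    by (rule nullI[OF f(1,2), of "Cod C g"]) (use f(3) assms in simp)
  then show ?thesis using f(2,3) assms(2,3) by (simp add: f(4)[symmetric])
qed

lemma null_comp_right:
  assumes "null f" "is_arrow C g" "Dom C f = Cod C g"
  shows "null (f \<cdot> g)"
proof -
  obtain W a b where f: "W \<in> WW" "arr C (Dom C f) W a" "arr C W (Cod C f) b" "f = b \<cdot> a"
    using assms(1) by (rule nullE)
  have "null (b \<cdot> (a \<cdot> g))"
    by (rule nullI[OF f(1) _ f(3), of "Dom C g"]) (use f(2) assms in simp)
  moreover have "(b \<cdot> a) \<cdot> g = b \<cdot> (a \<cdot> g)"
    by (rule assoc) (use f(2,3) assms(2,3) in simp_all)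
  ultimately show ?thesis using f(4) by simp
qed

text \<open>
  The sum of maps through \<open>W\<close> and \<open>W'\<close> factors through the biproduct of \<open>W\<close> and \<open>W'\<close>. This is why
  closure of \<open>WW\<close> under biproducts is demanded.
\<close>

lemma null_add:
  assumes "null f" "null g" "Dom C g = Dom C f" "Cod C g = Cod C f"
  shows "null (f \<boxplus> g)"
proof -
  obtain X Y where XY: "Dom C f = X" "Cod C f = Y" "Dom C g = X" "Cod C g = Y" using assms by simp
  obtain W a b where f: "W \<in> WW" "arr C X W a" "arr C W Y b" "f = b \<cdot> a"
    using assms(1) XY by (metis nullE)
  obtain W' a' b' where g: "W' \<in> WW" "arr C X W' a'" "arr C W' Y b'" "g = b' \<cdot> a'"
    using assms(2) XY by (metis nullE)
  obtain P i j p q where P: "is_biproduct C W W' P i j p q"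
    using ex_biproduct f(1) g(1) WW_objects by (meson subsetD)
  then have B: "arr C W P i" "arr C W' P j" "arr C P W p" "arr C P W' q"
      "p \<cdot> i = Ide C W" "q \<cdot> j = Ide C W'" "p \<cdot> j = Zero C W' W" "q \<cdot> i = Zero C W W'"
    unfolding is_biproduct_def arr_def by auto
  have "p \<cdot> (i \<cdot> a) = Ide C W \<cdot> a" "q \<cdot> (i \<cdot> a) = Zero C W W' \<cdot> a"
    "p \<cdot> (j \<cdot> a') = Zero C W' W \<cdot> a'" "q \<cdot> (j \<cdot> a') = Ide C W' \<cdot> a'"
    by (rule comp_reduce; use B f(2) g(2) in simp)+
  then have eq: "f \<boxplus> g = (b \<cdot> p \<boxplus> b' \<cdot> q) \<cdot> (i \<cdot> a \<boxplus> j \<cdot> a')"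
    using B(1-4) f(2,3) g(2,3) unfolding f(4) g(4) by simp
  have "P \<in> WW" using WW_biproduct[OF P] f g by blast
  then have "null ((b \<cdot> p \<boxplus> b' \<cdot> q) \<cdot> (i \<cdot> a \<boxplus> j \<cdot> a'))"
    by (rule nullI[of P X _ Y]) (use B(1-4) f(2,3) g(2,3) in simp_all)
  then show ?thesis by (simp only: eq)
qed

lemma null_negate: "null f \<Longrightarrow> null (\<ominus> f)"
  using null_comp_left[of f "\<ominus> Ide C (Cod C f)"] by simp

lemma null_congruent:
  assumes "null (f \<boxplus> \<ominus> g)" "null g" "is_arrow C f" "Dom C g = Dom C f" "Cod C g = Cod C f"
  shows "null f"
  using null_add[OF assms(1,2)] assms(2-) by simp

lemma null_diff_commute:
  assumes "null (f \<boxplus> \<ominus> g)" "is_arrow C f" "is_arrow C g" "Dom C g = Dom C f" "Cod C g = Cod C f"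
  shows "null (g \<boxplus> \<ominus> f)"
proof -
  have "g \<boxplus> \<ominus> f = \<ominus> (f \<boxplus> \<ominus> g)"
  proof (rule eq_negateI)
    have "(g \<boxplus> \<ominus> f) \<boxplus> (f \<boxplus> \<ominus> g) = g \<boxplus> ((\<ominus> f \<boxplus> f) \<boxplus> \<ominus> g)"
      using assms(2-) by (simp del: add_negate)
    also have "\<dots> = Zero C (Dom C g) (Cod C g)" using assms(2-) by simp
    finally show "(g \<boxplus> \<ominus> f) \<boxplus> (f \<boxplus> \<ominus> g) = Zero C (Dom C (g \<boxplus> \<ominus> f)) (Cod C (g \<boxplus> \<ominus> f))"
      using assms(2-) by simp
  qed (use assms in auto)
  then show ?thesis using assms(1) null_negate by metis
qed

lemma null_diff_trans:
  assumes "null (f \<boxplus> \<ominus> g)" "null (g \<boxplus> \<ominus> h)" "is_arrow C f" "is_arrow C g" "is_arrow C h"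
    "Dom C g = Dom C f" "Cod C g = Cod C f" "Dom C h = Dom C f" "Cod C h = Cod C f"
  shows "null (f \<boxplus> \<ominus> h)"
proof -
  have "(f \<boxplus> \<ominus> g) \<boxplus> (g \<boxplus> \<ominus> h) = f \<boxplus> ((\<ominus> g \<boxplus> g) \<boxplus> \<ominus> h)"
    using assms(3-) by (simp del: add_negate)
  also have "\<dots> = f \<boxplus> \<ominus> h" using assms(3-) by simp
  finally show ?thesis using null_add[OF assms(1,2)] assms(3-) by simp
qed

lemma null_diff_comp:
  assumes "null (f \<boxplus> \<ominus> f')" "null (g \<boxplus> \<ominus> g')" "arr C X Y f" "arr C X Y f'" "arr C Y Z g" "arr C Y Z g'"
  shows "null (g \<cdot> f \<boxplus> \<ominus> (g' \<cdot> f'))"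
proof (rule null_diff_trans)
  show "null (g \<cdot> f \<boxplus> \<ominus> (g \<cdot> f'))"
    using null_comp_left[OF assms(1), of g] assms(3-) by simp
  show "null (g \<cdot> f' \<boxplus> \<ominus> (g' \<cdot> f'))"
    using null_comp_right[OF assms(2), of f'] assms(3-) by simp
qed (use assms(3-) in auto)

lemma null_diff_add:
  assumes "null (f \<boxplus> \<ominus> f')" "null (g \<boxplus> \<ominus> g')" "arr C X Y f" "arr C X Y f'" "arr C X Y g" "arr C X Y g'"
  shows "null ((f \<boxplus> g) \<boxplus> \<ominus> (f' \<boxplus> g'))"
proof -
  have "(f \<boxplus> g) \<boxplus> \<ominus> (f' \<boxplus> g') = (f \<boxplus> \<ominus> f') \<boxplus> (g \<boxplus> \<ominus> g')"
  proof (rule add_right_cancel[of _ "f' \<boxplus> g'"])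
    have "((f \<boxplus> \<ominus> f') \<boxplus> (g \<boxplus> \<ominus> g')) \<boxplus> (f' \<boxplus> g') = (f \<boxplus> \<ominus> f') \<boxplus> ((g \<boxplus> \<ominus> g') \<boxplus> (g' \<boxplus> f'))"
      using assms(3-) add_commute[of f' g'] by simp
    also have "(g \<boxplus> \<ominus> g') \<boxplus> (g' \<boxplus> f') = ((g \<boxplus> \<ominus> g') \<boxplus> g') \<boxplus> f'" using assms(3-) by (simp del: add_negate)
    also have "\<dots> = f' \<boxplus> g" using assms(3-) add_diff_cancel(2)[of g g'] add_commute[of g f'] by simp
    also have "(f \<boxplus> \<ominus> f') \<boxplus> (f' \<boxplus> g) = ((f \<boxplus> \<ominus> f') \<boxplus> f') \<boxplus> g" using assms(3-) by (simp del: add_negate)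
    also have "\<dots> = f \<boxplus> g" using assms(3-) add_diff_cancel(2)[of f f'] by simp
    finally show "((f \<boxplus> g) \<boxplus> \<ominus> (f' \<boxplus> g')) \<boxplus> (f' \<boxplus> g') = ((f \<boxplus> \<ominus> f') \<boxplus> (g \<boxplus> \<ominus> g')) \<boxplus> (f' \<boxplus> g')"
      using add_diff_cancel(2)[of "f \<boxplus> g" "f' \<boxplus> g'"] assms(3-) by simp
  qed (use assms(3-) in auto)
  then show ?thesis using null_add[OF assms(1,2)] assms(3-) by simp
qed

lemma factor_ideal_iff: "arr C X Y f \<Longrightarrow> f \<in> factor_ideal C WW \<longleftrightarrow> null f"
proof
  assume f: "arr C X Y f" "f \<in> factor_ideal C WW"
  then obtain X' W Y' a b where "X' \<in> Obj C" "Y' \<in> Obj C" "W \<in> WW" "a \<in> Hom C X' W" "b \<in> Hom C W Y'" "f = b \<cdot> a"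
    unfolding factor_ideal_def by auto
  then show "null f"
    using WW_objects nullI[of W X' a Y' b] by (auto simp: hom_iff subset_iff)
next
  assume f: "arr C X Y f" "null f"
  from f(2) obtain W a b where W: "W \<in> WW" "arr C (Dom C f) W a" "arr C W (Cod C f) b" "f = b \<cdot> a"
    by (rule nullE)
  then have "Dom C f \<in> Obj C" "Cod C f \<in> Obj C" "a \<in> Hom C (Dom C f) W" "b \<in> Hom C W (Cod C f)"
    by (auto simp: arr_def simp del: arr_iff)
  then show "f \<in> factor_ideal C WW"
    unfolding factor_ideal_def using W(1,4) by blast
qed

lemma coset_eq:
  assumes f: "arr C X Y f" and H: "X \<in> H" "Y \<in> H"
  shows "coset f = {g. arr C X Y g \<and> null (g \<boxplus> \<ominus> f)}"
proof (intro equalityI subsetI)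
  fix g assume "g \<in> coset f"
  then obtain j X' Y' where j: "g = f \<boxplus> j" "X' \<in> H" "Y' \<in> H" "f \<in> Hom C X' Y'" "j \<in> Hom C X' Y'"
      "j \<in> factor_ideal C WW"
    unfolding ideal_coset_def full_subcategory_def by auto
  then have ja: "arr C X Y j" using f H_objects by (auto simp: hom_iff subset_iff)
  then have "null j" using j(6) factor_ideal_iff by blast
  moreover have "g = j \<boxplus> f" using j(1) ja f add_commute[of f j] by simp
  then have "g \<boxplus> \<ominus> f = j" using ja f by simp
  ultimately show "g \<in> {g. arr C X Y g \<and> null (g \<boxplus> \<ominus> f)}" using \<open>g = j \<boxplus> f\<close> ja f by auto
next
  fix g assume "g \<in> {g. arr C X Y g \<and> null (g \<boxplus> \<ominus> f)}"
  then have g: "arr C X Y g" "null (g \<boxplus> \<ominus> f)" by auto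
  let ?j = "g \<boxplus> \<ominus> f"
  have "arr C X Y ?j" using f g by simp
  then have "?j \<in> Hom C X Y" "?j \<in> factor_ideal C WW" using g(2) factor_ideal_iff[of X Y ?j]
    by (auto simp: hom_iff)
  moreover have "g = f \<boxplus> ?j" using add_diff_cancel(1)[of g f] f g by simp
  ultimately show "g \<in> coset f"
    unfolding ideal_coset_def full_subcategory_def using H arr_hom[OF f]
    by (simp del: arr_iff) blast
qed

lemma coset_self: "arr C X Y f \<Longrightarrow> X \<in> H \<Longrightarrow> Y \<in> H \<Longrightarrow> f \<in> coset f"
  using coset_eq[of X Y f] by simp

lemma coset_eq_iff:
  assumes "arr C X Y f" "arr C X Y g" "X \<in> H" "Y \<in> H"
  shows "coset f = coset g \<longleftrightarrow> null (f \<boxplus> \<ominus> g)"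
proof
  assume "coset f = coset g"
  then show "null (f \<boxplus> \<ominus> g)" using coset_self[OF assms(1,3,4)] coset_eq[OF assms(2-4)] by auto
next
  assume *: "null (f \<boxplus> \<ominus> g)"
  have **: "null (g \<boxplus> \<ominus> f)" by (rule null_diff_commute[OF *]) (use assms in auto)
  show "coset f = coset g"
    unfolding coset_eq[OF assms(1,3,4)] coset_eq[OF assms(2-4)]
  proof (intro Collect_cong conj_cong refl iffI)
    fix h assume h: "arr C X Y h"
    show "null (h \<boxplus> \<ominus> g)" if "null (h \<boxplus> \<ominus> f)"
      by (rule null_diff_trans[OF that *]) (use h assms in auto)
    show "null (h \<boxplus> \<ominus> f)" if "null (h \<boxplus> \<ominus> g)"
      by (rule null_diff_trans[OF that **]) (use h assms in auto)
  qed
qed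

lemma quotient_simps:
  "Obj quotient = H" "Hom quotient X Y = coset ` Hom C X Y" "Ide quotient X = coset (Ide C X)"
  "Zero quotient X Y = coset (Zero C X Y)"
  "G \<cdot>\<^bsub>quotient\<^esub> F = (\<Union>g\<in>G. \<Union>f\<in>F. coset (g \<cdot> f))"
  "F \<boxplus>\<^bsub>quotient\<^esub> G = (\<Union>f\<in>F. \<Union>g\<in>G. coset (f \<boxplus> g))"
  by (simp_all add: quotient_category_def full_subcategory_def)

lemma arr_cosetI: "arr C X Y f \<Longrightarrow> X \<in> H \<Longrightarrow> Y \<in> H \<Longrightarrow> arr quotient X Y (coset f)"
  by (simp add: arr_def quotient_simps del: arr_iff)

lemma arr_quotientE:
  assumes "arr quotient X Y F"
  obtains f where "arr C X Y f" "X \<in> H" "Y \<in> H" "F = coset f"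
  using assms H_objects by (auto simp: arr_def quotient_simps simp del: arr_iff)

lemma comp_coset:
  assumes "arr C X Y f" "arr C Y Z g" "X \<in> H" "Y \<in> H" "Z \<in> H"
  shows "coset g \<cdot>\<^bsub>quotient\<^esub> coset f = coset (g \<cdot> f)"
proof -
  have "coset (g' \<cdot> f') = coset (g \<cdot> f)" if "f' \<in> coset f" "g' \<in> coset g" for f' g'
  proof -
    have a: "arr C X Y f'" "arr C Y Z g'" "null (f' \<boxplus> \<ominus> f)" "null (g' \<boxplus> \<ominus> g)"
      using that coset_eq[OF assms(1,3,4)] coset_eq[OF assms(2,4,5)] by auto
    have "null (g' \<cdot> f' \<boxplus> \<ominus> (g \<cdot> f))" using null_diff_comp a assms by blast
    then show ?thesis using coset_eq_iff[of X Z "g' \<cdot> f'" "g \<cdot> f"] a assms by simp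
  qed
  then have "coset g \<cdot>\<^bsub>quotient\<^esub> coset f = (\<Union>g'\<in>coset g. \<Union>f'\<in>coset f. coset (g \<cdot> f))"
    unfolding quotient_simps by (intro SUP_cong refl)
  then show ?thesis
    using coset_self[OF assms(1,3,4)] coset_self[OF assms(2,4,5)] by blast
qed

lemma add_coset:
  assumes "arr C X Y f" "arr C X Y g" "X \<in> H" "Y \<in> H"
  shows "coset f \<boxplus>\<^bsub>quotient\<^esub> coset g = coset (f \<boxplus> g)"
proof -
  have "coset (f' \<boxplus> g') = coset (f \<boxplus> g)" if "f' \<in> coset f" "g' \<in> coset g" for f' g'
  proof -
    have a: "arr C X Y f'" "arr C X Y g'" "null (f' \<boxplus> \<ominus> f)" "null (g' \<boxplus> \<ominus> g)"
      using that coset_eq[OF assms(1,3,4)] coset_eq[OF assms(2,3,4)] by auto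
    have "null ((f' \<boxplus> g') \<boxplus> \<ominus> (f \<boxplus> g))" using null_diff_add a assms by blast
    then show ?thesis using coset_eq_iff[of X Y "f' \<boxplus> g'" "f \<boxplus> g"] a assms by simp
  qed
  then have "coset f \<boxplus>\<^bsub>quotient\<^esub> coset g = (\<Union>f'\<in>coset f. \<Union>g'\<in>coset g. coset (f \<boxplus> g))"
    unfolding quotient_simps by (intro SUP_cong refl)
  then show ?thesis
    using coset_self[OF assms(1,3,4)] coset_self[OF assms(2,3,4)] by blast
qed

lemma coset_biproduct:
  assumes "is_biproduct C X Y P i j p q" "X \<in> H" "Y \<in> H"
  shows "is_biproduct quotient X Y P (coset i) (coset j) (coset p) (coset q)"
proof -
  have P: "P \<in> H" using H_biproduct assms by blast
  have B: "arr C X P i" "arr C Y P j" "arr C P X p" "arr C P Y q"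
      "p \<cdot> i = Ide C X" "q \<cdot> j = Ide C Y" "p \<cdot> j = Zero C Y X" "q \<cdot> i = Zero C X Y"
      "i \<cdot> p \<boxplus> j \<cdot> q = Ide C P"
    using assms(1) unfolding is_biproduct_def arr_def by auto
  have "arr C P P (i \<cdot> p)" "arr C P P (j \<cdot> q)" using B by auto
  then show ?thesis
    unfolding is_biproduct_def using assms(2,3) P B(5-)
      arr_cosetI[OF B(1)] arr_cosetI[OF B(2)] arr_cosetI[OF B(3)] arr_cosetI[OF B(4)]
      comp_coset[OF B(1) B(3)] comp_coset[OF B(2) B(4)] comp_coset[OF B(2) B(3)] comp_coset[OF B(1) B(4)]
      comp_coset[OF B(3) B(1)] comp_coset[OF B(4) B(2)] add_coset[of P P "i \<cdot> p" "j \<cdot> q"]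
    by (simp add: quotient_simps arr_def del: arr_iff)
qed

lemma category_quotient: "category quotient"
proof
  fix X Y X' Y' F
  assume "X \<in> Obj quotient" "Y \<in> Obj quotient" "X' \<in> Obj quotient" "Y' \<in> Obj quotient"
    and "F \<in> Hom quotient X Y" "F \<in> Hom quotient X' Y'"
  then have "arr quotient X Y F" "arr quotient X' Y' F" by (auto simp: arr_def)
  then obtain f f' where f: "arr C X Y f" "X \<in> H" "Y \<in> H" "F = coset f"
      and f': "arr C X' Y' f'" "X' \<in> H" "Y' \<in> H" "F = coset f'"
    by (metis arr_quotientE)
  have "f \<in> coset f'" using coset_self[OF f(1-3)] f(4) f'(4) by simp
  then show "X = X' \<and> Y = Y'" using f(1) coset_eq[OF f'(1-3)] by auto
next
  fix X assume "X \<in> Obj quotient"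
  then show "Ide quotient X \<in> Hom quotient X X"
    using H_objects ide_in_hom by (auto simp: quotient_simps)
next
  fix X Y Z F G
  assume "X \<in> Obj quotient" "Y \<in> Obj quotient" "Z \<in> Obj quotient" "F \<in> Hom quotient X Y" "G \<in> Hom quotient Y Z"
  then have "arr quotient X Y F" "arr quotient Y Z G" by (auto simp: arr_def)
  then obtain f g where fg: "arr C X Y f" "arr C Y Z g" "X \<in> H" "Y \<in> H" "Z \<in> H" "F = coset f" "G = coset g"
    by (metis arr_quotientE)
  have "arr C X Z (g \<cdot> f)" using fg by simp
  then show "G \<cdot>\<^bsub>quotient\<^esub> F \<in> Hom quotient X Z"
    using arr_cosetI fg comp_coset[OF fg(1-5)] arr_hom by metis
next
  fix X Y F
  assume "X \<in> Obj quotient" "Y \<in> Obj quotient" "F \<in> Hom quotient X Y"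
  then have "arr quotient X Y F" by (auto simp: arr_def)
  then obtain f where f: "arr C X Y f" "X \<in> H" "Y \<in> H" "F = coset f"
    by (metis arr_quotientE)
  show "F \<cdot>\<^bsub>quotient\<^esub> Ide quotient X = F" "Ide quotient Y \<cdot>\<^bsub>quotient\<^esub> F = F"
    using comp_coset[of X X "Ide C X" Y f] comp_coset[of X Y f Y "Ide C Y"] f
    by (auto simp: quotient_simps)
next
  fix W X Y Z F G K
  assume "W \<in> Obj quotient" "X \<in> Obj quotient" "Y \<in> Obj quotient" "Z \<in> Obj quotient"
    "F \<in> Hom quotient W X" "G \<in> Hom quotient X Y" "K \<in> Hom quotient Y Z"
  then have "arr quotient W X F" "arr quotient X Y G" "arr quotient Y Z K" by (auto simp: arr_def)
  then obtain f g k where *: "arr C W X f" "arr C X Y g" "arr C Y Z k" "W \<in> H" "X \<in> H" "Y \<in> H" "Z \<in> H"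
      "F = coset f" "G = coset g" "K = coset k"
    by (metis arr_quotientE)
  have "arr C X Z (k \<cdot> g)" "arr C W Y (g \<cdot> f)" "(k \<cdot> g) \<cdot> f = k \<cdot> (g \<cdot> f)" using *(1-3) by auto
  then show "(K \<cdot>\<^bsub>quotient\<^esub> G) \<cdot>\<^bsub>quotient\<^esub> F = K \<cdot>\<^bsub>quotient\<^esub> (G \<cdot>\<^bsub>quotient\<^esub> F)"
    using * comp_coset by metis
qed

lemma preadditive_quotient: "preadditive_category quotient"
proof -
  interpret Q: category quotient by (rule category_quotient)
  show ?thesis
  proof (intro preadditive_category.intro category_quotient preadditive_category_axioms.intro)
    fix X Y assume "X \<in> Obj quotient" "Y \<in> Obj quotient"
    then have H: "X \<in> H" "Y \<in> H" by (auto simp: quotient_simps)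
    then have O: "X \<in> Obj C" "Y \<in> Obj C" using H_objects by auto
    have mem: "\<exists>f. arr C X Y f \<and> F = coset f" if "F \<in> carrier (hom_group quotient X Y)" for F
      using that O by (auto simp: hom_group_def quotient_simps arr_def)
    have memI: "coset f \<in> carrier (hom_group quotient X Y)" if "arr C X Y f" for f
      using that by (auto simp: hom_group_def quotient_simps arr_def simp del: arr_iff)
    have mult: "coset f \<otimes>\<^bsub>hom_group quotient X Y\<^esub> coset g = coset (f \<boxplus> g)"
      if "arr C X Y f" "arr C X Y g" for f g
      using add_coset[OF that H] by (simp add: hom_group_def)
    have one: "\<one>\<^bsub>hom_group quotient X Y\<^esub> = coset (Zero C X Y)"
      by (simp add: hom_group_def quotient_simps)
    show "comm_group (hom_group quotient X Y)"
    proof (rule comm_groupI)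
      fix F G assume "F \<in> carrier (hom_group quotient X Y)" "G \<in> carrier (hom_group quotient X Y)"
      then obtain f g where fg: "arr C X Y f" "arr C X Y g" "F = coset f" "G = coset g" using mem by blast
      have s: "arr C X Y (f \<boxplus> g)" using fg by simp
      show "F \<otimes>\<^bsub>hom_group quotient X Y\<^esub> G \<in> carrier (hom_group quotient X Y)"
        using fg s mult memI by simp
      show "F \<otimes>\<^bsub>hom_group quotient X Y\<^esub> G = G \<otimes>\<^bsub>hom_group quotient X Y\<^esub> F"
        using fg(1,2) add_commute[of f g] unfolding fg(3,4) mult[OF fg(1,2)] mult[OF fg(2,1)] by simp
      fix K assume "K \<in> carrier (hom_group quotient X Y)"
      then obtain k where k: "arr C X Y k" "K = coset k" using mem by blast
      have t: "arr C X Y (g \<boxplus> k)" using fg k by simp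
      show "(F \<otimes>\<^bsub>hom_group quotient X Y\<^esub> G) \<otimes>\<^bsub>hom_group quotient X Y\<^esub> K =
            F \<otimes>\<^bsub>hom_group quotient X Y\<^esub> (G \<otimes>\<^bsub>hom_group quotient X Y\<^esub> K)"
        using fg(1,2) k(1) unfolding fg(3,4) k(2) mult[OF fg(1,2)] mult[OF fg(2) k(1)] mult[OF s k(1)] mult[OF fg(1) t]
        by simp
    next
      have z: "arr C X Y (Zero C X Y)" using O by simp
      show "\<one>\<^bsub>hom_group quotient X Y\<^esub> \<in> carrier (hom_group quotient X Y)"
        using memI[OF z] one by simp
      fix F assume "F \<in> carrier (hom_group quotient X Y)"
      then obtain f where f: "arr C X Y f" "F = coset f" using mem by blast
      show "\<one>\<^bsub>hom_group quotient X Y\<^esub> \<otimes>\<^bsub>hom_group quotient X Y\<^esub> F = F"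
        using f mult[OF z f(1)] one by simp
      have n: "arr C X Y (\<ominus> f)" using f(1) by simp
      show "\<exists>G \<in> carrier (hom_group quotient X Y). G \<otimes>\<^bsub>hom_group quotient X Y\<^esub> F = \<one>\<^bsub>hom_group quotient X Y\<^esub>"
        by (rule bexI[OF _ memI[OF n]]) (use f mult[OF n f(1)] one in simp)
    qed
  next
    fix X Y Z F F' G
    assume "X \<in> Obj quotient" "Y \<in> Obj quotient" "Z \<in> Obj quotient"
      "F \<in> Hom quotient X Y" "F' \<in> Hom quotient X Y" "G \<in> Hom quotient Y Z"
    then have "arr quotient X Y F" "arr quotient X Y F'" "arr quotient Y Z G" by (auto simp: arr_def)
    then obtain f f' g where *: "arr C X Y f" "arr C X Y f'" "arr C Y Z g" "X \<in> H" "Y \<in> H" "Z \<in> H"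
        "F = coset f" "F' = coset f'" "G = coset g"
      by (metis arr_quotientE)
    have a: "arr C X Y (f \<boxplus> f')" "arr C X Z (g \<cdot> f)" "arr C X Z (g \<cdot> f')" using *(1-3) by auto
    show "G \<cdot>\<^bsub>quotient\<^esub> (F \<boxplus>\<^bsub>quotient\<^esub> F') = G \<cdot>\<^bsub>quotient\<^esub> F \<boxplus>\<^bsub>quotient\<^esub> G \<cdot>\<^bsub>quotient\<^esub> F'"
      unfolding *(7-9) add_coset[OF *(1,2,4,5)] comp_coset[OF *(1,3-6)] comp_coset[OF *(2,3-6)]
        comp_coset[OF a(1) *(3-6)] add_coset[OF a(2,3) *(4,6)]
      using *(1-3) by simp
  next
    fix X Y Z F G G'
    assume "X \<in> Obj quotient" "Y \<in> Obj quotient" "Z \<in> Obj quotient"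
      "F \<in> Hom quotient X Y" "G \<in> Hom quotient Y Z" "G' \<in> Hom quotient Y Z"
    then have "arr quotient X Y F" "arr quotient Y Z G" "arr quotient Y Z G'" by (auto simp: arr_def)
    then obtain f g g' where *: "arr C X Y f" "arr C Y Z g" "arr C Y Z g'" "X \<in> H" "Y \<in> H" "Z \<in> H"
        "F = coset f" "G = coset g" "G' = coset g'"
      by (metis arr_quotientE)
    have a: "arr C Y Z (g \<boxplus> g')" "arr C X Z (g \<cdot> f)" "arr C X Z (g' \<cdot> f)" using *(1-3) by auto
    show "(G \<boxplus>\<^bsub>quotient\<^esub> G') \<cdot>\<^bsub>quotient\<^esub> F = G \<cdot>\<^bsub>quotient\<^esub> F \<boxplus>\<^bsub>quotient\<^esub> G' \<cdot>\<^bsub>quotient\<^esub> F"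
      unfolding *(7-9) add_coset[OF *(2,3,5,6)] comp_coset[OF *(1,2,4-6)] comp_coset[OF *(1,3-6)]
        comp_coset[OF *(1) a(1) *(4-6)] add_coset[OF a(2,3) *(4,6)]
      using *(1-3) by simp
  qed
qed

lemma additive_quotient: "additive_category quotient"
proof -
  interpret Q: preadditive_category quotient by (rule preadditive_quotient)
  show ?thesis
  proof
    obtain Z where Z: "is_zero_object C Z" using ex_zero_object by blast
    have ex1: "\<exists>!F. F \<in> coset ` A" if "\<exists>!f. f \<in> A" for A :: "'m set" using that by blast
    have coset_ex1: "\<exists>!F. F \<in> coset ` Hom C X Z" "\<exists>!F. F \<in> coset ` Hom C Z X" if "X \<in> H" for X
    proof -
      have "\<exists>!f. f \<in> Hom C X Z" "\<exists>!f. f \<in> Hom C Z X"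
        using Z subsetD[OF H_objects that] by (simp_all only: is_zero_object_def)
      then show "\<exists>!F. F \<in> coset ` Hom C X Z" "\<exists>!F. F \<in> coset ` Hom C Z X"
        by (simp_all only: ex1)
    qed
    have "is_zero_object quotient Z"
      unfolding is_zero_object_def quotient_simps by (intro conjI ballI H_zero[OF Z] coset_ex1)
    then show "\<exists>Z. is_zero_object quotient Z" by blast
  next
    fix X Y assume "X \<in> Obj quotient" "Y \<in> Obj quotient"
    then show "\<exists>P i j p q. is_biproduct quotient X Y P i j p q"
      using ex_biproduct[of X Y] coset_biproduct[of X Y] H_objects unfolding quotient_simps by blast
  qed
qed

end

sublocale ideal_quotient \<subseteq> Q: additive_category quotient
  by (rule additive_quotient)

declare (in ideal_quotient) Q.arr_iff [simp del]

context ideal_quotient begin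

lemma coset_zero_iff:
  assumes "arr C X Y f" "X \<in> H" "Y \<in> H"
  shows "coset f = Zero quotient X Y \<longleftrightarrow> null f"
  using coset_eq_iff[of X Y f "Zero C X Y"] assms by (simp add: quotient_simps)

lemma coset_cokernelI:
  assumes "arr C X Y f" "arr C Y K c" "X \<in> H" "Y \<in> H" "K \<in> H" "null (c \<cdot> f)"
    and "\<And>Z z. Z \<in> H \<Longrightarrow> arr C Y Z z \<Longrightarrow> null (z \<cdot> f) \<Longrightarrow> \<exists>u. arr C K Z u \<and> null (u \<cdot> c \<boxplus> \<ominus> z)"
    and "\<And>Z u. Z \<in> H \<Longrightarrow> arr C K Z u \<Longrightarrow> null (u \<cdot> c) \<Longrightarrow> null u"
  shows "is_cokernel quotient X Y K (coset f) (coset c)"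
proof (rule Q.cokernelI)
  show "arr quotient X Y (coset f)" "arr quotient Y K (coset c)" using arr_cosetI assms(1-5) by blast+
  show "coset c \<cdot>\<^bsub>quotient\<^esub> coset f = Zero quotient X K"
    using comp_coset[OF assms(1-5)] coset_zero_iff[of X K "c \<cdot> f"] assms(1-6) by simp
  fix Z F assume "arr quotient Y Z F" "F \<cdot>\<^bsub>quotient\<^esub> coset f = Zero quotient X Z"
  then obtain z where z: "arr C Y Z z" "Z \<in> H" "F = coset z" "coset z \<cdot>\<^bsub>quotient\<^esub> coset f = Zero quotient X Z"
    by (metis arr_quotientE)
  have "null (z \<cdot> f)"
    using comp_coset[OF assms(1) z(1) assms(3,4) z(2)] coset_zero_iff[of X Z "z \<cdot> f"] z assms(1,3) by simp
  then obtain u where u: "arr C K Z u" "null (u \<cdot> c \<boxplus> \<ominus> z)" using assms(7) z by blast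
  have "coset u \<cdot>\<^bsub>quotient\<^esub> coset c = F"
    using comp_coset[OF assms(2) u(1) assms(4,5) z(2)] coset_eq_iff[of Y Z "u \<cdot> c" z] u z assms(2,4) by simp
  then show "\<exists>u. arr quotient K Z u \<and> u \<cdot>\<^bsub>quotient\<^esub> coset c = F"
    using arr_cosetI[OF u(1)] assms z by blast
next
  fix Z F assume "arr quotient K Z F" "F \<cdot>\<^bsub>quotient\<^esub> coset c = Zero quotient Y Z"
  then obtain z where z: "arr C K Z z" "Z \<in> H" "F = coset z" "coset z \<cdot>\<^bsub>quotient\<^esub> coset c = Zero quotient Y Z"
    by (metis arr_quotientE)
  have "null (z \<cdot> c)"
    using comp_coset[OF assms(2) z(1) assms(4,5) z(2)] coset_zero_iff[of Y Z "z \<cdot> c"] z assms(2,4) by simp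
  then have "null z" using assms(8) z by blast
  then show "F = Zero quotient K Z" using z coset_zero_iff[OF z(1) assms(5) z(2)] by simp
qed

lemma coset_monicI:
  assumes "arr C X Y f" "X \<in> H" "Y \<in> H"
    and "\<And>Z u. Z \<in> H \<Longrightarrow> arr C Z X u \<Longrightarrow> null (f \<cdot> u) \<Longrightarrow> null u"
  shows "monic quotient X Y (coset f)"
  unfolding monic_def
proof (intro conjI allI impI)
  show "arr quotient X Y (coset f)" using arr_cosetI assms(1-3) by blast
  fix Z F assume "arr quotient Z X F" "coset f \<cdot>\<^bsub>quotient\<^esub> F = Zero quotient Z Y"
  then obtain z where z: "arr C Z X z" "Z \<in> H" "F = coset z" "coset f \<cdot>\<^bsub>quotient\<^esub> coset z = Zero quotient Z Y"
    by (metis arr_quotientE)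
  have "null (f \<cdot> z)"
    using comp_coset[OF z(1) assms(1) z(2) assms(2,3)] coset_zero_iff[of Z Y "f \<cdot> z"] z assms(1,3) by simp
  then have "null z" using assms(4) z by blast
  then show "F = Zero quotient Z X" using z coset_zero_iff[OF z(1,2) assms(2)] by simp
qed

lemma coset_kernelI:
  assumes "arr C K X k" "arr C X Y f" "K \<in> H" "X \<in> H" "Y \<in> H" "null (f \<cdot> k)"
    and "\<And>Z z. Z \<in> H \<Longrightarrow> arr C Z X z \<Longrightarrow> null (f \<cdot> z) \<Longrightarrow> \<exists>u. arr C Z K u \<and> null (k \<cdot> u \<boxplus> \<ominus> z)"
    and "\<And>Z u. Z \<in> H \<Longrightarrow> arr C Z K u \<Longrightarrow> null (k \<cdot> u) \<Longrightarrow> null u"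
  shows "is_kernel quotient K X Y (coset k) (coset f)"
proof (rule Q.kernelI)
  show "arr quotient K X (coset k)" "arr quotient X Y (coset f)" using arr_cosetI assms(1-5) by blast+
  show "coset f \<cdot>\<^bsub>quotient\<^esub> coset k = Zero quotient K Y"
    using comp_coset[OF assms(1-5)] coset_zero_iff[of K Y "f \<cdot> k"] assms(1-6) by simp
  show "monic quotient K X (coset k)" using coset_monicI assms by blast
  fix Z F assume "arr quotient Z X F" "coset f \<cdot>\<^bsub>quotient\<^esub> F = Zero quotient Z Y"
  then obtain z where z: "arr C Z X z" "Z \<in> H" "F = coset z" "coset f \<cdot>\<^bsub>quotient\<^esub> coset z = Zero quotient Z Y"
    by (metis arr_quotientE)
  have "null (f \<cdot> z)"
    using comp_coset[OF z(1) assms(2) z(2) assms(4,5)] coset_zero_iff[of Z Y "f \<cdot> z"] z assms(2,5) by simp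
  then obtain u where u: "arr C Z K u" "null (k \<cdot> u \<boxplus> \<ominus> z)" using assms(7) z by blast
  have "coset k \<cdot>\<^bsub>quotient\<^esub> coset u = F"
    using comp_coset[OF u(1) assms(1) z(2) assms(3,4)] coset_eq_iff[of Z X "k \<cdot> u" z] u z assms(1,4) by simp
  then show "\<exists>u. arr quotient Z K u \<and> coset k \<cdot>\<^bsub>quotient\<^esub> u = F"
    using arr_cosetI[OF u(1)] assms z by blast
qed

end

lemma null_opposite:
  assumes "ideal_quotient C WW H" "ideal_quotient (opposite C) WW H'"
  shows "ideal_quotient.null (opposite C) WW f \<longleftrightarrow> ideal_quotient.null C WW f"
  unfolding ideal_quotient.null_def[OF assms(1)] ideal_quotient.null_def[OF assms(2)]
    arr_opposite is_arrow_opposite Dom_opposite Cod_opposite opposite_simps by blast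

section \<open>The heart when one half contains the other\<close>

text \<open>
  In the intended model \<open>seq X Y Z W f g h\<close> says that \<open>(f, g, h)\<close> is a triangle and \<open>W = \<Sigma>X\<close>, and
  \<open>S0\<close>, \<open>S1\<close>, \<open>V0\<close>, \<open>V1\<close> are \<open>\<Sigma>\<inverse>\<S>\<close>, \<open>\<Sigma>\<Sigma>\<inverse>\<S>\<close>, \<open>\<V>\<close>, \<open>\<Sigma>\<V>\<close>. The assumptions are chosen to be
  self-dual: reversing all arrows and exchanging \<open>S0\<close> with \<open>V1\<close>, \<open>S1\<close> with \<open>V0\<close> and \<open>T\<close> with \<open>U\<close>
  permutes them. This is why the octahedral axiom appears in two mirror-image forms.
\<close>

locale twin_sequences = additive_category C for C :: "('o, 'm, 'z) cat_scheme" (structure) +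
  fixes seq :: "'o \<Rightarrow> 'o \<Rightarrow> 'o \<Rightarrow> 'o \<Rightarrow> 'm \<Rightarrow> 'm \<Rightarrow> 'm \<Rightarrow> bool"
    and S0 S1 T U V0 V1 :: "'o set"
  assumes seq_arr: "seq X Y Z W f g h \<Longrightarrow> arr C X Y f \<and> arr C Y Z g \<and> arr C Z W h"
    and seq_zero: "seq X Y Z W f g h \<Longrightarrow> g \<cdot> f = Zero C X Z \<and> h \<cdot> g = Zero C Y W"
    and weak_kernel_1:
      "\<lbrakk>seq X Y Z W f g h; arr C Q Y z; g \<cdot> z = Zero C Q Z\<rbrakk> \<Longrightarrow> \<exists>u. arr C Q X u \<and> f \<cdot> u = z"
    and weak_kernel_2:
      "\<lbrakk>seq X Y Z W f g h; arr C Q Z z; h \<cdot> z = Zero C Q W\<rbrakk> \<Longrightarrow> \<exists>u. arr C Q Y u \<and> g \<cdot> u = z"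
    and weak_cokernel_1:
      "\<lbrakk>seq X Y Z W f g h; arr C Y Q z; z \<cdot> f = Zero C X Q\<rbrakk> \<Longrightarrow> \<exists>u. arr C Z Q u \<and> u \<cdot> g = z"
    and weak_cokernel_2:
      "\<lbrakk>seq X Y Z W f g h; arr C Z Q z; z \<cdot> g = Zero C Y Q\<rbrakk> \<Longrightarrow> \<exists>u. arr C W Q u \<and> u \<cdot> h = z"
    and T_objects: "T \<subseteq> Obj C" and U_objects: "U \<subseteq> Obj C"
    and S0_objects: "S0 \<subseteq> Obj C" and V1_objects: "V1 \<subseteq> Obj C"
    and approx_T: "X \<in> Obj C \<Longrightarrow> \<exists>a \<in> S0. \<exists>t \<in> T. \<exists>s \<in> S1. \<exists>f g h. seq a X t s f g h"
    and approx_U: "X \<in> Obj C \<Longrightarrow> \<exists>v \<in> V0. \<exists>u \<in> U. \<exists>w \<in> V1. \<exists>f g h. seq v u X w f g h"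
    and cone_S0: "\<lbrakk>a \<in> S0; arr C a Y f\<rbrakk> \<Longrightarrow> \<exists>M. \<exists>s \<in> S1. \<exists>g h. seq a Y M s f g h"
    and fibre_V1: "\<lbrakk>w \<in> V1; arr C Y w h\<rbrakk> \<Longrightarrow> \<exists>v \<in> V0. \<exists>L f g. seq v L Y w f g h"
    and fibre_S1: "\<lbrakk>s \<in> S1; arr C Y s h\<rbrakk> \<Longrightarrow> \<exists>a \<in> S0. \<exists>P f g. seq a P Y s f g h"
    and cone_V0: "\<lbrakk>v \<in> V0; arr C v Y f\<rbrakk> \<Longrightarrow> \<exists>P. \<exists>w \<in> V1. \<exists>g h. seq v Y P w f g h"
    and octahedron_fibre:
      "\<lbrakk>seq a X t s i p j; seq v u t w f g q\<rbrakk>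
        \<Longrightarrow> \<exists>K f' g' f'' g'' h''. seq v K X w f' g' (q \<cdot> p) \<and> seq a K u s f'' g'' h''"
    and octahedron_cone:
      "\<lbrakk>seq v u X w j r i; seq a u t s q g h\<rbrakk>
        \<Longrightarrow> \<exists>K g' h' f'' g'' h''. seq a X K s (r \<cdot> q) g' h' \<and> seq v t K w f'' g'' h''"
    and hom_S0_T: "\<lbrakk>a \<in> S0; t \<in> T; arr C a t f\<rbrakk> \<Longrightarrow> f = Zero C a t"
    and hom_U_V1: "\<lbrakk>u \<in> U; w \<in> V1; arr C u w f\<rbrakk> \<Longrightarrow> f = Zero C u w"
    and hom_S0_V0: "\<lbrakk>a \<in> S0; v \<in> V0; arr C a v f\<rbrakk> \<Longrightarrow> f = Zero C a v"
    and hom_S1_V1: "\<lbrakk>s \<in> S1; w \<in> V1; arr C s w f\<rbrakk> \<Longrightarrow> f = Zero C s w"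
    and T_if_hom_zero:
      "\<lbrakk>X \<in> Obj C; \<And>a f. a \<in> S0 \<Longrightarrow> arr C a X f \<Longrightarrow> f = Zero C a X\<rbrakk> \<Longrightarrow> X \<in> T"
    and U_if_hom_zero:
      "\<lbrakk>X \<in> Obj C; \<And>w f. w \<in> V1 \<Longrightarrow> arr C X w f \<Longrightarrow> f = Zero C X w\<rbrakk> \<Longrightarrow> X \<in> U"
begin

text \<open>
  The vanishing description of \<open>\<Sigma>\<inverse>\<S> * \<W>\<close>: by \<open>Cminus_seqE\<close> and \<open>Cminus_extension\<close> below, the objects
  of \<open>Cminus\<close> are exactly those with a sequence \<open>S0 \<rightarrow> X \<rightarrow> T \<inter> U \<rightarrow> S1\<close>. Dually, \<open>Cplus\<close> is
  \<open>\<W> * \<Sigma>\<V>\<close>.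
\<close>

definition Cminus :: "'o set" where
  "Cminus = {X \<in> Obj C. \<forall>t \<in> T. \<forall>w \<in> V1. \<forall>f g. arr C X t f \<longrightarrow> arr C t w g \<longrightarrow> g \<cdot> f = Zero C X w}"

definition Cplus :: "'o set" where
  "Cplus = {X \<in> Obj C. \<forall>u \<in> U. \<forall>a \<in> S0. \<forall>f g. arr C u X f \<longrightarrow> arr C a u g \<longrightarrow> f \<cdot> g = Zero C a X}"

lemma Cminus_zero:
  "X \<in> Cminus \<Longrightarrow> t \<in> T \<Longrightarrow> w \<in> V1 \<Longrightarrow> arr C X t f \<Longrightarrow> arr C t w g \<Longrightarrow> g \<cdot> f = Zero C X w"
  unfolding Cminus_def by blast

lemma CminusI:
  assumes "X \<in> Obj C"
    and "\<And>t w f g. t \<in> T \<Longrightarrow> w \<in> V1 \<Longrightarrow> arr C X t f \<Longrightarrow> arr C t w g \<Longrightarrow> g \<cdot> f = Zero C X w"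
  shows "X \<in> Cminus"
  using assms unfolding Cminus_def by blast

lemma Cminus_objects: "Cminus \<subseteq> Obj C"
  by (auto simp: Cminus_def)

lemma opposite_twin_sequences:
  "twin_sequences (opposite C) (\<lambda>X Y Z W f g h. seq W Z Y X h g f) V1 V0 U T S1 S0"
proof (intro twin_sequences.intro additive_opposite additive_category_axioms
    twin_sequences_axioms.intro; unfold arr_opposite opposite_simps)
  fix v u X w j r i a t s q g h
  assume "seq w X u v i r j" "seq s t u a h g q"
  then show "\<exists>K g' h' f'' g'' h''. seq s K X a h' g' (q \<cdot> r) \<and> seq w K t v h'' g'' f''"
    using octahedron_fibre[of w X u v i r j s t a h g q] by blast
next
  fix a X t s i p j v u w f g q
  assume "seq s t X a j p i" "seq w t u v q g f"
  then show "\<exists>K f' g' f'' g'' h''. seq w X K v (p \<cdot> q) g' f' \<and> seq s u K a h'' g'' f''"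
    using octahedron_cone[of s t X a j p i w u v q g f] by blast
qed (erule (2) weak_kernel_1 weak_kernel_2 weak_cokernel_1 weak_cokernel_2
    | rule T_objects U_objects S0_objects V1_objects
    | use seq_arr in blast | use seq_zero in blast | use approx_T in blast | use approx_U in blast
    | use cone_S0 in blast | use cone_V0 in blast | use fibre_S1 in blast | use fibre_V1 in blast
    | use hom_S0_T in blast | use hom_U_V1 in blast | use hom_S0_V0 in blast | use hom_S1_V1 in blast
    | use T_if_hom_zero in blast | use U_if_hom_zero in blast)+

lemma U_sub_Cminus: "U \<subseteq> Cminus"
proof
  fix X assume X: "X \<in> U"
  have "g \<cdot> f = Zero C X w" if "w \<in> V1" "arr C X t f" "arr C t w g" for t w f g
    by (rule hom_U_V1[OF X that(1)]) (use that in simp)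
  then show "X \<in> Cminus" using X U_objects unfolding Cminus_def by blast
qed

lemma S0_sub_Cminus: "S0 \<subseteq> Cminus"
proof
  fix X assume X: "X \<in> S0"
  have "g \<cdot> f = Zero C X w" if "t \<in> T" "w \<in> V1" "arr C X t f" "arr C t w g" for t w f g
    using hom_S0_T[OF X that(1,3)] that by simp
  then show "X \<in> Cminus" using X S0_objects unfolding Cminus_def by blast
qed

text \<open>
  Approximate \<open>X\<close> by \<open>a \<rightarrow> X \<rightarrow> t \<rightarrow> s\<close> with \<open>t \<in> T\<close>. A map \<open>t \<rightarrow> w\<close> to \<open>V1\<close> vanishes on \<open>X\<close>, hence
  factors through \<open>s\<close>, and there are no non-zero maps from \<open>S1\<close> to \<open>V1\<close>. So \<open>t \<in> U\<close>.
\<close>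

lemma Cminus_seqE:
  assumes "X \<in> Cminus"
  obtains a t s f g h where "a \<in> S0" "t \<in> T \<inter> U" "s \<in> S1" "seq a X t s f g h"
proof -
  obtain a t s f g h where *: "a \<in> S0" "t \<in> T" "s \<in> S1" "seq a X t s f g h"
    using approx_T assms Cminus_objects by blast
  note arrs = seq_arr[OF *(4)]
  have "t \<in> U"
  proof (rule U_if_hom_zero)
    show "t \<in> Obj C" using arrs by simp
    fix w x assume w: "w \<in> V1" "arr C t w x"
    have "x \<cdot> g = Zero C X w" using Cminus_zero[OF assms *(2) w(1)] arrs w(2) by blast
    then obtain y where y: "arr C s w y" "y \<cdot> h = x" using weak_cokernel_2[OF *(4) w(2)] by blast
    then show "x = Zero C t w" using hom_S1_V1[OF *(3) w(1) y(1)] arrs by auto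
  qed
  then show thesis using that * by blast
qed

text \<open>
  A map from \<open>X\<close> to \<open>T\<close> vanishes on \<open>a\<close> and so factors through \<open>Y\<close>.
\<close>

lemma Cminus_extension:
  assumes "seq a X Y s f g h" "a \<in> S0" "Y \<in> Cminus"
  shows "X \<in> Cminus"
proof -
  note arrs = seq_arr[OF assms(1)]
  have "y \<cdot> x = Zero C X w" if t: "t \<in> T" "w \<in> V1" "arr C X t x" "arr C t w y" for t w x y
  proof -
    have "x \<cdot> f = Zero C a t" by (rule hom_S0_T[OF assms(2) t(1)]) (use t arrs in simp)
    then obtain z where z: "arr C Y t z" "z \<cdot> g = x" using weak_cokernel_1[OF assms(1) t(3)] by blast
    have "y \<cdot> (z \<cdot> g) = Zero C Y w \<cdot> g"
      by (rule comp_reduce[OF Cminus_zero[OF assms(3) t(1,2) z(1) t(4)]]) (use z(1) t arrs in simp_all)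
    then show ?thesis using z arrs t by simp
  qed
  moreover have "X \<in> Obj C" using arrs by simp
  ultimately show ?thesis by (rule CminusI[rotated])
qed

text \<open>
  A composite \<open>Y \<rightarrow> t \<rightarrow> w\<close> vanishes on \<open>X\<close>, hence factors through \<open>s \<rightarrow> w\<close>, which is zero.
\<close>

lemma Cminus_cone:
  assumes "seq a X Y s f g h" "s \<in> S1" "X \<in> Cminus"
  shows "Y \<in> Cminus"
proof -
  note arrs = seq_arr[OF assms(1)]
  have "y \<cdot> x = Zero C Y w" if t: "t \<in> T" "w \<in> V1" "arr C Y t x" "arr C t w y" for t w x y
  proof -
    have "arr C X t (x \<cdot> g)" "arr C Y w (y \<cdot> x)" using t arrs by simp_all
    then have "(y \<cdot> x) \<cdot> g = Zero C X w"
      using Cminus_zero[OF assms(3) t(1,2) _ t(4), of "x \<cdot> g"] t arrs by simp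
    then obtain z where z: "arr C s w z" "z \<cdot> h = y \<cdot> x"
      using weak_cokernel_2[OF assms(1) \<open>arr C Y w (y \<cdot> x)\<close>] by blast
    then show ?thesis using hom_S1_V1[OF assms(2) t(2) z(1)] arrs by simp
  qed
  moreover have "Y \<in> Obj C" using arrs by simp
  ultimately show ?thesis by (rule CminusI[rotated])
qed

lemma biproduct_arrs:
  assumes "is_biproduct C X Y P i j p q"
  shows "arr C X P i" "arr C Y P j" "arr C P X p" "arr C P Y q" "i \<cdot> p \<boxplus> j \<cdot> q = Ide C P"
  using assms unfolding is_biproduct_def arr_def by auto

lemma T_biproduct:
  assumes B: "is_biproduct C X Y P i j p q" and "X \<in> T" "Y \<in> T"
  shows "P \<in> T"
proof (rule T_if_hom_zero)
  note arrs = biproduct_arrs[OF B]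
  show "P \<in> Obj C" using arrs(1) by simp
  fix a f assume f: "a \<in> S0" "arr C a P f"
  have "p \<cdot> f = Zero C a X" "q \<cdot> f = Zero C a Y"
    using hom_S0_T[OF f(1) assms(2)] hom_S0_T[OF f(1) assms(3)] f(2) arrs(3,4) by simp_all
  moreover have "f = (i \<cdot> p \<boxplus> j \<cdot> q) \<cdot> f" using f(2) by (simp add: arrs(5))
  then have "f = i \<cdot> (p \<cdot> f) \<boxplus> j \<cdot> (q \<cdot> f)" using arrs(1-4) f(2) by simp
  ultimately show "f = Zero C a P" using arrs(1-4) f(2) by simp
qed

lemma U_biproduct:
  assumes B: "is_biproduct C X Y P i j p q" and "X \<in> U" "Y \<in> U"
  shows "P \<in> U"
proof (rule U_if_hom_zero)
  note arrs = biproduct_arrs[OF B]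
  show "P \<in> Obj C" using arrs(1) by simp
  fix w f assume f: "w \<in> V1" "arr C P w f"
  have "f \<cdot> i = Zero C X w" "f \<cdot> j = Zero C Y w"
    using hom_U_V1[OF assms(2) f(1)] hom_U_V1[OF assms(3) f(1)] f(2) arrs(1,2) by simp_all
  moreover have "f = f \<cdot> (i \<cdot> p \<boxplus> j \<cdot> q)" using f(2) by (simp add: arrs(5))
  then have "f = (f \<cdot> i) \<cdot> p \<boxplus> (f \<cdot> j) \<cdot> q" using arrs(1-4) f(2) by simp
  ultimately show "f = Zero C P w" using arrs(1-4) f(2) by simp
qed

lemma Cminus_biproduct:
  assumes B: "is_biproduct C X Y P i j p q" and "X \<in> Cminus" "Y \<in> Cminus"
  shows "P \<in> Cminus"
proof -
  note arrs = biproduct_arrs[OF B]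
  have "g \<cdot> f = Zero C P w" if t: "t \<in> T" "w \<in> V1" "arr C P t f" "arr C t w g" for t w f g
  proof -
    have "g \<cdot> (f \<cdot> i) = Zero C X w" "g \<cdot> (f \<cdot> j) = Zero C Y w"
      by (rule Cminus_zero[OF _ t(1,2) _ t(4)]; use assms arrs t in simp)+
    moreover have "g \<cdot> f = (g \<cdot> f) \<cdot> (i \<cdot> p \<boxplus> j \<cdot> q)" using t by (simp add: arrs(5))
    then have "g \<cdot> f = (g \<cdot> (f \<cdot> i)) \<cdot> p \<boxplus> (g \<cdot> (f \<cdot> j)) \<cdot> q" using arrs(1-4) t by simp
    ultimately show ?thesis using arrs(1-4) t by simp
  qed
  then show ?thesis using arrs(1) unfolding Cminus_def by simp
qed

lemma zero_in_T: "is_zero_object C Z \<Longrightarrow> Z \<in> T"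
  by (rule T_if_hom_zero) (auto simp: is_zero_object_def zero_object_arr simp del: arr_iff)

lemma zero_in_U: "is_zero_object C Z \<Longrightarrow> Z \<in> U"
  by (rule U_if_hom_zero) (auto simp: is_zero_object_def zero_object_arr' simp del: arr_iff)

end

sublocale twin_sequences \<subseteq> ideal_quotient C "T \<inter> U" Cminus
proof
  show "T \<inter> U \<subseteq> Obj C" using T_objects by blast
  show "Cminus \<subseteq> Obj C" by (rule Cminus_objects)
  show "Z \<in> T \<inter> U" "Z \<in> Cminus" if "is_zero_object C Z" for Z
    using that zero_in_T zero_in_U U_sub_Cminus by blast+
  show "P \<in> T \<inter> U" if "is_biproduct C X Y P i j p q" "X \<in> T \<inter> U" "Y \<in> T \<inter> U" for X Y P i j p q
    using that T_biproduct U_biproduct by blast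
  show "P \<in> Cminus" if "is_biproduct C X Y P i j p q" "X \<in> Cminus" "Y \<in> Cminus" for X Y P i j p q
    using that Cminus_biproduct by blast
qed

context twin_sequences begin

lemma null_factorE:
  assumes "null f" "arr C X Y f"
  obtains W a b where "W \<in> T \<inter> U" "arr C X W a" "arr C W Y b" "f = b \<cdot> a"
proof -
  have "Dom C f = X" "Cod C f = Y" using assms(2) by simp_all
  then show thesis using that by (metis nullE[OF assms(1)])
qed

lemma null_from_S0:
  assumes "a \<in> S0" "arr C a X f" "null f"
  shows "f = Zero C a X"
proof -
  obtain W x y where W: "W \<in> T \<inter> U" "arr C a W x" "arr C W X y" "f = y \<cdot> x"
    using null_factorE[OF assms(3,2)] .
  have "x = Zero C a W" using hom_S0_T assms(1) W by blast
  then show ?thesis using W assms(2) by auto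
qed

lemma null_to_V1:
  assumes "w \<in> V1" "arr C X w f" "null f"
  shows "f = Zero C X w"
proof -
  obtain W x y where W: "W \<in> T \<inter> U" "arr C X W x" "arr C W w y" "f = y \<cdot> x"
    using null_factorE[OF assms(3,2)] .
  have "y = Zero C W w" using hom_U_V1 assms(1) W by blast
  then show ?thesis using W assms(2) by auto
qed

text \<open>
  The map vanishes on the \<open>S0\<close>-part of \<open>Z\<close> and so factors through its \<open>T \<inter> U\<close>-part.
\<close>

lemma null_Cminus_V0:
  assumes "Z \<in> Cminus" "v \<in> V0" "arr C Z v x"
  shows "null x"
proof -
  obtain a t s f g h where *: "a \<in> S0" "t \<in> T \<inter> U" "s \<in> S1" "seq a Z t s f g h"
    using Cminus_seqE[OF assms(1)] .
  note arrs = seq_arr[OF *(4)]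
  have "x \<cdot> f = Zero C a v" by (rule hom_S0_V0[OF *(1) assms(2)]) (use assms(3) arrs in simp)
  then obtain y where "arr C t v y" "y \<cdot> g = x" using weak_cokernel_1[OF *(4) assms(3)] by blast
  then show ?thesis using nullI[OF *(2)] arrs by blast
qed

text \<open>
  A factorization of \<open>g \<cdot> u\<close> through \<open>W \<in> T \<inter> U\<close> lifts along \<open>g\<close>, since maps from \<open>W \<in> U\<close> to \<open>w\<close> vanish.
  What remains of \<open>u\<close> after subtracting the lift is annihilated by \<open>g\<close>, thus passes through \<open>v\<close>, and
  maps from \<open>Cminus\<close> to \<open>V0\<close> are null.
\<close>

lemma null_reflected:
  assumes "seq v X Y w i g h" "v \<in> V0" "w \<in> V1" "Z \<in> Cminus" "arr C Z X u" "null (g \<cdot> u)"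
  shows "null u"
proof -
  note arrs = seq_arr[OF assms(1)]
  obtain W a b where W: "W \<in> T \<inter> U" "arr C Z W a" "arr C W Y b" "g \<cdot> u = b \<cdot> a"
  proof (rule null_factorE[OF assms(6)])
    show "arr C Z Y (g \<cdot> u)" using assms(5) arrs by simp
  qed
  have "h \<cdot> b = Zero C W w" by (rule hom_U_V1[OF _ assms(3)]) (use W(1,3) arrs in simp_all)
  then obtain c where c: "arr C W X c" "g \<cdot> c = b" using weak_kernel_2[OF assms(1) W(3)] by blast
  have "g \<cdot> (c \<cdot> a) = b \<cdot> a" by (rule comp_reduce[OF c(2)]) (use c(1) W(2) arrs in simp_all)
  then have "g \<cdot> u = g \<cdot> (c \<cdot> a)" by (simp only: W(4))
  then have "g \<cdot> (u \<boxplus> \<ominus> (c \<cdot> a)) = Zero C Z Y" using arrs assms(5) c(1) W(2,3) by simp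
  moreover have d: "arr C Z X (u \<boxplus> \<ominus> (c \<cdot> a))" using assms(5) c(1) W(2) by simp
  ultimately obtain x where x: "arr C Z v x" "i \<cdot> x = u \<boxplus> \<ominus> (c \<cdot> a)"
    using weak_kernel_1[OF assms(1)] by blast
  have "null x" using null_Cminus_V0 assms(2,4) x(1) by blast
  then have "null (i \<cdot> x)" by (rule null_comp_left) (use x arrs in auto)
  then have "null (u \<boxplus> \<ominus> (c \<cdot> a))" by (simp only: x(2))
  moreover have "null (c \<cdot> a)" using nullI W(1,2) c(1) by blast
  ultimately show ?thesis
    by (rule null_congruent) (use assms(5) c(1) W(2) in simp_all)
qed

lemma Cplus_eq_opposite:
  "twin_sequences.Cminus (opposite C) U S0 = Cplus"
proof -
  interpret op: twin_sequences "opposite C" "\<lambda>X Y Z W f g h. seq W Z Y X h g f" V1 V0 U T S1 S0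
    by (rule opposite_twin_sequences)
  show ?thesis unfolding op.Cminus_def Cplus_def arr_opposite opposite_simps by blast
qed

lemma Cplus_seqE:
  assumes "X \<in> Cplus"
  obtains v t w f g h where "v \<in> V0" "t \<in> T \<inter> U" "w \<in> V1" "seq v t X w f g h"
proof -
  interpret op: twin_sequences "opposite C" "\<lambda>X Y Z W f g h. seq W Z Y X h g f" V1 V0 U T S1 S0
    by (rule opposite_twin_sequences)
  have "X \<in> op.Cminus" using assms Cplus_eq_opposite by simp
  then obtain v t w f g h where "v \<in> V1" "t \<in> U \<inter> T" "w \<in> V0" "seq w t X v h g f"
    by (rule op.Cminus_seqE)
  then show thesis using that by blast
qed

lemma null_coreflected:
  assumes "seq a X Y s i g h" "a \<in> S0" "s \<in> S1" "Z \<in> Cplus" "arr C Y Z u" "null (u \<cdot> g)"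
  shows "null u"
proof -
  interpret op: twin_sequences "opposite C" "\<lambda>X Y Z W f g h. seq W Z Y X h g f" V1 V0 U T S1 S0
    by (rule opposite_twin_sequences)
  have *: "op.null f \<longleftrightarrow> null f" for f
    using null_opposite[OF ideal_quotient_axioms, of "Cplus" f] op.ideal_quotient_axioms
    by (simp add: Int_commute Cplus_eq_opposite)
  show ?thesis using op.null_reflected[of a X Y s i g h Z u] assms
    unfolding * Cplus_eq_opposite arr_opposite opposite_simps by blast
qed

lemma Cminus_eq_opposite:
  "twin_sequences.Cplus (opposite C) V1 T = Cminus"
proof -
  interpret op: twin_sequences "opposite C" "\<lambda>X Y Z W f g h. seq W Z Y X h g f" V1 V0 U T S1 S0
    by (rule opposite_twin_sequences)
  show ?thesis unfolding op.Cplus_def Cminus_def arr_opposite opposite_simps by blast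
qed

lemma Cplus_cone:
  assumes "seq v t X w f g h" "w \<in> V1" "t \<in> T"
  shows "X \<in> Cplus"
proof -
  interpret op: twin_sequences "opposite C" "\<lambda>X Y Z W f g h. seq W Z Y X h g f" V1 V0 U T S1 S0
    by (rule opposite_twin_sequences)
  have "t \<in> op.Cminus" using op.U_sub_Cminus assms(3) by blast
  then have "X \<in> op.Cminus" by (rule op.Cminus_extension[OF assms(1,2)])
  then show ?thesis by (simp only: Cplus_eq_opposite)
qed

text \<open>
  Approximate \<open>X \<rightarrow> t\<close> and \<open>u \<rightarrow> t \<rightarrow> w\<close>, and let \<open>K\<close> be the fibre of the composite \<open>X \<rightarrow> t \<rightarrow> w\<close>. That
  composite vanishes on objects of \<open>Cminus\<close> by definition, which gives the lifts. The octahedron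
  presents \<open>K\<close> as an extension of \<open>u \<in> U\<close> by \<open>a \<in> S0\<close>, so \<open>K \<in> Cminus\<close>.
\<close>

lemma coreflection:
  assumes "X \<in> Obj C"
  obtains v K w i k h where "v \<in> V0" "K \<in> Cminus" "w \<in> V1" "seq v K X w i k h"
    "\<And>Z z. Z \<in> Cminus \<Longrightarrow> arr C Z X z \<Longrightarrow> \<exists>u. arr C Z K u \<and> k \<cdot> u = z"
proof -
  obtain a t s i p j where 1: "a \<in> S0" "t \<in> T" "s \<in> S1" "seq a X t s i p j"
    using approx_T assms by blast
  note a1 = seq_arr[OF 1(4)]
  obtain v u w f g q where 2: "v \<in> V0" "u \<in> U" "w \<in> V1" "seq v u t w f g q"
    using approx_U a1 by (meson arr_objs)
  note a2 = seq_arr[OF 2(4)]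
  obtain K f' g' f'' g'' h'' where K: "seq v K X w f' g' (q \<cdot> p)" "seq a K u s f'' g'' h''"
    using octahedron_fibre[OF 1(4) 2(4)] by blast
  have "K \<in> Cminus" using Cminus_extension[OF K(2) 1(1)] U_sub_Cminus 2(2) by blast
  moreover have "\<exists>u. arr C Z K u \<and> g' \<cdot> u = z" if z: "Z \<in> Cminus" "arr C Z X z" for Z z
  proof (rule weak_kernel_2[OF K(1) z(2)])
    have "q \<cdot> (p \<cdot> z) = Zero C Z w"
      by (rule Cminus_zero[OF z(1) 1(2) 2(3)]) (use z a1 a2 in simp_all)
    then show "(q \<cdot> p) \<cdot> z = Zero C Z w" using z a1 a2 by simp
  qed
  ultimately show thesis using that 2 K(1) by blast
qed

text \<open>
  Existence of factorizations holds already before passing to the quotient, as \<open>c\<close> is a weak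
  cokernel of \<open>r\<close>. Uniqueness is the dual of \<open>null_reflected\<close> and needs test objects in \<open>Cplus\<close>; this
  is where \<open>Cminus \<subseteq> Cplus\<close> enters for cokernels.
\<close>

lemma quotient_cokernel_of_cone:
  assumes "seq a B M s r c d" "a \<in> S0" "s \<in> S1" "B \<in> Cminus" "Cminus \<subseteq> Cplus"
    and A: "A \<in> Cminus" "arr C A B f" "null (c \<cdot> f)"
    and f: "\<And>Z z. Z \<in> Cminus \<Longrightarrow> arr C B Z z \<Longrightarrow> null (z \<cdot> f) \<Longrightarrow> z \<cdot> r = Zero C a Z"
  shows "is_cokernel quotient A B M (coset f) (coset c)"
proof (rule coset_cokernelI)
  note arrs = seq_arr[OF assms(1)]
  show "arr C A B f" "arr C B M c" "A \<in> Cminus" "B \<in> Cminus" "M \<in> Cminus" "null (c \<cdot> f)"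
    using assms arrs Cminus_cone by blast+
  fix Z assume Z: "Z \<in> Cminus"
  show "null u" if "arr C M Z u" "null (u \<cdot> c)" for u
    using null_coreflected[OF assms(1-3) _ that] Z assms(5) by blast
  fix z assume z: "arr C B Z z" "null (z \<cdot> f)"
  obtain u where u: "arr C M Z u" "u \<cdot> c = z" using weak_cokernel_1[OF assms(1) z(1)] f[OF Z z] by blast
  then show "\<exists>u. arr C M Z u \<and> null (u \<cdot> c \<boxplus> \<ominus> z)" using z(1) by auto
qed

text \<open>
  With \<open>a \<rightarrow> A \<rightarrow> t \<rightarrow> s\<close> a presentation of \<open>A\<close>, take the cone of \<open>a \<rightarrow> A \<rightarrow> B\<close>. The composite
  \<open>A \<rightarrow> B \<rightarrow> M\<close> vanishes on \<open>a\<close> and so passes through \<open>t \<in> T \<inter> U\<close>; and a \<open>z\<close> with \<open>z \<cdot> f\<close> null satisfies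
  \<open>z \<cdot> f \<cdot> i = 0\<close> exactly, because null maps out of \<open>S0\<close> are zero.
\<close>

lemma quotient_cokernelE:
  assumes "A \<in> Cminus" "B \<in> Cminus" "arr C A B f" "Cminus \<subseteq> Cplus"
  obtains a M s r c d where "a \<in> S0" "s \<in> S1" "seq a B M s r c d"
    "is_cokernel quotient A B M (coset f) (coset c)"
proof -
  obtain a t s i p j where 1: "a \<in> S0" "t \<in> T \<inter> U" "s \<in> S1" "seq a A t s i p j"
    using Cminus_seqE[OF assms(1)] .
  note a1 = seq_arr[OF 1(4)]
  obtain M s' c d where 2: "s' \<in> S1" "seq a B M s' (f \<cdot> i) c d"
    using cone_S0[OF 1(1), of B "f \<cdot> i"] a1 assms(3) by auto
  note a2 = seq_arr[OF 2(2)]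
  have "(c \<cdot> f) \<cdot> i = Zero C a M" using seq_zero[OF 2(2)] a1 a2 assms(3) by simp
  moreover have "arr C A M (c \<cdot> f)" using a2 assms(3) by simp
  ultimately obtain u where u: "arr C t M u" "u \<cdot> p = c \<cdot> f" using weak_cokernel_1[OF 1(4)] by blast
  then have n: "null (c \<cdot> f)" using nullI[OF 1(2)] a1 by metis
  have "is_cokernel quotient A B M (coset f) (coset c)"
  proof (rule quotient_cokernel_of_cone[OF 2(2) 1(1) 2(1) assms(2,4,1,3) n])
    fix Z z assume z: "Z \<in> Cminus" "arr C B Z z" "null (z \<cdot> f)"
    have "null ((z \<cdot> f) \<cdot> i)" by (rule null_comp_right) (use z a1 assms(3) in simp_all)
    moreover have "(z \<cdot> f) \<cdot> i = z \<cdot> (f \<cdot> i)" using z a1 assms(3) by simp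
    moreover have "arr C a Z (z \<cdot> (f \<cdot> i))" using z a1 assms(3) by simp
    ultimately show "z \<cdot> (f \<cdot> i) = Zero C a Z" using null_from_S0[OF 1(1)] by metis
  qed
  then show thesis using that 1(1) 2 by blast
qed

text \<open>
  Here \<open>B \<in> Cplus\<close> is used: in a sequence \<open>v0 \<rightarrow> t \<rightarrow> B \<rightarrow> w\<close> with last map \<open>b\<close>, a map \<open>z\<close> has \<open>f \<cdot> z\<close> null if
  and only if \<open>b \<cdot> f \<cdot> z = 0\<close>. So a kernel of \<open>f\<close> is obtained from the fibre \<open>L\<close> of \<open>b \<cdot> f\<close>, made into an object of
  \<open>Cminus\<close> by coreflection. The two sequences are kept in the conclusion since pushing out
  kernels is done along them.
\<close>

lemma quotient_kernelE:
  assumes "A \<in> Cminus" "B \<in> Cminus" "arr C A B f" "Cminus \<subseteq> Cplus"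
  obtains v L w i l h v' K w' i' k h' where
    "v \<in> V0" "w \<in> V1" "seq v L A w i l h"
    "v' \<in> V0" "w' \<in> V1" "seq v' K L w' i' k h'"
    "K \<in> Cminus" "is_kernel quotient K A B (coset (l \<cdot> k)) (coset f)"
proof -
  obtain v0 t w x y b where 1: "v0 \<in> V0" "t \<in> T \<inter> U" "w \<in> V1" "seq v0 t B w x y b"
    using Cplus_seqE assms(2,4) by blast
  note a1 = seq_arr[OF 1(4)]
  obtain v L i l where 2: "v \<in> V0" "seq v L A w i l (b \<cdot> f)"
    using fibre_V1[OF 1(3), of A "b \<cdot> f"] a1 assms(3) by auto
  note a2 = seq_arr[OF 2(2)]
  have "L \<in> Obj C" using a2 by simp
  then obtain v' K w' i' k h' where 3: "v' \<in> V0" "K \<in> Cminus" "w' \<in> V1" "seq v' K L w' i' k h'"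
    and lift: "\<And>Z z. Z \<in> Cminus \<Longrightarrow> arr C Z L z \<Longrightarrow> \<exists>u. arr C Z K u \<and> k \<cdot> u = z"
    using coreflection[of L] by blast
  note a3 = seq_arr[OF 3(4)]
  have lk: "arr C K A (l \<cdot> k)" using a2 a3 by simp
  have "is_kernel quotient K A B (coset (l \<cdot> k)) (coset f)"
  proof (rule coset_kernelI[OF lk assms(3) 3(2) assms(1,2)])
    have "(b \<cdot> f) \<cdot> (l \<cdot> k) = Zero C L w \<cdot> k"
      by (rule comp_reduce) (use seq_zero[OF 2(2)] a2 a3 in auto)
    then have "b \<cdot> (f \<cdot> (l \<cdot> k)) = Zero C K w" using a1 a2 a3 assms(3) by simp
    moreover have flk: "arr C K B (f \<cdot> (l \<cdot> k))" using lk assms(3) by simp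
    ultimately obtain u where "arr C K t u" "y \<cdot> u = f \<cdot> (l \<cdot> k)"
      using weak_kernel_2[OF 1(4)] by blast
    then show "null (f \<cdot> (l \<cdot> k))" using nullI[OF 1(2)] a1 by metis
  next
    fix Z z assume z: "Z \<in> Cminus" "arr C Z A z" "null (f \<cdot> z)"
    have "null (b \<cdot> (f \<cdot> z))" by (rule null_comp_left) (use z a1 assms(3) in simp_all)
    moreover have "b \<cdot> (f \<cdot> z) = (b \<cdot> f) \<cdot> z" "arr C Z w ((b \<cdot> f) \<cdot> z)"
      using z a1 assms(3) by simp_all
    ultimately have "(b \<cdot> f) \<cdot> z = Zero C Z w" using null_to_V1[OF 1(3)] by metis
    then obtain z' where z': "arr C Z L z'" "l \<cdot> z' = z" using weak_kernel_2[OF 2(2) z(2)] by blast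
    then obtain u where u: "arr C Z K u" "k \<cdot> u = z'" using lift[OF z(1)] by blast
    have "(l \<cdot> k) \<cdot> u = z" using u z' a2 a3 by simp
    then show "\<exists>u. arr C Z K u \<and> null ((l \<cdot> k) \<cdot> u \<boxplus> \<ominus> z)"
      using u(1) z(2) by (intro exI[of _ u]) simp
  next
    fix Z u assume u: "Z \<in> Cminus" "arr C Z K u" "null ((l \<cdot> k) \<cdot> u)"
    have "null (l \<cdot> (k \<cdot> u))" using u a2 a3 by simp
    then have "null (k \<cdot> u)"
      by (rule null_reflected[OF 2(2,1) 1(3) u(1), rotated]) (use u a3 in simp)
    then show "null u"
      by (rule null_reflected[OF 3(4,1,3) u(1,2)])
  qed
  then show thesis using that 1 2 3 by blast
qed

lemma quotient_preabelian:
  assumes "Cminus \<subseteq> Cplus"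
  shows "preabelian_category quotient"
proof
  fix X Y F assume "X \<in> Obj quotient" "Y \<in> Obj quotient" "F \<in> Hom quotient X Y"
  then obtain f where f: "arr C X Y f" "X \<in> Cminus" "Y \<in> Cminus" "F = coset f"
    using arr_quotientE arrI by metis
  show "\<exists>K k. is_kernel quotient K X Y k F" "\<exists>K c. is_cokernel quotient X Y K F c"
    using quotient_kernelE[OF f(2,3,1) assms] quotient_cokernelE[OF f(2,3,1) assms] f(4) by metis+
qed

text \<open>
  Replace \<open>F\<close> by the cone \<open>c : X \<rightarrow> M\<close> of a map out of \<open>S0\<close>, with \<open>d : M \<rightarrow> s\<close>. The fibre \<open>P\<close> of
  \<open>Y \<rightarrow> M \<rightarrow> s\<close> lies in \<open>Cminus\<close>, its map to \<open>Y\<close> is a cokernel of the same kind, and \<open>P \<rightarrow> Y \<rightarrow> M\<close> lifts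
  to \<open>X\<close> because it is annihilated by \<open>d\<close>.
\<close>

lemma quotient_cokernel_square:
  assumes sub: "Cminus \<subseteq> Cplus" and F: "cokernel_morphism quotient X Z F" and G: "arr quotient Y Z G"
  shows "\<exists>P p q. cokernel_morphism quotient P Y q \<and> arr quotient P X p \<and>
    F \<cdot>\<^bsub>quotient\<^esub> p = G \<cdot>\<^bsub>quotient\<^esub> q"
proof -
  obtain A F0 where F0: "is_cokernel quotient A X Z F0 F" using F unfolding cokernel_morphism_def by blast
  then obtain f where f: "arr C A X f" "A \<in> Cminus" "X \<in> Cminus" "F0 = coset f"
    using Q.cokernel_arr by (metis arr_quotientE)
  obtain a M s r c d where 1: "a \<in> S0" "s \<in> S1" "seq a X M s r c d"
      "is_cokernel quotient A X M F0 (coset c)"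
    using quotient_cokernelE[OF f(2,3,1) sub] f(4) by metis
  note a1 = seq_arr[OF 1(3)]
  obtain e e' where e: "arr quotient Z M e" "arr quotient M Z e'" "e' \<cdot>\<^bsub>quotient\<^esub> e = Ide quotient Z"
      "e' \<cdot>\<^bsub>quotient\<^esub> coset c = F"
    using Q.cokernel_unique[OF F0 1(4)] by metis
  have eG: "arr quotient Y M (e \<cdot>\<^bsub>quotient\<^esub> G)" using e(1) G by (simp add: Q.arr_iff)
  obtain y where y: "arr C Y M y" "Y \<in> Cminus" "M \<in> Cminus" "e \<cdot>\<^bsub>quotient\<^esub> G = coset y"
    using arr_quotientE[OF eG] by metis
  obtain a' P r' q where 2: "a' \<in> S0" "seq a' P Y s r' q (d \<cdot> y)"
    using fibre_S1[OF 1(2), of Y "d \<cdot> y"] a1 y(1) by auto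
  note a2 = seq_arr[OF 2(2)]
  have P: "P \<in> Cminus" by (rule Cminus_extension[OF 2(2,1) y(2)])
  have yq: "arr C P M (y \<cdot> q)" using a2 y(1) by simp
  have "d \<cdot> (y \<cdot> q) = Zero C P s" using seq_zero[OF 2(2)] a1 a2 y(1) by simp
  then obtain p where p: "arr C P X p" "c \<cdot> p = y \<cdot> q" using weak_kernel_2[OF 1(3) yq] by blast
  have a': "a' \<in> Cminus" using 2(1) S0_sub_Cminus by blast
  have r': "arr C a' P r'" using a2 by blast
  have "is_cokernel quotient a' P Y (coset r') (coset q)"
  proof (rule quotient_cokernel_of_cone[OF 2(2,1) 1(2) P sub a' r'])
    show "null (q \<cdot> r')" using seq_zero[OF 2(2)] a2 by simp
    fix Z z assume z: "Z \<in> Cminus" "arr C P Z z" "null (z \<cdot> r')"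
    show "z \<cdot> r' = Zero C a' Z" by (rule null_from_S0[OF 2(1) _ z(3)]) (use z r' in simp)
  qed
  then have "cokernel_morphism quotient P Y (coset q)" unfolding cokernel_morphism_def by blast
  moreover have p': "arr quotient P X (coset p)" using arr_cosetI p(1) P f(3) by blast
  moreover have "F \<cdot>\<^bsub>quotient\<^esub> coset p = G \<cdot>\<^bsub>quotient\<^esub> coset q"
  proof -
    have c': "arr quotient X M (coset c)" using arr_cosetI a1 f(3) y(3) by blast
    have q': "arr quotient P Y (coset q)" using arr_cosetI a2 P y(2) by blast
    have q: "arr C P Y q" and c: "arr C X M c" using a1 a2 by blast+
    have "coset c \<cdot>\<^bsub>quotient\<^esub> coset p = coset y \<cdot>\<^bsub>quotient\<^esub> coset q"
      using comp_coset[OF p(1) c P f(3) y(3)] comp_coset[OF q y(1) P y(2,3)] p(2) by simp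
    then have *: "coset c \<cdot>\<^bsub>quotient\<^esub> coset p = (e \<cdot>\<^bsub>quotient\<^esub> G) \<cdot>\<^bsub>quotient\<^esub> coset q" by (simp only: y(4))
    have "F \<cdot>\<^bsub>quotient\<^esub> coset p = e' \<cdot>\<^bsub>quotient\<^esub> (coset c \<cdot>\<^bsub>quotient\<^esub> coset p)"
      unfolding e(4)[symmetric] by (rule Q.assoc) (use e(2) c' p' in \<open>simp_all add: Q.arr_iff\<close>)
    also have "\<dots> = (e' \<cdot>\<^bsub>quotient\<^esub> e) \<cdot>\<^bsub>quotient\<^esub> (G \<cdot>\<^bsub>quotient\<^esub> coset q)"
      unfolding * using e(1,2) G q' by (simp add: Q.arr_iff)
    also have "\<dots> = G \<cdot>\<^bsub>quotient\<^esub> coset q"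
      unfolding e(3) using G q' by (simp add: Q.arr_iff)
    finally show ?thesis .
  qed
  ultimately show ?thesis by blast
qed

lemma cone_V0_square:
  assumes "seq v X Y w i g h" "v \<in> V0" "arr C X Z f"
  obtains P w' g' h' p where "w' \<in> V1" "seq v Z P w' (f \<cdot> i) g' h'" "arr C Y P p" "p \<cdot> g = g' \<cdot> f"
proof -
  note a1 = seq_arr[OF assms(1)]
  obtain P w' g' h' where 2: "w' \<in> V1" "seq v Z P w' (f \<cdot> i) g' h'"
    using cone_V0[OF assms(2), of Z "f \<cdot> i"] a1 assms(3) by auto
  note a2 = seq_arr[OF 2(2)]
  have "(g' \<cdot> f) \<cdot> i = Zero C v P" using seq_zero[OF 2(2)] a1 a2 assms(3) by simp
  moreover have "arr C X P (g' \<cdot> f)" using a2 assms(3) by simp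
  ultimately show thesis using weak_cokernel_1[OF assms(1)] that 2 by metis
qed

text \<open>
  Replace \<open>F\<close> by the composite \<open>K \<rightarrow> L \<rightarrow> X\<close> of two maps with fibre in \<open>V0\<close> and push it out in two steps to
  \<open>Y \<rightarrow> P1 \<rightarrow> P2\<close>, again with fibres in \<open>V0\<close>. The object \<open>P2\<close> is arbitrary, but \<open>X\<close> and \<open>Y\<close> are in
  \<open>Cminus\<close>, so both maps into \<open>P2\<close> lift to its coreflection \<open>P\<close>. Commutativity over \<open>P\<close> and
  monicity of \<open>Y \<rightarrow> P\<close> follow because \<open>P \<rightarrow> P2\<close>, \<open>P1 \<rightarrow> P2\<close> and \<open>Y \<rightarrow> P1\<close> reflect null maps.
\<close>

lemma quotient_kernel_square:
  assumes sub: "Cminus \<subseteq> Cplus" and F: "kernel_morphism quotient Z X F" and G: "arr quotient Z Y G"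
  shows "\<exists>P i j. monic quotient Y P j \<and> arr quotient X P i \<and>
    i \<cdot>\<^bsub>quotient\<^esub> F = j \<cdot>\<^bsub>quotient\<^esub> G"
proof -
  obtain B F0 where F0: "is_kernel quotient Z X B F F0" using F unfolding kernel_morphism_def by blast
  then obtain f where f: "arr C X B f" "X \<in> Cminus" "B \<in> Cminus" "F0 = coset f"
    using Q.kernel_arr by (metis arr_quotientE)
  obtain v L w i l h v' K w' i' k h' where 1: "v \<in> V0" "w \<in> V1" "seq v L X w i l h"
    and 2: "v' \<in> V0" "w' \<in> V1" "seq v' K L w' i' k h'"
    and K: "K \<in> Cminus" "is_kernel quotient K X B (coset (l \<cdot> k)) F0"
    using quotient_kernelE[OF f(2,3,1) sub] f(4) by metis
  note a1 = seq_arr[OF 1(3)] note a2 = seq_arr[OF 2(3)]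
  obtain e e' where e: "arr quotient Z K e" "arr quotient K Z e'" "e' \<cdot>\<^bsub>quotient\<^esub> e = Ide quotient Z"
      "coset (l \<cdot> k) \<cdot>\<^bsub>quotient\<^esub> e = F"
    using Q.kernel_unique[OF F0 K(2)] by metis
  have Ge: "arr quotient K Y (G \<cdot>\<^bsub>quotient\<^esub> e')" using e(2) G by (simp add: Q.arr_iff)
  obtain y where y: "arr C K Y y" "Y \<in> Cminus" "G \<cdot>\<^bsub>quotient\<^esub> e' = coset y"
    using arr_quotientE[OF Ge] by metis
  obtain P1 w1 j1 h1 p1 where 3: "w1 \<in> V1" "seq v' Y P1 w1 (y \<cdot> i') j1 h1" "arr C L P1 p1" "p1 \<cdot> k = j1 \<cdot> y"
    using cone_V0_square[OF 2(3,1) y(1)] by metis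
  note a3 = seq_arr[OF 3(2)]
  obtain P2 w2 j2 h2 p2 where 4: "w2 \<in> V1" "seq v P1 P2 w2 (p1 \<cdot> i) j2 h2" "arr C X P2 p2" "p2 \<cdot> l = j2 \<cdot> p1"
    using cone_V0_square[OF 1(3,1) 3(3)] by metis
  note a4 = seq_arr[OF 4(2)]
  have "P2 \<in> Obj C" using a4 by simp
  then obtain v5 P w5 i5 m h5 where 5: "v5 \<in> V0" "P \<in> Cminus" "w5 \<in> V1" "seq v5 P P2 w5 i5 m h5"
    and lift: "\<And>Z z. Z \<in> Cminus \<Longrightarrow> arr C Z P2 z \<Longrightarrow> \<exists>u. arr C Z P u \<and> m \<cdot> u = z"
    using coreflection[of P2] by blast
  note a5 = seq_arr[OF 5(4)]
  have "arr C Y P2 (j2 \<cdot> j1)" using a3 a4 by simp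
  then obtain j where j: "arr C Y P j" "m \<cdot> j = j2 \<cdot> j1" using lift[OF y(2)] by blast
  obtain q where q: "arr C X P q" "m \<cdot> q = p2" using lift[OF f(2) 4(3)] by blast
  have jm: "monic quotient Y P (coset j)"
  proof (rule coset_monicI[OF j(1) y(2) 5(2)])
    fix Z u assume u: "Z \<in> Cminus" "arr C Z Y u" "null (j \<cdot> u)"
    have "null (m \<cdot> (j \<cdot> u))" by (rule null_comp_left) (use u j a5 in simp_all)
    moreover have "m \<cdot> (j \<cdot> u) = (j2 \<cdot> j1) \<cdot> u" by (rule comp_reduce[OF j(2)]) (use u j(1) a5 in simp_all)
    ultimately have "null (j2 \<cdot> (j1 \<cdot> u))" using u a3 a4 by simp
    then have "null (j1 \<cdot> u)"
      by (rule null_reflected[OF 4(2) 1(1) 4(1) u(1), rotated]) (use u a3 in simp)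
    then show "null u" by (rule null_reflected[OF 3(2) 2(1) 3(1) u(1,2)])
  qed
  have lk: "arr C K X (l \<cdot> k)" using a1 a2 by simp
  have "m \<cdot> (q \<cdot> (l \<cdot> k)) = p2 \<cdot> (l \<cdot> k)" by (rule comp_reduce[OF q(2)]) (use q(1) lk a5 in simp_all)
  also have "\<dots> = (j2 \<cdot> p1) \<cdot> k" by (rule comp_reduce[OF 4(4)]) (use 4(3) a1 a2 in simp_all)
  also have "\<dots> = j2 \<cdot> (p1 \<cdot> k)" by (rule assoc) (use 3(3) a2 a4 in simp_all)
  also have "\<dots> = j2 \<cdot> (j1 \<cdot> y)" by (simp only: 3(4))
  also have "\<dots> = (j2 \<cdot> j1) \<cdot> y" by (rule assoc[symmetric]) (use y(1) a3 a4 in simp_all)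
  also have "\<dots> = m \<cdot> (j \<cdot> y)" by (rule comp_reduce[OF j(2), symmetric]) (use y(1) j(1) a5 in simp_all)
  finally have "null (m \<cdot> (q \<cdot> (l \<cdot> k) \<boxplus> \<ominus> (j \<cdot> y)))"
    using a5 q(1) lk j(1) y(1) by simp
  then have n: "null (q \<cdot> (l \<cdot> k) \<boxplus> \<ominus> (j \<cdot> y))"
    by (rule null_reflected[OF 5(4,1,3) K(1), rotated]) (use q(1) lk j(1) y(1) in simp)
  have q': "arr quotient X P (coset q)" using arr_cosetI q(1) f(2) 5(2) by blast
  have j': "arr quotient Y P (coset j)" using arr_cosetI j(1) y(2) 5(2) by blast
  have lk': "arr quotient K X (coset (l \<cdot> k))" using arr_cosetI lk K(1) f(2) by blast
  have "arr C K P (q \<cdot> (l \<cdot> k))" "arr C K P (j \<cdot> y)" using q(1) lk j(1) y(1) by simp_all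
  then have "coset (q \<cdot> (l \<cdot> k)) = coset (j \<cdot> y)" using coset_eq_iff n K(1) 5(2) by blast
  then have *: "coset q \<cdot>\<^bsub>quotient\<^esub> coset (l \<cdot> k) = coset j \<cdot>\<^bsub>quotient\<^esub> (G \<cdot>\<^bsub>quotient\<^esub> e')"
    using comp_coset[OF lk q(1) K(1) f(2) 5(2)] comp_coset[OF y(1) j(1) K(1) y(2) 5(2)] y(3) by simp
  have "coset q \<cdot>\<^bsub>quotient\<^esub> F = (coset q \<cdot>\<^bsub>quotient\<^esub> coset (l \<cdot> k)) \<cdot>\<^bsub>quotient\<^esub> e"
    unfolding e(4)[symmetric] by (rule Q.assoc[symmetric]) (use e(1) q' lk' in \<open>simp_all add: Q.arr_iff\<close>)
  also have "\<dots> = coset j \<cdot>\<^bsub>quotient\<^esub> (G \<cdot>\<^bsub>quotient\<^esub> (e' \<cdot>\<^bsub>quotient\<^esub> e))"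
    unfolding * using e(1,2) G j' by (simp add: Q.arr_iff)
  also have "\<dots> = coset j \<cdot>\<^bsub>quotient\<^esub> G"
    unfolding e(3) using G by (simp add: Q.arr_iff)
  finally show ?thesis using jm q' by blast
qed

lemma quotient_quasi_abelian:
  assumes "Cminus \<subseteq> Cplus"
  shows "quasi_abelian_category quotient"
proof -
  interpret P: preabelian_category quotient by (rule quotient_preabelian[OF assms])
  interpret P: preabelian_with_squares quotient
    by unfold_locales (use quotient_cokernel_square[OF assms] quotient_kernel_square[OF assms] in blast)+
  show ?thesis by (rule P.quasi_abelian)
qed

lemma heart_quasi_abelian:
  assumes "Cminus \<subseteq> Cplus \<or> Cplus \<subseteq> Cminus"
  shows "quasi_abelian_category
    (quotient_category (full_subcategory C (Cminus \<inter> Cplus)) (factor_ideal C (T \<inter> U)))"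
proof (cases "Cminus \<subseteq> Cplus")
  case True
  then show ?thesis using quotient_quasi_abelian by (simp add: Int_absorb2)
next
  case False
  interpret op: twin_sequences "opposite C" "\<lambda>X Y Z W f g h. seq W Z Y X h g f" V1 V0 U T S1 S0
    by (rule opposite_twin_sequences)
  have "Cplus \<subseteq> Cminus" using False assms by blast
  then have H: "Cminus \<inter> Cplus = Cplus" by blast
  have "op.Cminus \<subseteq> op.Cplus" using \<open>Cplus \<subseteq> Cminus\<close> by (simp only: Cplus_eq_opposite Cminus_eq_opposite)
  from quasi_abelian_opposite[OF op.quotient_quasi_abelian[OF this]] show ?thesis
    unfolding quotient_category_opposite opposite_opposite Cplus_eq_opposite H Int_commute[of U T] .
qed

end

section \<open>Exactness properties of triangles\<close>

context category begin

lemma isomorphicE: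
  assumes "isomorphic C X Y"
  obtains a b where "is_iso C X Y a" "is_iso C Y X b" "b \<cdot> a = Ide C X" "a \<cdot> b = Ide C Y"
    "arr C X Y a" "arr C Y X b"
proof -
  obtain a b where "X \<in> Obj C" "Y \<in> Obj C" "a \<in> Hom C X Y" "b \<in> Hom C Y X" "b \<cdot> a = Ide C X" "a \<cdot> b = Ide C Y"
    using assms unfolding isomorphic_def is_iso_def by blast
  then show thesis using that[of a b] unfolding is_iso_def arr_def by blast
qed

lemma isomorphic_sym: "isomorphic C X Y \<Longrightarrow> isomorphic C Y X"
  by (metis isomorphicE isomorphic_def)

lemma ide_iso: "X \<in> Obj C \<Longrightarrow> is_iso C X X (Ide C X)"
  unfolding is_iso_def using ide_in_hom[of X] by (auto intro!: bexI[of _ "Ide C X"])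

end

context triangulated_category begin

lemma susp_arrow [simp]:
  assumes "is_arrow C f"
  shows "is_arrow C (SuspM C f)" "Dom C (SuspM C f) = Susp C (Dom C f)" "Cod C (SuspM C f) = Susp C (Cod C f)"
proof -
  have "SuspM C f \<in> Hom C (Susp C (Dom C f)) (Susp C (Cod C f))"
    using susp_fully_faithful[of "Dom C f" "Cod C f"] assms hom_iff
    unfolding bij_betw_def by auto
  then show "is_arrow C (SuspM C f)" "Dom C (SuspM C f) = Susp C (Dom C f)" "Cod C (SuspM C f) = Susp C (Cod C f)"
    using assms by (simp_all add: hom_iff susp_obj)
qed

lemma susp_composite [simp]:
  "is_arrow C f \<Longrightarrow> is_arrow C g \<Longrightarrow> Dom C g = Cod C f \<Longrightarrow> SuspM C (g \<cdot> f) = SuspM C g \<cdot> SuspM C f"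
  using susp_comp[of "Dom C f" "Cod C f" "Cod C g" f g] by (simp add: hom_iff)

lemma susp_inject:
  assumes "SuspM C f = SuspM C g" "is_arrow C f" "is_arrow C g" "Dom C g = Dom C f" "Cod C g = Cod C f"
  shows "f = g"
  using susp_fully_faithful[of "Dom C f" "Cod C f"] assms unfolding bij_betw_def inj_on_def
  by (simp add: hom_iff)

lemma susp_full:
  assumes "arr C (Susp C X) (Susp C Y) g" "X \<in> Obj C" "Y \<in> Obj C"
  obtains f where "arr C X Y f" "SuspM C f = g"
proof -
  have "g \<in> SuspM C ` Hom C X Y"
    using susp_fully_faithful[OF assms(2,3)] arr_hom[OF assms(1)] unfolding bij_betw_def by simp
  then show thesis using that assms(2,3) by (auto simp: arr_def)
qed

declare susp_obj [simp]

lemma susp_zero [simp]: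
  assumes "X \<in> Obj C" "Y \<in> Obj C"
  shows "SuspM C (Zero C X Y) = Zero C (Susp C X) (Susp C Y)"
proof -
  have "SuspM C (Zero C X Y \<boxplus> Zero C X Y) = SuspM C (Zero C X Y) \<boxplus> SuspM C (Zero C X Y)"
    by (rule susp_add[OF assms]) (use assms in \<open>simp_all add: hom_iff\<close>)
  then have "SuspM C (Zero C X Y) \<boxplus> SuspM C (Zero C X Y) =
      Zero C (Susp C X) (Susp C Y) \<boxplus> SuspM C (Zero C X Y)" using assms by simp
  then show ?thesis by (rule add_right_cancel) (use assms in simp_all)
qed

lemma susp_zero_object:
  assumes "is_zero_object C Z"
  shows "is_zero_object C (Susp C Z)"
proof -
  have Z: "Z \<in> Obj C" using assms by (simp add: is_zero_object_def)
  have "Ide C Z = Zero C Z Z" by (rule zero_object_arr[OF assms]) (use Z in simp)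
  then have "SuspM C (Ide C Z) = SuspM C (Zero C Z Z)" by (rule arg_cong)
  then have *: "Ide C (Susp C Z) = Zero C (Susp C Z) (Susp C Z)" using Z by (simp add: susp_ide)
  have "f = Zero C X (Susp C Z)" if "arr C X (Susp C Z) f" for X f
  proof -
    have "Ide C (Susp C Z) \<cdot> f = Zero C X (Susp C Z)" unfolding * using that Z by simp
    then show ?thesis using that Z by simp
  qed
  moreover have "f = Zero C (Susp C Z) X" if "arr C (Susp C Z) X f" for X f
  proof -
    have "f \<cdot> Ide C (Susp C Z) = Zero C (Susp C Z) X" unfolding * using that Z by simp
    then show ?thesis using that Z by simp
  qed
  moreover have "Zero C X (Susp C Z) \<in> Hom C X (Susp C Z)" "Zero C (Susp C Z) X \<in> Hom C (Susp C Z) X"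
    if "X \<in> Obj C" for X using that Z by (simp_all add: hom_iff)
  ultimately have "X \<in> Obj C \<Longrightarrow> \<exists>!f. f \<in> Hom C X (Susp C Z)" "X \<in> Obj C \<Longrightarrow> \<exists>!f. f \<in> Hom C (Susp C Z) X" for X
    using arrI[OF _ susp_obj[OF Z]] arrI[OF susp_obj[OF Z]] by metis+
  then show ?thesis
    unfolding is_zero_object_def using susp_obj[OF Z] by (intro conjI ballI)
qed

lemma triangle_arr:
  "triangle C X Y Z f g h \<Longrightarrow> arr C X Y f \<and> arr C Y Z g \<and> arr C Z (Susp C X) h"
  unfolding triangle_def candidate_triangle_def using susp_obj by (simp add: arr_def del: arr_iff)

lemma candidate_triangleI:
  "arr C X Y f \<Longrightarrow> arr C Y Z g \<Longrightarrow> arr C Z (Susp C X) h \<Longrightarrow> candidate_triangle C X Y Z f g h"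
  unfolding candidate_triangle_def by (simp add: arr_def del: arr_iff)

lemma triangle_rotate:
  assumes "triangle C X Y Z f g h"
  shows "triangle C Y Z (Susp C X) g h (\<ominus> (SuspM C f))"
proof -
  have "arr C (Susp C X) (Susp C Y) (SuspM C f)" using triangle_arr[OF assms] by auto
  then show ?thesis using TR2[of X Y Z f g h] assms neg_eq unfolding triangle_def by metis
qed

text \<open>
  By fullness of the suspension the last map \<open>k\<close> is of the form \<open>-\<Sigma>f\<close>.
\<close>

lemma triangle_unrotate:
  assumes "triangle C Y Z (Susp C X) g h k" "X \<in> Obj C"
  obtains f where "triangle C X Y Z f g h"
proof -
  note arrs = triangle_arr[OF assms(1)]
  have "arr C (Susp C X) (Susp C Y) (\<ominus> k)" using arrs by simp
  then obtain f where f: "arr C X Y f" "SuspM C f = \<ominus> k" using susp_full[OF _ assms(2)] arrs arr_objs by metis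
  have cand: "candidate_triangle C X Y Z f g h" using candidate_triangleI arrs f(1) by blast
  have "arr C (Susp C X) (Susp C Y) (SuspM C f)" using f arrs by simp
  then have "neg C (Susp C X) (Susp C Y) (SuspM C f) = \<ominus> (SuspM C f)" by (rule neg_eq)
  then have "neg C (Susp C X) (Susp C Y) (SuspM C f) = k" using f(2) arrs by simp
  then show thesis using TR2[OF cand] assms(1) that by simp
qed

lemma triangle_desuspend:
  assumes "triangle C (Susp C X) (Susp C Y) (Susp C Z) f g h" "X \<in> Obj C" "Y \<in> Obj C" "Z \<in> Obj C"
  obtains f' g' h' where "triangle C X Y Z f' g' h'"
  by (meson assms triangle_unrotate)

lemma triangle_morphism:
  assumes "triangle C X Y Z f g h" "triangle C X' Y' Z' f' g' h'" "arr C X X' a" "arr C Y Y' b" "b \<cdot> f = f' \<cdot> a"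
  obtains c where "arr C Z Z' c" "c \<cdot> g = g' \<cdot> b" "SuspM C a \<cdot> h = h' \<cdot> c"
proof -
  obtain c where "c \<in> Hom C Z Z'" "c \<cdot> g = g' \<cdot> b" "SuspM C a \<cdot> h = h' \<cdot> c"
    using TR3[OF assms(1,2) arr_hom[OF assms(3)] arr_hom[OF assms(4)] assms(5)] by blast
  then show thesis using that triangle_arr[OF assms(1)] triangle_arr[OF assms(2)] by (simp add: hom_iff)
qed

lemma triangle_comp_zero:
  assumes "triangle C X Y Z f g h"
  shows "g \<cdot> f = Zero C X Z" "h \<cdot> g = Zero C Y (Susp C X)"
proof -
  have *: "g \<cdot> f = Zero C X Z" if t: "triangle C X Y Z f g h" for X Y Z f g h
  proof -
    note arrs = triangle_arr[OF t]
    obtain N where N: "is_zero_object C N" using ex_zero_object by blast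
    then have NO: "N \<in> Obj C" by (simp add: is_zero_object_def)
    have "triangle C X X N (Ide C X) (Zero C X N) (Zero C N (Susp C X))"
      using TR1_ide N arrs by simp
    then obtain c where "arr C N Z c" "c \<cdot> Zero C X N = g \<cdot> f"
      by (rule triangle_morphism[OF _ t, where a = "Ide C X" and b = f]) (use arrs in auto)
    then show ?thesis using arrs NO by simp
  qed
  show "g \<cdot> f = Zero C X Z" using * assms by blast
  show "h \<cdot> g = Zero C Y (Susp C X)" using * triangle_rotate[OF assms] by blast
qed

text \<open>
  Compare with the rotation of the trivial triangle \<open>Q \<rightarrow> Q \<rightarrow> 0\<close>; the map of triangles has a
  component \<open>\<Sigma>Q \<rightarrow> \<Sigma>X\<close>, which desuspends.
\<close>

lemma triangle_weak_kernel_1: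
  assumes t: "triangle C X Y Z f g h" and z: "arr C Q Y z" "g \<cdot> z = Zero C Q Z"
  shows "\<exists>u. arr C Q X u \<and> f \<cdot> u = z"
proof -
  note arrs = triangle_arr[OF t]
  obtain N where N: "is_zero_object C N" using ex_zero_object by blast
  then have NO: "N \<in> Obj C" by (simp add: is_zero_object_def)
  have Q: "Q \<in> Obj C" using z by simp
  have "triangle C Q Q N (Ide C Q) (Zero C Q N) (Zero C N (Susp C Q))" using TR1_ide N Q by simp
  note t' = triangle_rotate[OF this]
  obtain c where c: "arr C (Susp C Q) (Susp C X) c"
      "SuspM C z \<cdot> \<ominus> (SuspM C (Ide C Q)) = \<ominus> (SuspM C f) \<cdot> c"
    by (rule triangle_morphism[OF t' triangle_rotate[OF t] z(1), where b = "Zero C N Z"])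
      (use z arrs NO Q in auto)
  obtain u where u: "arr C Q X u" "SuspM C u = c" using susp_full[OF c(1)] Q arrs by auto
  have "\<ominus> (SuspM C z) = \<ominus> (SuspM C (f \<cdot> u))" using c u z(1) arrs Q by (simp add: susp_ide)
  then have "\<ominus> (\<ominus> (SuspM C z)) = \<ominus> (\<ominus> (SuspM C (f \<cdot> u)))" by simp
  then have "SuspM C (f \<cdot> u) = SuspM C z" using z(1) u(1) arrs by simp
  then have "f \<cdot> u = z" by (rule susp_inject) (use z(1) u(1) arrs in simp_all)
  then show ?thesis using u(1) by blast
qed

text \<open>
  Compare with the triangle \<open>0 \<rightarrow> Q \<rightarrow> Q\<close>, which is the trivial triangle \<open>Q \<rightarrow> Q \<rightarrow> \<Sigma>0\<close> rotated back.
\<close>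

lemma triangle_weak_cokernel_1:
  assumes t: "triangle C X Y Z f g h" and z: "arr C Y Q z" "z \<cdot> f = Zero C X Q"
  shows "\<exists>u. arr C Z Q u \<and> u \<cdot> g = z"
proof -
  note arrs = triangle_arr[OF t]
  obtain N where N: "is_zero_object C N" using ex_zero_object by blast
  then have NO: "N \<in> Obj C" by (simp add: is_zero_object_def)
  have Q: "Q \<in> Obj C" using z by simp
  have "triangle C Q Q (Susp C N) (Ide C Q) (Zero C Q (Susp C N)) (Zero C (Susp C N) (Susp C Q))"
    using TR1_ide susp_zero_object N Q by simp
  then obtain k where t': "triangle C N Q Q k (Ide C Q) (Zero C Q (Susp C N))"
    using triangle_unrotate NO by blast
  have k: "arr C N Q k" using triangle_arr[OF t'] by blast
  obtain u where "arr C Z Q u" "u \<cdot> g = Ide C Q \<cdot> z"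
    by (rule triangle_morphism[OF t t' _ z(1), where a = "Zero C X N"]) (use z arrs NO k in auto)
  then show ?thesis using z(1) by auto
qed

lemma triangle_replace_third:
  assumes t: "triangle C X Y Z f g h" and "isomorphic C Z Z'"
  obtains g' h' where "triangle C X Y Z' f g' h'"
proof -
  note arrs = triangle_arr[OF t]
  obtain a b where ab: "is_iso C Z Z' a" "b \<cdot> a = Ide C Z" "arr C Z Z' a" "arr C Z' Z b"
    using isomorphicE[OF assms(2)] by metis
  have "triangle C X Y Z' f (a \<cdot> g) (h \<cdot> b)"
  proof (rule TR1_iso[OF t _ ide_iso ide_iso ab(1)])
    show "candidate_triangle C X Y Z' f (a \<cdot> g) (h \<cdot> b)"
      by (rule candidate_triangleI) (use arrs ab in auto)
    show "SuspM C (Ide C X) \<cdot> h = (h \<cdot> b) \<cdot> a" using arrs ab(2-4) by (simp add: susp_ide)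
  qed (use arrs ab in auto)
  then show thesis by (rule that)
qed

lemma triangle_replace_first:
  assumes t: "triangle C X Y Z f g h" and "isomorphic C X X'"
  obtains f' h' where "triangle C X' Y Z f' g h'"
proof -
  note arrs = triangle_arr[OF t]
  obtain a b where ab: "is_iso C X X' a" "b \<cdot> a = Ide C X" "arr C X X' a" "arr C X' X b"
    using isomorphicE[OF assms(2)] by metis
  have "triangle C X' Y Z (f \<cdot> b) g (SuspM C a \<cdot> h)"
  proof (rule TR1_iso[OF t _ ab(1) ide_iso ide_iso])
    show "candidate_triangle C X' Y Z (f \<cdot> b) g (SuspM C a \<cdot> h)"
      by (rule candidate_triangleI) (use arrs ab in auto)
    show "Ide C Y \<cdot> f = (f \<cdot> b) \<cdot> a" using arrs ab(2-4) by simp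
  qed (use arrs ab in auto)
  then show thesis by (rule that)
qed

lemma triangle_complete:
  assumes "arr C Y (Susp C X) h" "X \<in> Obj C"
  obtains L f g where "triangle C X L Y f g h"
proof -
  obtain Q g' h' where t: "triangle C Y (Susp C X) Q h g' h'"
    using TR1_cone assms(1) arr_hom arr_objs by metis
  note arrs = triangle_arr[OF t]
  obtain L where L: "L \<in> Obj C" "isomorphic C (Susp C L) Q" using susp_ess_surj arrs by auto
  obtain g2 h2 where "triangle C Y (Susp C X) (Susp C L) h g2 h2"
    using triangle_replace_third[OF t isomorphic_sym[OF L(2)]] .
  then obtain g1 where "triangle C L Y (Susp C X) g1 h g2" using triangle_unrotate L(1) by blast
  then obtain f where "triangle C X L Y f g1 h" using triangle_unrotate assms(2) by blast
  then show thesis by (rule that)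
qed

text \<open>
  A section \<open>j\<close> of \<open>g\<close> exists since \<open>h\<close> annihilates the identity of \<open>Z\<close>, and \<open>1 - j \<cdot> g\<close> factors
  through \<open>f\<close> as \<open>f \<cdot> p\<close>. The remaining identities can be checked after composing with \<open>f\<close>, because
  \<open>f\<close> is monic: \<open>\<Sigma>u\<close> factors through \<open>h = 0\<close> if \<open>f \<cdot> u = 0\<close>.
\<close>

lemma triangle_split:
  assumes t: "triangle C X Y Z f g h" and h: "h = Zero C Z (Susp C X)"
  shows "\<exists>p j. is_biproduct C X Z Y f j p g"
proof -
  note arrs = triangle_arr[OF t]
  note rot = triangle_rotate[OF t]
  have Z: "arr C Z Z (Ide C Z)" using arrs by simp
  have "h \<cdot> Ide C Z = Zero C Z (Susp C X)" using h arrs by simp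
  then obtain j where j: "arr C Z Y j" "g \<cdot> j = Ide C Z" using triangle_weak_kernel_1[OF rot Z] by blast
  have d: "arr C Y Y (Ide C Y \<boxplus> \<ominus> (j \<cdot> g))" using j arrs by simp
  have "g \<cdot> (j \<cdot> g) = Ide C Z \<cdot> g" by (rule comp_reduce[OF j(2)]) (use j arrs in auto)
  then have "g \<cdot> (Ide C Y \<boxplus> \<ominus> (j \<cdot> g)) = Zero C Y Z" using j(1) arrs by simp
  then obtain p where p: "arr C Y X p" "f \<cdot> p = Ide C Y \<boxplus> \<ominus> (j \<cdot> g)"
    using triangle_weak_kernel_1[OF t d] by blast
  have f_monic: "u = Zero C Q X" if u: "arr C Q X u" "f \<cdot> u = Zero C Q Y" for Q u
  proof -
    have "\<ominus> (SuspM C f) \<cdot> SuspM C u = \<ominus> (SuspM C (f \<cdot> u))" using u(1) arrs by simp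
    also have "SuspM C (f \<cdot> u) = SuspM C (Zero C Q Y)" by (simp only: u(2))
    also have "\<ominus> \<dots> = Zero C (Susp C Q) (Susp C Y)" using u(1) arrs by simp
    finally obtain c where c: "arr C (Susp C Q) Z c" "h \<cdot> c = SuspM C u"
      using triangle_weak_kernel_1[OF triangle_rotate[OF rot], of "Susp C Q" "SuspM C u"] u(1) by auto
    then have "SuspM C u = SuspM C (Zero C Q X)" using h u(1) arrs by simp
    then show ?thesis by (rule susp_inject) (use u(1) arrs in simp_all)
  qed
  have fp: "f \<cdot> p \<boxplus> j \<cdot> g = Ide C Y" unfolding p(2) by (rule add_diff_cancel) (use j arrs in auto)
  have gf: "g \<cdot> f = Zero C X Z" by (rule triangle_comp_zero[OF t])
  have "f \<cdot> (p \<cdot> j) = (Ide C Y \<boxplus> \<ominus> (j \<cdot> g)) \<cdot> j"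
    by (rule comp_reduce[OF p(2)]) (use p j(1) arrs in auto)
  also have "\<dots> = Zero C Z Y" using j arrs by simp
  finally have pj: "p \<cdot> j = Zero C Z X" by (rule f_monic[rotated]) (use p(1) j(1) in simp)
  have "f \<cdot> (p \<cdot> f) = (Ide C Y \<boxplus> \<ominus> (j \<cdot> g)) \<cdot> f"
    by (rule comp_reduce[OF p(2)]) (use p j(1) arrs in auto)
  also have "\<dots> = f" using j(1) arrs gf by simp
  finally have "f \<cdot> (p \<cdot> f \<boxplus> \<ominus> (Ide C X)) = Zero C X Y" using p(1) arrs by simp
  then have "p \<cdot> f \<boxplus> \<ominus> (Ide C X) = Zero C X X" by (rule f_monic[rotated]) (use p(1) arrs in simp)
  then have "p \<cdot> f = Ide C X" using diff_eq_zero_iff[of "p \<cdot> f" "Ide C X"] p(1) arrs by simp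
  then show ?thesis
    unfolding is_biproduct_def using j p pj gf fp arrs
    by (intro exI[of _ p] exI[of _ j]) (simp add: hom_iff)
qed

lemma triangle_octahedron:
  assumes "triangle C X Y Z' f u u'" "triangle C Y Z X' g v v'" "triangle C X Z Y' (g \<cdot> f) w w'"
  obtains m n k where "triangle C Z' Y' X' m n k"
  using TR4[OF assms] by blast

text \<open>
  The octahedral axiom applied to \<open>p\<close> and \<open>q\<close> produces a triangle on the cones \<open>\<Sigma>A\<close>, \<open>\<Sigma>K\<close>, \<open>\<Sigma>U\<close>.
\<close>

lemma octahedron_of_fibres:
  assumes 1: "triangle C A X T i p j" and 2: "triangle C V U T f g q" and 3: "triangle C V K X f' g' (q \<cdot> p)"
  obtains f'' g'' h'' where "triangle C A K U f'' g'' h''"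
proof -
  note rot = triangle_rotate[OF 1] triangle_rotate[OF triangle_rotate[OF 2]] triangle_rotate[OF triangle_rotate[OF 3]]
  obtain m n k where "triangle C (Susp C A) (Susp C K) (Susp C U) m n k"
    by (rule triangle_octahedron[OF rot])
  then show thesis
    using triangle_desuspend that triangle_arr[OF 1] triangle_arr[OF 2] triangle_arr[OF 3] by (meson arr_objs)
qed

end

section \<open>Twin cotorsion pairs in a triangulated category\<close>

context triangulated_category begin

lemma Ext1_vanishesD:
  "Ext1_vanishes C U V \<Longrightarrow> X \<in> U \<Longrightarrow> Y \<in> V \<Longrightarrow> arr C X (Susp C Y) f \<Longrightarrow> f = Zero C X (Susp C Y)"
  unfolding Ext1_vanishes_def Ext1_def using arr_hom by fastforce

lemma cotorsion_pairD:
  assumes "cotorsion_pair C U V"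
  shows "U \<subseteq> Obj C" "V \<subseteq> Obj C"
    "\<And>X Y. X \<in> U \<Longrightarrow> isomorphic C X Y \<Longrightarrow> Y \<in> U"
    "\<And>X Y P i j p q. is_biproduct C X Y P i j p q \<Longrightarrow> P \<in> U \<Longrightarrow> X \<in> U \<and> Y \<in> U"
    "\<And>X Y P i j p q. is_biproduct C X Y P i j p q \<Longrightarrow> P \<in> V \<Longrightarrow> X \<in> V \<and> Y \<in> V"
    "\<And>X Y f. X \<in> U \<Longrightarrow> Y \<in> V \<Longrightarrow> arr C X (Susp C Y) f \<Longrightarrow> f = Zero C X (Susp C Y)"
proof -
  have sub: "additive_subcategory C U" "additive_subcategory C V"
    and iso: "closed_under_isos C U"
    and sum: "closed_under_summands C U" "closed_under_summands C V"
    and ext: "Ext1_vanishes C U V"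
    using assms unfolding cotorsion_pair_def by blast+
  show "U \<subseteq> Obj C" "V \<subseteq> Obj C" using sub unfolding additive_subcategory_def by blast+
  show "\<And>X Y. X \<in> U \<Longrightarrow> isomorphic C X Y \<Longrightarrow> Y \<in> U"
    using iso unfolding closed_under_isos_def by blast
  show "\<And>X Y P i j p q. is_biproduct C X Y P i j p q \<Longrightarrow> P \<in> U \<Longrightarrow> X \<in> U \<and> Y \<in> U"
    "\<And>X Y P i j p q. is_biproduct C X Y P i j p q \<Longrightarrow> P \<in> V \<Longrightarrow> X \<in> V \<and> Y \<in> V"
    using sum unfolding closed_under_summands_def by metis+
  show "\<And>X Y f. X \<in> U \<Longrightarrow> Y \<in> V \<Longrightarrow> arr C X (Susp C Y) f \<Longrightarrow> f = Zero C X (Susp C Y)"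
    by (rule Ext1_vanishesD[OF ext])
qed

lemma cotorsion_pair_triangle:
  assumes "cotorsion_pair C U V" "X \<in> Obj C"
  obtains A B f g h where "A \<in> U" "B \<in> V" "triangle C A X (Susp C B) f g h"
proof -
  have "X \<in> star C U (susp_set C V)" using assms unfolding cotorsion_pair_def by simp
  then obtain A Y f g h where t: "A \<in> U" "Y \<in> susp_set C V" "triangle C A X Y f g h"
    unfolding star_def by blast
  then obtain B where B: "B \<in> V" "isomorphic C (Susp C B) Y" unfolding susp_set_def by blast
  show thesis
    using triangle_replace_third[OF t(3) isomorphic_sym[OF B(2)]] that[OF t(1) B(1)] by blast
qed

lemma susp_desusp_set:
  assumes "cotorsion_pair C S T" "A \<in> desusp_set C S"
  shows "Susp C A \<in> S"
  using assms(2) cotorsion_pairD(3)[OF assms(1)] isomorphic_sym unfolding desusp_set_def by blast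

lemma desusp_set_objects: "desusp_set C S \<subseteq> Obj C"
  by (auto simp: desusp_set_def)

text \<open>
  Desuspend the approximation triangle of \<open>\<Sigma>X\<close>.
\<close>

lemma cotorsion_pair_desuspended_triangle:
  assumes "cotorsion_pair C S T" "X \<in> Obj C"
  obtains A B f g h where "A \<in> desusp_set C S" "B \<in> T" "triangle C A X B f g h"
proof -
  obtain A' B f g h where 1: "A' \<in> S" "B \<in> T" "triangle C A' (Susp C X) (Susp C B) f g h"
    using cotorsion_pair_triangle[OF assms(1) susp_obj[OF assms(2)]] .
  obtain A where A: "A \<in> Obj C" "isomorphic C (Susp C A) A'"
    using susp_ess_surj cotorsion_pairD(1)[OF assms(1)] 1(1) by blast
  obtain f' h' where "triangle C (Susp C A) (Susp C X) (Susp C B) f' g h'"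
    using triangle_replace_first[OF 1(3) isomorphic_sym[OF A(2)]] .
  then obtain f'' g'' h'' where "triangle C A X B f'' g'' h''"
    using triangle_desuspend A(1) assms(2) 1(2) cotorsion_pairD(2)[OF assms(1)] by blast
  moreover have "A \<in> desusp_set C S" using A 1(1) unfolding desusp_set_def by blast
  ultimately show thesis using that 1(2) by blast
qed

lemma cotorsion_pair_extended_triangle:
  assumes "cotorsion_pair C U V" "X \<in> Obj C"
  obtains B A f g h where "B \<in> V" "A \<in> U" "triangle C B A X f g h"
proof -
  obtain A B f g h where 1: "A \<in> U" "B \<in> V" "triangle C A X (Susp C B) f g h"
    using cotorsion_pair_triangle[OF assms] .
  have "B \<in> Obj C" using 1(2) cotorsion_pairD(2)[OF assms(1)] by blast
  then obtain e where "triangle C B A X e f g" using triangle_unrotate[OF 1(3)] by blast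
  then show thesis by (rule that[OF 1(2,1)])
qed

lemma desuspended_hom_zero:
  assumes "arr C A B f" "\<And>g. arr C (Susp C A) (Susp C B) g \<Longrightarrow> g = Zero C (Susp C A) (Susp C B)"
  shows "f = Zero C A B"
proof -
  have "SuspM C f = SuspM C (Zero C A B)" using assms(2)[of "SuspM C f"] assms(1) by simp
  then show ?thesis by (rule susp_inject) (use assms(1) in simp_all)
qed

text \<open>
  The characterizations of \<open>T\<close> and \<open>U\<close> by orthogonality come from closure under direct summands: if
  the relevant map of the approximation triangle of \<open>X\<close> vanishes, that triangle splits and \<open>X\<close>
  is a summand of its approximation.
\<close>

lemma twin_sequences_triangles:
  assumes "twin_cotorsion_pair C S T U V"
  shows "twin_sequences C (\<lambda>X Y Z W f g h. W = Susp C X \<and> triangle C X Y Z f g h)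
    (desusp_set C S) (Susp C ` desusp_set C S) T U V (Susp C ` V)"
proof -
  have ST: "cotorsion_pair C S T" and UV: "cotorsion_pair C U V"
    and SV: "\<And>X Y f. X \<in> S \<Longrightarrow> Y \<in> V \<Longrightarrow> arr C X (Susp C Y) f \<Longrightarrow> f = Zero C X (Susp C Y)"
    using assms Ext1_vanishesD[of S V] unfolding twin_cotorsion_pair_def by simp_all
  note ST' = cotorsion_pairD[OF ST] note UV' = cotorsion_pairD[OF UV]
  have ex_cone: "\<exists>M. \<exists>s \<in> Susp C ` A. \<exists>g h. s = Susp C a \<and> triangle C a Y M f g h"
    if a: "a \<in> A" "arr C a Y f" for a Y f A
  proof -
    obtain M g h where "triangle C a Y M f g h" using TR1_cone a(2) arr_hom arr_objs by metis
    then show ?thesis using a(1) by blast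
  qed
  have ex_fibre: "\<exists>v \<in> A. \<exists>L f g. w = Susp C v \<and> triangle C v L Y f g h"
    if w: "w \<in> Susp C ` A" "arr C Y w h" "A \<subseteq> Obj C" for w Y h A
  proof -
    obtain v where v: "v \<in> A" "w = Susp C v" using w(1) by blast
    obtain L f g where "triangle C v L Y f g h"
      using triangle_complete[of Y v h] w(2,3) v by blast
    then show ?thesis using v by blast
  qed
  show ?thesis
  proof (unfold_locales; (elim conjE)?)
    fix X Y Z W f g h assume W: "W = Susp C X" and t: "triangle C X Y Z f g h"
    show "arr C X Y f \<and> arr C Y Z g \<and> arr C Z W h" using triangle_arr[OF t] W by blast
    show "g \<cdot> f = Zero C X Z \<and> h \<cdot> g = Zero C Y W" using triangle_comp_zero[OF t] W by blast
    fix Q z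
    show "\<exists>u. arr C Q X u \<and> f \<cdot> u = z" if "arr C Q Y z" "g \<cdot> z = Zero C Q Z"
      using triangle_weak_kernel_1[OF t that] .
    show "\<exists>u. arr C Q Y u \<and> g \<cdot> u = z" if "arr C Q Z z" "h \<cdot> z = Zero C Q W"
      using triangle_weak_kernel_1[OF triangle_rotate[OF t]] that W by blast
    show "\<exists>u. arr C Z Q u \<and> u \<cdot> g = z" if "arr C Y Q z" "z \<cdot> f = Zero C X Q"
      using triangle_weak_cokernel_1[OF t that] .
    show "\<exists>u. arr C W Q u \<and> u \<cdot> h = z" if "arr C Z Q z" "z \<cdot> g = Zero C Y Q"
      using triangle_weak_cokernel_1[OF triangle_rotate[OF t]] that W by blast
  next
    show "T \<subseteq> Obj C" "U \<subseteq> Obj C" "desusp_set C S \<subseteq> Obj C" "Susp C ` V \<subseteq> Obj C"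
      using ST'(2) UV'(1,2) desusp_set_objects susp_obj by auto
  next
    fix X assume "X \<in> Obj C"
    show "\<exists>a \<in> desusp_set C S. \<exists>t \<in> T. \<exists>s \<in> Susp C ` desusp_set C S. \<exists>f g h.
        s = Susp C a \<and> triangle C a X t f g h"
      by (rule cotorsion_pair_desuspended_triangle[OF ST \<open>X \<in> Obj C\<close>]) blast
    show "\<exists>v \<in> V. \<exists>u \<in> U. \<exists>w \<in> Susp C ` V. \<exists>f g h. w = Susp C v \<and> triangle C v u X f g h"
      by (rule cotorsion_pair_extended_triangle[OF UV \<open>X \<in> Obj C\<close>]) blast
  next
    fix a Y f assume "a \<in> desusp_set C S" "arr C a Y f"
    then show "\<exists>M. \<exists>s \<in> Susp C ` desusp_set C S. \<exists>g h. s = Susp C a \<and> triangle C a Y M f g h"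
      by (rule ex_cone)
  next
    fix v Y f assume "v \<in> V" "arr C v Y f"
    then show "\<exists>M. \<exists>s \<in> Susp C ` V. \<exists>g h. s = Susp C v \<and> triangle C v Y M f g h"
      by (rule ex_cone)
  next
    fix w Y h assume "w \<in> Susp C ` V" "arr C Y w h"
    then show "\<exists>v \<in> V. \<exists>L f g. w = Susp C v \<and> triangle C v L Y f g h"
      using ex_fibre UV'(2) by blast
  next
    fix w Y h assume "w \<in> Susp C ` desusp_set C S" "arr C Y w h"
    then show "\<exists>v \<in> desusp_set C S. \<exists>L f g. w = Susp C v \<and> triangle C v L Y f g h"
      using ex_fibre desusp_set_objects by blast
  next
    fix a X t s i p j v u w f g q
    assume s: "s = Susp C a" and w: "w = Susp C v"
      and 1: "triangle C a X t i p j" and 2: "triangle C v u t f g q"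
    have "arr C X (Susp C v) (q \<cdot> p)" "v \<in> Obj C" using triangle_arr[OF 1] triangle_arr[OF 2] by auto
    then obtain K f' g' where K: "triangle C v K X f' g' (q \<cdot> p)" using triangle_complete by blast
    then obtain f'' g'' h'' where "triangle C a K u f'' g'' h''" using octahedron_of_fibres[OF 1 2] by blast
    then show "\<exists>K f' g' f'' g'' h''. (w = Susp C v \<and> triangle C v K X f' g' (q \<cdot> p)) \<and>
        s = Susp C a \<and> triangle C a K u f'' g'' h''" using K s w by blast
  next
    fix v u X w j r i a t s q g h
    assume s: "s = Susp C a" and w: "w = Susp C v"
      and 1: "triangle C v u X j r i" and 2: "triangle C a u t q g h"
    note arrs = triangle_arr[OF 1] triangle_arr[OF 2]
    have "arr C a X (r \<cdot> q)" using arrs by auto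
    then obtain K g' h' where K: "triangle C a X K (r \<cdot> q) g' h'" using TR1_cone arr_hom arr_objs by metis
    obtain m n k where "triangle C t K (Susp C v) m n k"
      by (rule triangle_octahedron[OF 2 triangle_rotate[OF 1] K])
    moreover have "v \<in> Obj C" using arrs by simp
    ultimately obtain f'' where "triangle C v t K f'' m n" using triangle_unrotate by blast
    then show "\<exists>K g' h' f'' g'' h''. (s = Susp C a \<and> triangle C a X K (r \<cdot> q) g' h') \<and>
        w = Susp C v \<and> triangle C v t K f'' g'' h''" using K s w by blast
  next
    fix a t f assume a: "a \<in> desusp_set C S" and f: "arr C a t f"
    note Sa = susp_desusp_set[OF ST a]
    show "f = Zero C a t" if "t \<in> T" using desuspended_hom_zero[OF f] ST'(6)[OF Sa that] by blast
    show "f = Zero C a t" if "t \<in> V" using desuspended_hom_zero[OF f] SV[OF Sa that] by blast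
  next
    fix u w f assume w: "w \<in> Susp C ` V" and f: "arr C u w f"
    show "f = Zero C u w" if "u \<in> U" using UV'(6) w f that by blast
    show "f = Zero C u w" if "u \<in> Susp C ` desusp_set C S"
      using SV susp_desusp_set[OF ST] w f that by blast
  next
    fix X assume X: "X \<in> Obj C" and hom: "\<And>a f. a \<in> desusp_set C S \<Longrightarrow> arr C a X f \<Longrightarrow> f = Zero C a X"
    obtain a t f g h where 1: "a \<in> desusp_set C S" "t \<in> T" "triangle C a X t f g h"
      using cotorsion_pair_desuspended_triangle[OF ST X] .
    note arrs = triangle_arr[OF 1(3)]
    have "f = Zero C a X" using hom 1(1) arrs by blast
    then have "\<ominus> (SuspM C f) = Zero C (Susp C a) (Susp C X)" using arrs by simp
    then show "X \<in> T" using triangle_split[OF triangle_rotate[OF 1(3)]] ST'(5) 1(2) by blast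
  next
    fix X assume X: "X \<in> Obj C" and hom: "\<And>w f. w \<in> Susp C ` V \<Longrightarrow> arr C X w f \<Longrightarrow> f = Zero C X w"
    obtain v u f g h where 1: "v \<in> V" "u \<in> U" "triangle C v u X f g h"
      using cotorsion_pair_extended_triangle[OF UV X] .
    have "h = Zero C X (Susp C v)" using hom[of "Susp C v"] 1(1) triangle_arr[OF 1(3)] by blast
    then show "X \<in> U" using triangle_split[OF 1(3)] UV'(4) 1(2) by blast
  qed
qed

end

theorem theorem3p4:
  fixes C :: "('o, 'm, 'z) tcat_scheme"
    and S T U V :: "'o set"
  assumes "triangulated_category C"
    and "twin_cotorsion_pair C S T U V"
    and "twin_H C S T U V = twin_C_minus C S T U \<or> twin_H C S T U V = twin_C_plus C T U V"
  shows "quasi_abelian_category (heart C S T U V)"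
proof -
  interpret triangulated_category C by fact
  interpret twin_sequences C "\<lambda>X Y Z W f g h. W = Susp C X \<and> triangle C X Y Z f g h"
    "desusp_set C S" "Susp C ` desusp_set C S" T U V "Susp C ` V"
    by (rule twin_sequences_triangles) fact
  have UV: "cotorsion_pair C U V" using assms(2) unfolding twin_cotorsion_pair_def by blast
  have minus: "twin_C_minus C S T U = Cminus"
  proof (intro equalityI subsetI)
    fix X assume "X \<in> twin_C_minus C S T U"
    then obtain a t f g h where t: "a \<in> desusp_set C S" "t \<in> T \<inter> U" "triangle C a X t f g h"
      unfolding twin_C_minus_def star_def twin_W_def by blast
    show "X \<in> Cminus"
      by (rule Cminus_extension[OF conjI[OF refl t(3)] t(1)]) (use t(2) U_sub_Cminus in blast)
  next
    fix X assume X: "X \<in> Cminus"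
    then obtain a t s f g h where "a \<in> desusp_set C S" "t \<in> T \<inter> U" "triangle C a X t f g h"
      by (rule Cminus_seqE) blast
    then show "X \<in> twin_C_minus C S T U"
      unfolding twin_C_minus_def star_def twin_W_def using X Cminus_objects by blast
  qed
  have plus: "twin_C_plus C T U V = Cplus"
  proof (intro equalityI subsetI)
    fix X assume "X \<in> twin_C_plus C T U V"
    then obtain t Y f g h where t: "t \<in> T \<inter> U" "Y \<in> susp_set C V" "triangle C t X Y f g h"
      unfolding twin_C_plus_def star_def twin_W_def by blast
    then obtain v where v: "v \<in> V" "isomorphic C (Susp C v) Y" unfolding susp_set_def by blast
    obtain g' h' where "triangle C t X (Susp C v) f g' h'"
      using triangle_replace_third[OF t(3) isomorphic_sym[OF v(2)]] .
    then obtain e where "triangle C v t X e f g'"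
      using triangle_unrotate v(1) cotorsion_pairD(2)[OF UV] by blast
    then show "X \<in> Cplus"
      using Cplus_cone[OF conjI[OF refl]] t(1) v(1) by blast
  next
    fix X assume X: "X \<in> Cplus"
    then obtain v t f g h where t: "v \<in> V" "t \<in> T \<inter> U" "triangle C v t X f g h"
      by (rule Cplus_seqE) blast
    have "Susp C v \<in> susp_set C V"
      using t(1) cotorsion_pairD(2)[OF UV] susp_obj ide_iso[of "Susp C v"]
      unfolding susp_set_def isomorphic_def by blast
    moreover have "X \<in> Obj C" using triangle_arr[OF t(3)] by simp
    ultimately show "X \<in> twin_C_plus C T U V"
      unfolding twin_C_plus_def star_def twin_W_def using t(2) triangle_rotate[OF t(3)] by blast
  qed
  have "Cminus \<subseteq> Cplus \<or> Cplus \<subseteq> Cminus"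
    using assms(3) unfolding twin_H_def minus plus by blast
  then show ?thesis
    using heart_quasi_abelian unfolding heart_def twin_H_def minus plus twin_W_def by blast
qed

end
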